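(* There exist a constant $\alpha \ge 1$ and a polynomial-time algorithm which, given a planar graph $G=(V,E)$ with cost, capacity and demand on each vertex as an instance of the capacitated domination problem, computes a feasible demand assignment function $f$ for $G$ with $w(f) \le \alpha \cdot w(f')$ for every feasible demand assignment function $f'$ for $G$.
   Context: All graphs are simple and undirected. An instance of capacitated domination is a graph $G=(V,E)$ with three non-negative parameters on each vertex $u\in V$: cost $w(u)$, capacity $c(u)$ and demand $d(u)$. $N[v]=N(v)\cup\{v\}$ is the closed neighbourhood of $v$. A demand assignment function is a function $f$ mapping pairs of vertices to non-negative reals ($f(u,v)$ is the amount of demand of $u$ assigned to $v$). It is feasible if $\sum_{u\in N[v]} f(v,u)\ge d(v)$ for each $v\in V$. The multiplicity of $v$ under $f$ is $x_f(v)=\left\lceil \frac{\sum_{u\in N[v]} f(u,v)}{c(v)}\right\rceil$, and the cost of $f$ is $w(f)=\sum_{u\in V} w(u)\,x_f(u)$. The capacitated domination problem asks for a feasible demand assignment function of minimum cost. *)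

theory Defs
  imports "HOL-Analysis.Analysis" "HOL-Computational_Algebra.Polynomial"
begin

record 'a cap_graph =
  verts :: "'a set"
  edges :: "'a set set"
  cost :: "'a \<Rightarrow> real"
  capacity :: "'a \<Rightarrow> real"
  demand :: "'a \<Rightarrow> real"

definition cap_instance :: "'a cap_graph \<Rightarrow> bool" where
  "cap_instance G \<longleftrightarrow>
     finite (verts G) \<and>
     (\<forall>e\<in>edges G. e \<subseteq> verts G \<and> card e = 2) \<and>
     (\<forall>v\<in>verts G. 0 \<le> cost G v \<and> 0 \<le> capacity G v \<and> 0 \<le> demand G v)"

definition closed_nbhd :: "'a cap_graph \<Rightarrow> 'a \<Rightarrow> 'a set" where
  "closed_nbhd G v = insert v {u \<in> verts G. {u, v} \<in> edges G}"

definition demand_assignment :: "'a cap_graph \<Rightarrow> ('a \<Rightarrow> 'a \<Rightarrow> real) \<Rightarrow> bool" where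
  "demand_assignment G f \<longleftrightarrow> (\<forall>u\<in>verts G. \<forall>v\<in>verts G. 0 \<le> f u v)"

definition feasible :: "'a cap_graph \<Rightarrow> ('a \<Rightarrow> 'a \<Rightarrow> real) \<Rightarrow> bool" where
  "feasible G f \<longleftrightarrow>
     demand_assignment G f \<and> (\<forall>v\<in>verts G. (\<Sum>u\<in>closed_nbhd G v. f v u) \<ge> demand G v)"

definition assigned_load :: "'a cap_graph \<Rightarrow> ('a \<Rightarrow> 'a \<Rightarrow> real) \<Rightarrow> 'a \<Rightarrow> real" where
  "assigned_load G f v = (\<Sum>u\<in>closed_nbhd G v. f u v)"

definition multiplicity_of :: "'a cap_graph \<Rightarrow> ('a \<Rightarrow> 'a \<Rightarrow> real) \<Rightarrow> 'a \<Rightarrow> int" where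
  "multiplicity_of G f v = \<lceil>assigned_load G f v / capacity G v\<rceil>"

text \<open>
  A vertex of capacity zero cannot serve a positive amount of demand: no number of copies
  suffices, and the division by zero in the multiplicity (which HOL evaluates to zero) must not
  make such service free. An assignment that does this has infinite cost. A vertex of capacity
  zero with no load has multiplicity zero.
\<close>

definition assignment_cost :: "'a cap_graph \<Rightarrow> ('a \<Rightarrow> 'a \<Rightarrow> real) \<Rightarrow> ereal" where
  "assignment_cost G f =
     (if \<exists>v\<in>verts G. capacity G v = 0 \<and> 0 < assigned_load G f v then \<infinity>
      else ereal (\<Sum>v\<in>verts G. cost G v * of_int (multiplicity_of G f v)))"

text \<open>
  A drawing in the plane: distinct vertices are distinct points, an edge is an arc joining its
  ends and containing no other vertex, and two edges meet only in common ends.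
\<close>

definition planar :: "'a cap_graph \<Rightarrow> bool" where
  "planar G \<longleftrightarrow>
     (\<exists>(pos :: 'a \<Rightarrow> complex) (\<gamma> :: 'a set \<Rightarrow> real \<Rightarrow> complex).
        inj_on pos (verts G) \<and>
        (\<forall>e\<in>edges G. arc (\<gamma> e) \<and> {pathstart (\<gamma> e), pathfinish (\<gamma> e)} = pos ` e
           \<and> path_image (\<gamma> e) \<inter> pos ` verts G = pos ` e) \<and>
        (\<forall>e\<in>edges G. \<forall>e'\<in>edges G. e \<noteq> e' \<longrightarrow>
           path_image (\<gamma> e) \<inter> path_image (\<gamma> e') = pos ` (e \<inter> e')))"

text \<open>
  The model of computation is a random access machine whose memory cells, addressed by natural
  numbers, hold natural numbers, programmed with structured control flow. Every operation is
  charged the binary length of all the numbers and addresses it involves (the logarithmic cost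
  criterion), so that polynomial time here coincides with polynomial time on Turing machines,
  although multiplication and division are primitive.
\<close>

type_synonym memory = "nat \<Rightarrow> nat"

datatype ram_exp =
    Lit nat
  | Deref ram_exp  \<comment> \<open>content of the cell whose address is the value of the argument\<close>
  | Add ram_exp ram_exp
  | Sub ram_exp ram_exp  \<comment> \<open>truncated at zero\<close>
  | Mul ram_exp ram_exp
  | Quot ram_exp ram_exp

datatype ram_prog =
    Skip
  | Store ram_exp ram_exp  \<comment> \<open>address, new content\<close>
  | Seq ram_prog ram_prog
  | Cond ram_exp ram_prog ram_prog  \<comment> \<open>nonzero means true, here and in loops\<close>
  | Loop ram_exp ram_prog

fun bit_length :: "nat \<Rightarrow> nat" where
  "bit_length n = (if n < 2 then 1 else Suc (bit_length (n div 2)))"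

declare bit_length.simps [simp del]

definition bit_size :: "nat list \<Rightarrow> nat" where
  "bit_size xs = sum_list (map bit_length xs)"

fun exp_val :: "ram_exp \<Rightarrow> memory \<Rightarrow> nat" where
  "exp_val (Lit n) s = n"
| "exp_val (Deref a) s = s (exp_val a s)"
| "exp_val (Add a b) s = exp_val a s + exp_val b s"
| "exp_val (Sub a b) s = exp_val a s - exp_val b s"
| "exp_val (Mul a b) s = exp_val a s * exp_val b s"
| "exp_val (Quot a b) s = exp_val a s div exp_val b s"

fun exp_time :: "ram_exp \<Rightarrow> memory \<Rightarrow> nat" where
  "exp_time (Lit n) s = bit_length n"
| "exp_time (Deref a) s = exp_time a s + bit_length (exp_val (Deref a) s)"
| "exp_time (Add a b) s = exp_time a s + exp_time b s + bit_length (exp_val (Add a b) s)"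
| "exp_time (Sub a b) s = exp_time a s + exp_time b s + bit_length (exp_val (Sub a b) s)"
| "exp_time (Mul a b) s = exp_time a s + exp_time b s + bit_length (exp_val (Mul a b) s)"
| "exp_time (Quot a b) s = exp_time a s + exp_time b s + bit_length (exp_val (Quot a b) s)"

text \<open>\<open>ram_run P s t s'\<close>: started in \<open>s\<close>, \<open>P\<close> halts in \<open>s'\<close> after time \<open>t\<close>.\<close>

inductive ram_run :: "ram_prog \<Rightarrow> memory \<Rightarrow> nat \<Rightarrow> memory \<Rightarrow> bool" where
  Skip: "ram_run Skip s 1 s"
| Store: "ram_run (Store a b) s (1 + exp_time a s + exp_time b s) (s(exp_val a s := exp_val b s))"
| Seq: "ram_run P s t s' \<Longrightarrow> ram_run Q s' t' s'' \<Longrightarrow> ram_run (Seq P Q) s (t + t') s''"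
| CondTrue: "exp_val b s \<noteq> 0 \<Longrightarrow> ram_run P s t s' \<Longrightarrow>
    ram_run (Cond b P Q) s (1 + exp_time b s + t) s'"
| CondFalse: "exp_val b s = 0 \<Longrightarrow> ram_run Q s t s' \<Longrightarrow>
    ram_run (Cond b P Q) s (1 + exp_time b s + t) s'"
| LoopFalse: "exp_val b s = 0 \<Longrightarrow> ram_run (Loop b P) s (1 + exp_time b s) s"
| LoopTrue: "exp_val b s \<noteq> 0 \<Longrightarrow> ram_run P s t s' \<Longrightarrow> ram_run (Loop b P) s' t' s'' \<Longrightarrow>
    ram_run (Loop b P) s (1 + exp_time b s + t + t') s''"

lemma ram_run_deterministic:
  "ram_run P s t s' \<Longrightarrow> ram_run P s u s'' \<Longrightarrow> u = t \<and> s'' = s'"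
proof (induction arbitrary: u s'' rule: ram_run.induct)
  case (Skip s)
  from Skip.prems show ?case by cases auto
next
  case (Store a b s)
  from Store.prems show ?case by cases auto
next
  case (Seq P s t s' Q t' s3)
  from Seq.prems show ?case by cases (use Seq.IH in blast)
next
  case (CondTrue b s P t s' Q)
  from CondTrue.prems show ?case by cases (use CondTrue.hyps CondTrue.IH in blast)+
next
  case (CondFalse b s Q t s' P)
  from CondFalse.prems show ?case by cases (use CondFalse.hyps CondFalse.IH in blast)+
next
  case (LoopFalse b s P)
  from LoopFalse.prems show ?case by cases (use LoopFalse.hyps in auto)
next
  case (LoopTrue b s P t s' t' s3)
  from LoopTrue.prems show ?case by cases (use LoopTrue.hyps LoopTrue.IH in blast)+
qed

text \<open>A list is stored with its length in cell 0 and its elements in the cells from 1 on.\<close>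

definition input_memory :: "nat list \<Rightarrow> memory" where
  "input_memory xs i =
     (if i = 0 then length xs else if i \<le> length xs then xs ! (i - 1) else 0)"

definition output_list :: "memory \<Rightarrow> nat list" where
  "output_list s = map s [1..<Suc (s 0)]"

text \<open>
  The size of the output is added to the running time because a program could otherwise claim
  an arbitrarily long output of untouched cells merely by writing a large number to cell 0.
\<close>

definition ram_computes :: "ram_prog \<Rightarrow> nat list \<Rightarrow> nat \<Rightarrow> nat list \<Rightarrow> bool" where
  "ram_computes P xs t ys \<longleftrightarrow>
     (\<exists>t' s. ram_run P (input_memory xs) t' s \<and> ys = output_list s \<and> t = t' + bit_size ys)"

definition is_fraction :: "real \<Rightarrow> nat \<Rightarrow> nat \<Rightarrow> bool" where
  "is_fraction x a b \<longleftrightarrow> b \<noteq> 0 \<and> x = real a / real b"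

text \<open>
  An instance on the vertices \<open>0, \<dots>, n - 1\<close> with rational parameters is given by \<open>n\<close>, the
  adjacency matrix, and numerator and denominator of cost, capacity and demand of each vertex.
  Fractions need not be in lowest terms.
\<close>

definition encodes_instance :: "nat list \<Rightarrow> nat cap_graph \<Rightarrow> bool" where
  "encodes_instance xs G \<longleftrightarrow>
     (\<exists>n. verts G = {..<n} \<and> length xs = 1 + n * n + 6 * n \<and> xs ! 0 = n \<and>
        (\<forall>u<n. \<forall>v<n. xs ! (1 + u * n + v) = (if {u, v} \<in> edges G then 1 else 0)) \<and>
        (\<forall>v<n. let k = 1 + n * n + 6 * v in
           is_fraction (cost G v) (xs ! k) (xs ! (k + 1)) \<and>
           is_fraction (capacity G v) (xs ! (k + 2)) (xs ! (k + 3)) \<and>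
           is_fraction (demand G v) (xs ! (k + 4)) (xs ! (k + 5))))"

definition encodes_assignment ::
  "nat list \<Rightarrow> nat cap_graph \<Rightarrow> (nat \<Rightarrow> nat \<Rightarrow> real) \<Rightarrow> bool" where
  "encodes_assignment ys G f \<longleftrightarrow>
     (\<exists>n. verts G = {..<n} \<and> length ys = 2 * (n * n) \<and>
        (\<forall>u<n. \<forall>v<n. let k = 2 * (u * n + v) in
           is_fraction (f u v) (ys ! k) (ys ! (k + 1))))"

end

theory Submission
  imports Defs
begin

text \<open>
  Up to a constant factor, using a vertex \<open>u\<close> costs \<open>w(u)\<close> for opening it plus \<open>w(u) / c(u)\<close> for
  each unit of demand it serves, which is facility location without capacities, except that a
  client may only use its closed neighbourhood. Eliminate the vertices of the planar graph one by
  one, each with at most 15 remaining neighbours. When \<open>v\<close> is eliminated, it pays \<open>\<alpha>(v)\<close>, the minimum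
  over its closed neighbours of the part of the opening cost not paid so far plus the cost of serving \<open>v\<close>;
  the minimizer serves \<open>v\<close>, and what \<open>\<alpha>(v)\<close> exceeds the service cost is put towards the opening
  costs of \<open>v\<close> and of the remaining neighbours. Every payment is thus used at most 17 times. Conversely, the
  payments of the clients of one facility \<open>u\<close> in an optimal solution are bounded by their service
  costs, plus \<open>w(u)\<close> in total for the clients eliminated not later than \<open>u\<close>, plus \<open>w(u)\<close> for each
  of the boundedly many others.

  That some vertex has at most 15 remaining neighbours holds because a graph of minimum degree 16
  contains three disjoint connected sets with three common neighbours, and a plane drawing of
  these would consist of three arcs between two points together with a third point
  linked to all of them, which Janiszewski's theorem excludes.
\<close>

subsection \<open>Planar graphs have a vertex of small degree\<close>

text \<open>Planarity enters only through degeneracy: every nonempty set of vertices contains one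
  with at most 15 neighbours inside the set. Any constant would do; this one comes from passing
  three times to the neighbourhood of a contracted connected set, which halves the minimum degree
  from 16 down to 2. A client paying towards all its closed neighbours would have its payment
  counted as often as its degree, which is unbounded. Paying only remaining neighbours bounds the
  count, but the later clients of an eliminated facility no longer draw on its budget, and each of
  them may pay up to its whole opening cost. With \<open>D = 15\<close>, a payment is used at most
  \<open>D + 2\<close> times, and a facility of the optimum is charged at most \<open>D + 3\<close>
  times its cost: once by clients drawing on its budget, \<open>D + 1\<close> times by those in
  \<open>out u\<close>, and once for service. The factor is thus 17 * 18 = 306. The machine has only
  natural numbers, so all costs are scaled by one common multiple of the denominators. Its binary
  length is quadratic in the input size, which is what the bounds on cell contents have to
  accommodate.\<close>

text \<open>The side of the curve formed by arcs 0 and 1 that does not contain \<open>x\<close> is joined to \<open>x\<close> avoiding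
  arcs 1 and 2 (through \<open>Q 0\<close>), and avoiding arcs 0 and 2 (through \<open>Q 1\<close>), so by Janiszewski's
  theorem avoiding all three.\<close>

lemma theta_not_linked:
  fixes a b x :: complex and p :: "nat \<Rightarrow> real \<Rightarrow> complex" and q :: "nat \<Rightarrow> complex"
  assumes arcs: "\<And>i. i < 3 \<Longrightarrow> arc (p i) \<and> pathstart (p i) = a \<and> pathfinish (p i) = b"
    and meet: "\<And>i j. i < 3 \<Longrightarrow> j < 3 \<Longrightarrow> i \<noteq> j \<Longrightarrow> path_image (p i) \<inter> path_image (p j) \<subseteq> {a, b}"
    and Q: "\<And>i. i < 3 \<Longrightarrow> connected (Q i) \<and> x \<in> Q i \<and> q i \<in> Q i \<and> q i \<in> path_image (p i) - {a, b}"
    and disj: "\<And>i j. i < 3 \<Longrightarrow> j < 3 \<Longrightarrow> i \<noteq> j \<Longrightarrow> Q i \<inter> path_image (p j) = {}"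
  shows False
proof -
  define P where "P i = path_image (p i)" for i
  have ab: "a \<in> P i" "b \<in> P i" if "i < 3" for i
    using arcs[OF that] unfolding P_def by (metis pathstart_in_path_image pathfinish_in_path_image)+
  have cP: "compact (P i)" "closed (P i)" if "i < 3" for i
    using arcs[OF that] unfolding P_def by (auto intro: compact_arc_image closed_arc_image)
  define c where "c = p 0 +++ reversepath (p 1)"
  have c: "simple_path c" "pathfinish c = pathstart c"
    unfolding c_def using arcs[of 0] arcs[of 1] meet[of 0 1]
    by (auto intro!: simple_path_join_loop simp: arc_reversepath)
  have imc: "path_image c = P 0 \<union> P 1"
    unfolding c_def P_def using arcs[of 0] arcs[of 1] by (simp add: path_image_join)
  have xnot: "x \<notin> P i" if "i < 3" for i
  proof -
    obtain j where "j < 3" "j \<noteq> i" by (metis One_nat_def lessI numeral_3_eq_3 zero_less_Suc zero_neq_one less_Suc_eq)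
    then show ?thesis using Q[of j] disj[of j i] that unfolding P_def by blast
  qed
  define Ins Out where "Ins = inside (P 0 \<union> P 1)" and "Out = outside (P 0 \<union> P 1)"
  have J: "Ins \<noteq> {}" "open Ins" "connected Ins" "Out \<noteq> {}" "open Out" "connected Out" "Ins \<inter> Out = {}"
    "Ins \<union> Out = - (P 0 \<union> P 1)" "frontier Ins = P 0 \<union> P 1" "frontier Out = P 0 \<union> P 1"
    using Jordan_inside_outside[OF c, unfolded imc] unfolding Ins_def Out_def by simp_all
  have "x \<in> Ins \<or> x \<in> Out" using J(8) xnot[of 0] xnot[of 1] by auto
  \<comment> \<open>From here on it does not matter whether \<open>x\<close> lies inside or outside:
    \<open>B\<close> is the side without \<open>x\<close>, and either side has the whole curve as
    its frontier.\<close>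
  then have "\<exists>B B'. B \<noteq> {} \<and> connected B \<and> open B \<and> open B' \<and> B \<inter> B' = {} \<and>
      B \<union> B' = - (P 0 \<union> P 1) \<and> frontier B = P 0 \<union> P 1 \<and> x \<in> B'"
  proof
    assume "x \<in> Ins"
    then show ?thesis using J by (intro exI[of _ Out] exI[of _ Ins]) (simp add: Int_commute Un_commute)
  next
    assume "x \<in> Out"
    then show ?thesis using J by (intro exI[of _ Ins] exI[of _ Out]) simp
  qed
  then obtain B B' where B: "B \<noteq> {}" "connected B" "open B" "open B'" "B \<inter> B' = {}" "B \<union> B' = - (P 0 \<union> P 1)"
      "frontier B = P 0 \<union> P 1" "x \<in> B'"
    by (elim exE conjE) (rule that)
  have sep: "T \<inter> B = {}" if "connected T" "x \<in> T" "T \<inter> (P 0 \<union> P 1) = {}" for T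
    using connectedD[OF that(1) B(3,4)] B that by blast
  have con2: "connected (P 2 - {a, b})"
    using connected_simple_path_endless[OF arc_imp_simple_path, of "p 2"] arcs[of 2] unfolding P_def by auto
  \<comment> \<open>\<open>Q 2\<close> ties the open arc 2 to \<open>x\<close> without touching the
    curve, so arc 2 lies on the side of \<open>x\<close> and cannot cut through
    \<open>B\<close>.\<close>
  have "connected ((P 2 - {a, b}) \<union> Q 2)"
    using con2 Q[of 2] unfolding P_def by (intro connected_Un) auto
  moreover have "((P 2 - {a, b}) \<union> Q 2) \<inter> (P 0 \<union> P 1) = {}"
    using meet[of 2 0] meet[of 2 1] disj[of 2 0] disj[of 2 1] unfolding P_def by auto
  ultimately have PB: "(P 2 - {a, b}) \<inter> B = {}"
    using sep[of "(P 2 - {a, b}) \<union> Q 2"] Q[of 2] by auto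
  then have PB2: "P 2 \<inter> B = {}" using B(6) ab[of 0] by auto
  obtain y where y: "y \<in> B" using B by auto
  have reach: "connected_component (- (P j \<union> P 2)) x y" if ij: "i < 2" "j < 2" "i \<noteq> j" for i j
  proof -
    have lt: "i < 3" "j < 3" using ij by auto
    \<comment> \<open>Since \<open>q i\<close> is on the frontier of \<open>B\<close>, it can be
      added to \<open>B\<close> without losing connectedness. This leads from \<open>Q i\<close>
      into \<open>B\<close> without meeting arc \<open>j\<close>.\<close>
    have "q i \<in> frontier B" using B(7) Q[of i] ij unfolding P_def by (auto simp: less_2_cases_iff)
    then have "insert (q i) B \<subseteq> closure B" using closure_subset by (auto simp: frontier_def)
    then have "connected (insert (q i) B)" by (intro connected_intermediate_closure[OF B(2)]) auto
    then have "connected (insert (q i) B \<union> Q i)" using Q[OF lt(1)] by (intro connected_Un) auto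
    moreover have "insert (q i) B \<union> Q i \<subseteq> - (P j \<union> P 2)"
    proof -
      have "Q i \<inter> P j = {}" "Q i \<inter> P 2 = {}"
        using disj[OF lt ij(3)] disj[OF lt(1), of 2] ij unfolding P_def by auto
      moreover have "B \<inter> P j = {}" using B(6) ij by (auto simp: less_2_cases_iff)
      ultimately show ?thesis using Q[OF lt(1)] PB2 by blast
    qed
    ultimately show ?thesis
      unfolding connected_component_def using y Q[OF lt(1)] by (intro exI[of _ "insert (q i) B \<union> Q i"]) auto
  qed
  have "(P 0 \<union> P 2) \<inter> (P 1 \<union> P 2) = P 2"
    using meet[of 0 1] ab[of 2] unfolding P_def by auto
  moreover have "connected (P 2)"
    using arcs[of 2] unfolding P_def by (auto intro: connected_arc_image)
  ultimately have "connected_component (- ((P 0 \<union> P 2) \<union> (P 1 \<union> P 2))) x y"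
    using cP[of 0] cP[of 1] cP[of 2] reach[of 0 1] reach[of 1 0]
    by (intro Janiszewski[of "P 0 \<union> P 2" "P 1 \<union> P 2"]) (simp_all add: compact_Un closed_Un)
  then obtain T where "connected T" "x \<in> T" "y \<in> T" "T \<subseteq> - ((P 0 \<union> P 2) \<union> (P 1 \<union> P 2))"
    by (auto simp: connected_component_def)
  then show False using sep[of T] y by blast
qed

section \<open>Connected sets with dense common neighbourhoods\<close>

inductive grown :: "('a \<Rightarrow> 'a \<Rightarrow> bool) \<Rightarrow> 'a set \<Rightarrow> bool" for E where
  single: "grown E {v}"
| extend: "grown E U \<Longrightarrow> u \<in> U \<Longrightarrow> E u v \<Longrightarrow> grown E (insert v U)"

lemma grown_nonempty: "grown E U \<Longrightarrow> U \<noteq> {}"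
  by (induction rule: grown.induct) auto

text \<open>Mader's argument: contract a largest connected \<open>U\<close> for which the quotient is still as dense as
  the original graph. A vertex with fewer than \<open>k\<close> neighbours inside the neighbourhood \<open>N U\<close> could be added to \<open>U\<close>.\<close>

lemma dense_grown_neighbourhood:
  fixes E :: "'a \<Rightarrow> 'a \<Rightarrow> bool"
  assumes sym: "\<And>x y. E x y \<Longrightarrow> E y x" and irr: "\<And>x. \<not> E x x"
    and "finite V" "V \<noteq> {}" "0 < k" "2 * k * card V \<le> (\<Sum>v\<in>V. card {u\<in>V. E v u})"
  shows "\<exists>U H. grown E U \<and> U \<subseteq> V \<and> H \<subseteq> V \<and> H \<noteq> {} \<and> U \<inter> H = {} \<and>
     (\<forall>h\<in>H. \<exists>u\<in>U. E u h) \<and> (\<forall>h\<in>H. k \<le> card {u\<in>H. E h u})"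
  using assms(3,4,6)
proof (induction "card V" arbitrary: V rule: less_induct)
  case less
  define e where "e A = (\<Sum>v\<in>A. card {u\<in>A. E v u})" for A
  have e_remove: "e A = e (A - {h}) + 2 * card {u\<in>A. E h u}" if "finite A" "h \<in> A" for A h
  proof -
    define A' where "A' = A - {h}"
    have A: "A = insert h A'" "h \<notin> A'" "finite A'" using that by (auto simp: A'_def)
    have deg: "card {u\<in>A. E v u} = card {u\<in>A'. E v u} + (if E h v then 1 else 0)" if "v \<in> A'" for v
    proof -
      have "{u\<in>A. E v u} = (if E h v then insert h {u\<in>A'. E v u} else {u\<in>A'. E v u})"
        using A(1) sym by auto
      then show ?thesis using A by auto
    qed
    have "{u\<in>A. E h u} = {u\<in>A'. E h u}" using A irr by auto
    moreover have "card {u\<in>A'. E h u} = (\<Sum>v\<in>A'. if E h v then 1 else 0)"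
      using A(3) by (simp add: sum.If_cases Int_def)
    ultimately show ?thesis
      unfolding e_def A'_def[symmetric] using A(2,3) deg
      by (subst (1) A(1)) (simp add: sum.distrib)
  qed
  define N where "N U = {h\<in>V - U. \<exists>u\<in>U. E u h}" for U
  \<comment> \<open>Contracting \<open>U\<close> to one vertex leaves
    \<open>card (V - U) + 1\<close> vertices and the degree sum
    \<open>e (V - U) + 2 * card (N U)\<close>, so \<open>C U\<close> says that the quotient has
    average degree at least \<open>2 * k\<close>.\<close>
  define C where "C U \<longleftrightarrow> grown E U \<and> U \<subseteq> V \<and>
      2 * k * (card (V - U) + 1) \<le> e (V - U) + 2 * card (N U)" for U
  obtain v where v: "v \<in> V" using less by auto
  have "N {v} = {u\<in>V. E v u}" unfolding N_def using irr by auto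
  moreover have "card (V - {v}) + 1 = card V" using v less.prems(1) by (metis Suc_eq_plus1 card_Suc_Diff1)
  ultimately have "C {v}"
    unfolding C_def using v less.prems e_remove[OF less.prems(1) v] grown.single[of E v] by (simp add: e_def)
  moreover have "\<forall>U. C U \<longrightarrow> card U < Suc (card V)"
    by (intro allI impI le_imp_less_Suc card_mono less.prems(1)) (simp add: C_def)
  ultimately obtain U where U: "C U" and Umax: "\<And>U'. C U' \<Longrightarrow> card U' \<le> card U"
    using ex_has_greatest_nat[of C "{v}" card "Suc (card V)"] by metis
  have UV: "grown E U" "U \<subseteq> V" and Udens: "2 * k * (card (V - U) + 1) \<le> e (V - U) + 2 * card (N U)"
    using U unfolding C_def by auto
  have "finite U" using UV(2) less.prems(1) by (rule finite_subset)
  show ?case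
  proof (cases "N U = {}")
    \<comment> \<open>No edge leaves \<open>U\<close>, so the contracted vertex is isolated in the
      quotient and the rest alone is dense enough for the induction.\<close>
    case True
    then have d: "2 * k * (card (V - U) + 1) \<le> e (V - U)" using Udens by simp
    have "V - U \<noteq> {}"
    proof
      assume "V - U = {}"
      then show False using d \<open>0 < k\<close> unfolding \<open>V - U = {}\<close> by (simp add: e_def)
    qed
    moreover have "card (V - U) < card V"
      using grown_nonempty[OF UV(1)] UV less.prems(1) by (intro psubset_card_mono) auto
    moreover have "2 * k * card (V - U) \<le> e (V - U)" using d by (simp add: algebra_simps)
    ultimately have "\<exists>U' H. grown E U' \<and> U' \<subseteq> V - U \<and> H \<subseteq> V - U \<and> H \<noteq> {} \<and> U' \<inter> H = {} \<and>
     (\<forall>h\<in>H. \<exists>u\<in>U'. E u h) \<and> (\<forall>h\<in>H. k \<le> card {u\<in>H. E h u})"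
      using less.prems(1) unfolding e_def by (intro less.hyps) simp_all
    then obtain U' H where "grown E U'" and sub: "U' \<subseteq> V - U" "H \<subseteq> V - U" and "H \<noteq> {}" "U' \<inter> H = {}"
     "\<forall>h\<in>H. \<exists>u\<in>U'. E u h" "\<forall>h\<in>H. k \<le> card {u\<in>H. E h u}" by (elim exE conjE) (rule that)
    moreover have "U' \<subseteq> V" "H \<subseteq> V" using sub by auto
    ultimately show ?thesis by (intro exI[of _ U'] exI[of _ H]) simp
  next
    case False
    have "k \<le> card {u\<in>N U. E h u}" if h: "h \<in> N U" for h
    proof (rule ccontr)
      assume small: "\<not> k \<le> card {u\<in>N U. E h u}"
      define A where "A = V - U"
      define X where "X = {w\<in>A. E h w}"
      have fin: "finite A" "finite X" "finite (N U)" using less.prems(1) by (auto simp: A_def X_def N_def)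
      have hA: "h \<in> A" using h by (auto simp: N_def A_def)
      have A': "V - insert h U = A - {h}" by (auto simp: A_def)
      have "N (insert h U) = (N U - {h}) \<union> (X - N U)"
        using irr unfolding N_def X_def A_def by auto
      then have "card (N (insert h U)) = card (N U - {h}) + card (X - N U)"
        using fin by (simp add: card_Un_disjoint disjoint_iff)
      moreover have "card (N U - {h}) + 1 = card (N U)"
        using h fin by (metis Suc_eq_plus1 card_Suc_Diff1)
      moreover have "{u\<in>N U. E h u} = X \<inter> N U" by (auto simp: X_def N_def A_def)
      then have "card (X - N U) + card {u\<in>N U. E h u} = card X"
        using card_Int_Diff[OF fin(2), of "N U"] by simp
      moreover have "e A = e (A - {h}) + 2 * card X"
        using e_remove[OF fin(1) hA] by (simp add: X_def)
      moreover have "card (A - {h}) + 1 = card A"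
        using hA fin by (metis Suc_eq_plus1 card_Suc_Diff1)
      \<comment> \<open>Moving \<open>h\<close> into \<open>U\<close> removes one vertex from the
        quotient and lowers its degree sum by twice \<open>card (X \<inter> N U) + 1\<close>. This
        is at most \<open>2 * k\<close> because \<open>h\<close> has fewer than \<open>k\<close>
        neighbours in \<open>N U\<close>.\<close>
      ultimately have "2 * k * (card (A - {h}) + 1) \<le> e (A - {h}) + 2 * card (N (insert h U))"
        using Udens small unfolding A_def[symmetric] by (simp add: algebra_simps)
      moreover have "grown E (insert h U)" using h UV(1) unfolding N_def by (auto intro: grown.extend)
      ultimately have "C (insert h U)"
        unfolding C_def using h UV(2) A' by (auto simp: N_def)
      then show False using Umax[of "insert h U"] h \<open>finite U\<close> by (auto simp: N_def)
    qed
    then show ?thesis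
      using UV False by (intro exI[of _ U] exI[of _ "N U"]) (auto simp: N_def)
  qed
qed

corollary min_degree_grown_neighbourhood:
  fixes E :: "'a \<Rightarrow> 'a \<Rightarrow> bool"
  assumes "\<And>x y. E x y \<Longrightarrow> E y x" "\<And>x. \<not> E x x" "finite V" "V \<noteq> {}" "0 < k"
    and deg: "\<And>v. v \<in> V \<Longrightarrow> 2 * k \<le> card {u\<in>V. E v u}"
  obtains U H where "grown E U" "U \<subseteq> V" "H \<subseteq> V" "H \<noteq> {}" "U \<inter> H = {}"
    "\<And>h. h \<in> H \<Longrightarrow> \<exists>u\<in>U. E u h" "\<And>h. h \<in> H \<Longrightarrow> k \<le> card {u\<in>H. E h u}"
proof -
  have "2 * k * card V \<le> (\<Sum>v\<in>V. card {u\<in>V. E v u})"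
    using sum_mono[of V "\<lambda>_. 2 * k", OF deg] by (simp add: mult.commute)
  then show ?thesis
    using dense_grown_neighbourhood[of E V k, OF assms(1-5)] that by blast
qed

text \<open>Each application of the previous corollary takes place inside the neighbourhood found
  before and halves the minimum degree: 16, 8, 4, 2. Because of the nesting, the last neighbourhood
  is attached to all three connected sets, and minimum degree 2 provides three vertices in
  it.\<close>

lemma min_degree_K33_minor:
  fixes E :: "'a \<Rightarrow> 'a \<Rightarrow> bool"
  assumes E: "\<And>x y. E x y \<Longrightarrow> E y x" "\<And>x. \<not> E x x" and V: "finite V" "V \<noteq> {}"
    and deg: "\<And>v. v \<in> V \<Longrightarrow> 16 \<le> card {u\<in>V. E v u}"
  obtains U :: "nat \<Rightarrow> 'a set" and H
  where "\<And>i. i < 3 \<Longrightarrow> grown E (U i) \<and> U i \<subseteq> V \<and> U i \<inter> H = {}"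
    "\<And>i j. i < 3 \<Longrightarrow> j < 3 \<Longrightarrow> i \<noteq> j \<Longrightarrow> U i \<inter> U j = {}"
    "H \<subseteq> V" "card H = 3" "\<And>i h. i < 3 \<Longrightarrow> h \<in> H \<Longrightarrow> \<exists>u\<in>U i. E u h"
proof -
  obtain U0 H0 where 0: "grown E U0" "U0 \<subseteq> V" "H0 \<subseteq> V" "H0 \<noteq> {}" "U0 \<inter> H0 = {}"
    "\<And>h. h \<in> H0 \<Longrightarrow> \<exists>u\<in>U0. E u h" "\<And>h. h \<in> H0 \<Longrightarrow> 8 \<le> card {u\<in>H0. E h u}"
    using min_degree_grown_neighbourhood[of E V 8, OF E V] deg by auto
  have f0: "finite H0" using 0(3) V(1) by (rule finite_subset)
  obtain U1 H1 where 1: "grown E U1" "U1 \<subseteq> H0" "H1 \<subseteq> H0" "H1 \<noteq> {}" "U1 \<inter> H1 = {}"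
    "\<And>h. h \<in> H1 \<Longrightarrow> \<exists>u\<in>U1. E u h" "\<And>h. h \<in> H1 \<Longrightarrow> 4 \<le> card {u\<in>H1. E h u}"
    using min_degree_grown_neighbourhood[of E H0 4, OF E f0 0(4)] 0(7) by auto
  have f1: "finite H1" using 1(3) f0 by (rule finite_subset)
  obtain U2 H2 where 2: "grown E U2" "U2 \<subseteq> H1" "H2 \<subseteq> H1" "H2 \<noteq> {}" "U2 \<inter> H2 = {}"
    "\<And>h. h \<in> H2 \<Longrightarrow> \<exists>u\<in>U2. E u h" "\<And>h. h \<in> H2 \<Longrightarrow> 2 \<le> card {u\<in>H2. E h u}"
    using min_degree_grown_neighbourhood[of E H1 2, OF E f1 1(4)] 1(7) by auto
  have f2: "finite H2" using 2(3) f1 by (rule finite_subset)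
  obtain h where h: "h \<in> H2" using 2 by auto
  have "card (insert h {u\<in>H2. E h u}) = Suc (card {u\<in>H2. E h u})"
    using f2 E(2) by (subst card_insert_disjoint) auto
  moreover have "card (insert h {u\<in>H2. E h u}) \<le> card H2"
    using f2 h by (intro card_mono) auto
  ultimately have "3 \<le> card H2" using 2(7)[OF h] by linarith
  then obtain H where H: "H \<subseteq> H2" "card H = 3" by (metis obtain_subset_with_card_n)
  define U where "U i = (if i = 0 then U0 else if i = 1 then U1 else U2)" for i :: nat
  have HV: "H \<subseteq> V" "H \<subseteq> H0" "H \<subseteq> H1" using H(1) 0(3) 1(3) 2(3) by blast+
  have UV: "U0 \<subseteq> V" "U1 \<subseteq> V" "U2 \<subseteq> V" using 0(2,3) 1(2,3) 2(2) by blast+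
  have UH: "U0 \<inter> H = {}" "U1 \<inter> H = {}" "U2 \<inter> H = {}" using 0(5) 1(5) 2(5) HV H(1) by blast+
  have UU: "U0 \<inter> U1 = {}" "U0 \<inter> U2 = {}" "U1 \<inter> U2 = {}" using 0(5) 1(2,3,5) 2(2) by blast+
  have less3: "i < 3 \<longleftrightarrow> i = 0 \<or> i = 1 \<or> i = 2" for i :: nat by auto
  show ?thesis
  proof (rule that[of U H])
    show "grown E (U i) \<and> U i \<subseteq> V \<and> U i \<inter> H = {}" if "i < 3" for i
      using that 0(1) 1(1) 2(1) UV UH unfolding less3 U_def by (elim disjE) simp_all
    show "U i \<inter> U j = {}" if "i < 3" "j < 3" "i \<noteq> j" for i j
      using that UU unfolding less3 U_def by (elim disjE) (simp_all add: Int_commute)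
    show "\<exists>u\<in>U i. E u h" if "i < 3" "h \<in> H" for i h
    proof -
      have "h \<in> H0" "h \<in> H1" "h \<in> H2" using that(2) HV H(1) by auto
      then show ?thesis using that(1) 0(6) 1(6) 2(6) unfolding less3 U_def by (elim disjE) simp_all
    qed
  qed (rule HV H)+
qed

section \<open>Drawings of disjoint connected sets in the plane\<close>

locale plane_drawing =
  fixes V :: "'a set" and Es :: "'a set set"
    and pos :: "'a \<Rightarrow> complex" and \<gamma> :: "'a set \<Rightarrow> real \<Rightarrow> complex"
  assumes inj: "inj_on pos V"
    and edge: "\<And>e. e \<in> Es \<Longrightarrow> e \<subseteq> V \<and> card e = 2"
    and arc: "\<And>e. e \<in> Es \<Longrightarrow> arc (\<gamma> e)"
    and ends: "\<And>e. e \<in> Es \<Longrightarrow> {pathstart (\<gamma> e), pathfinish (\<gamma> e)} = pos ` e"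
    and vertices: "\<And>e. e \<in> Es \<Longrightarrow> path_image (\<gamma> e) \<inter> pos ` V = pos ` e"
    and crossing: "\<And>e e'. e \<in> Es \<Longrightarrow> e' \<in> Es \<Longrightarrow> e \<noteq> e' \<Longrightarrow>
      path_image (\<gamma> e) \<inter> path_image (\<gamma> e') = pos ` (e \<inter> e')"
begin

text \<open>Edges between two vertices of \<open>X\<close> are left out, so that the drawings for disjoint sets \<open>U\<close>
  share only vertices of \<open>X\<close>.\<close>

definition drawn :: "'a set \<Rightarrow> 'a set \<Rightarrow> complex set" where
  "drawn U X = pos ` (U \<union> X) \<union> (\<Union>e\<in>{e\<in>Es. e \<inter> U \<noteq> {} \<and> e \<subseteq> U \<union> X}. path_image (\<gamma> e))"

lemma drawn_mono: "U \<subseteq> U' \<Longrightarrow> X \<subseteq> U' \<union> X' \<Longrightarrow> drawn U X \<subseteq> drawn U' X'"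
  unfolding drawn_def by blast

lemma pos_in_drawn: "v \<in> U \<union> X \<Longrightarrow> pos v \<in> drawn U X"
  unfolding drawn_def by auto

lemma arc_in_drawn: "{u, v} \<in> Es \<Longrightarrow> u \<in> U \<Longrightarrow> v \<in> U \<union> X \<Longrightarrow> path_image (\<gamma> {u, v}) \<subseteq> drawn U X"
  unfolding drawn_def by auto

text \<open>Every arc drawn for \<open>U\<close> has an end in \<open>U\<close>, and no arc drawn
  for \<open>U'\<close> has one, so the drawings share no arc. Distinct arcs meet only in common
  ends, and an arc passes through no vertices but its ends.\<close>

lemma drawn_Int:
  assumes "U \<subseteq> V" "X \<subseteq> V" "U' \<subseteq> V" "X' \<subseteq> V" "U \<inter> (U' \<union> X') = {}" "U' \<inter> X = {}"
  shows "drawn U X \<inter> drawn U' X' \<subseteq> pos ` (X \<inter> X')"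
proof
  fix z assume z: "z \<in> drawn U X \<inter> drawn U' X'"
  have vertex: "z \<in> pos ` A \<Longrightarrow> A \<subseteq> V \<Longrightarrow> z \<in> drawn B Y \<Longrightarrow> B \<subseteq> V \<Longrightarrow> Y \<subseteq> V \<Longrightarrow> z \<in> pos ` (A \<inter> (B \<union> Y))" for A B Y
  proof -
    assume *: "z \<in> pos ` A" "A \<subseteq> V" "z \<in> drawn B Y" "B \<subseteq> V" "Y \<subseteq> V"
    have "z \<in> pos ` (B \<union> Y)"
    proof (cases "z \<in> pos ` (B \<union> Y)")
      case False
      then obtain e where e: "e \<in> Es" "e \<subseteq> B \<union> Y" "z \<in> path_image (\<gamma> e)" using *(3) unfolding drawn_def by auto
      have "z \<in> path_image (\<gamma> e) \<inter> pos ` V" using e(3) *(1,2) by blast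
      then show ?thesis unfolding vertices[OF e(1)] using e(2) by blast
    qed
    moreover have "pos ` A \<inter> pos ` (B \<union> Y) = pos ` (A \<inter> (B \<union> Y))"
      using * by (intro inj_on_image_Int[OF inj, symmetric]) auto
    ultimately show ?thesis using *(1) by blast
  qed
  show "z \<in> pos ` (X \<inter> X')"
  proof (cases "z \<in> pos ` (U \<union> X) \<or> z \<in> pos ` (U' \<union> X')")
    case True
    then have "z \<in> pos ` ((U \<union> X) \<inter> (U' \<union> X')) \<or> z \<in> pos ` ((U' \<union> X') \<inter> (U \<union> X))"
      using vertex[of "U \<union> X" U' X'] vertex[of "U' \<union> X'" U X] z assms by blast
    moreover have "(U \<union> X) \<inter> (U' \<union> X') = X \<inter> X'" using assms by blast
    ultimately show ?thesis by (simp add: Int_commute)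
  next
    case False
    obtain e where e: "e \<in> Es" "e \<inter> U \<noteq> {}" "e \<subseteq> U \<union> X" "z \<in> path_image (\<gamma> e)"
      using z False unfolding drawn_def by auto
    obtain e' where e': "e' \<in> Es" "e' \<inter> U' \<noteq> {}" "e' \<subseteq> U' \<union> X'" "z \<in> path_image (\<gamma> e')"
      using z False unfolding drawn_def by auto
    have "e \<noteq> e'" using e e' assms by blast
    then have "z \<in> pos ` (e \<inter> e')" using crossing[OF e(1) e'(1)] e(4) e'(4) by blast
    then show ?thesis using e(3) e'(3) assms by blast
  qed
qed

abbreviation adj :: "'a \<Rightarrow> 'a \<Rightarrow> bool" where "adj u v \<equiv> {u, v} \<in> Es"

lemma path_connected_edge: "e \<in> Es \<Longrightarrow> path_connected (path_image (\<gamma> e)) \<and> closed (path_image (\<gamma> e))"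
  using arc by (meson arc_imp_path closed_arc_image path_connected_path_image)

lemma pos_in_edge: "e \<in> Es \<Longrightarrow> v \<in> e \<Longrightarrow> pos v \<in> path_image (\<gamma> e)"
  using ends by (metis insert_subset image_eqI insertE pathfinish_in_path_image pathstart_in_path_image singletonD)

text \<open>\<open>W\<close> is the drawing of a spanning tree: each vertex added to the set comes
  with the arc that attaches it.\<close>

lemma grown_path_connected:
  assumes "grown adj U"
  shows "\<exists>W. path_connected W \<and> closed W \<and> pos ` U \<subseteq> W \<and> W \<subseteq> drawn U {}"
  using assms
proof (induction rule: grown.induct)
  case (single v)
  then show ?case by (intro exI[of _ "{pos v}"]) (auto simp: drawn_def)
next
  case (extend U u v)
  then obtain W where W: "path_connected W" "closed W" "pos ` U \<subseteq> W" "W \<subseteq> drawn U {}" by blast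
  have "path_connected (W \<union> path_image (\<gamma> {u, v}))"
    using W path_connected_edge[OF extend(3)] pos_in_edge[OF extend(3), of u] extend(2)
    by (intro path_connected_Un) auto
  moreover have "closed (W \<union> path_image (\<gamma> {u, v}))"
    using W path_connected_edge[OF extend(3)] by auto
  moreover have "pos ` insert v U \<subseteq> W \<union> path_image (\<gamma> {u, v})"
    using W pos_in_edge[OF extend(3), of v] by auto
  moreover have "W \<union> path_image (\<gamma> {u, v}) \<subseteq> drawn (insert v U) {}"
    using W drawn_mono[of U "insert v U" "{}" "{}"] arc_in_drawn[OF extend(3), of "insert v U" "{}"] extend(2) by auto
  ultimately show ?case by blast
qed

text \<open>\<open>W\<close>, a connected drawing of \<open>U\<close>, is extended by one edge each
  to \<open>x\<close>, \<open>y\<close> and \<open>z\<close>. An arc \<open>p\<close> from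
  \<open>x\<close> to \<open>y\<close> through the first two edges and \<open>W\<close> has to meet
  \<open>W\<close>, and it does so at an interior point \<open>q\<close> since \<open>W\<close>
  contains neither end. From there \<open>W\<close> and the edge to \<open>z\<close> form the link
  \<open>Q\<close>.\<close>

lemma grown_tripod:
  assumes U: "grown adj U" "U \<subseteq> V" and xyz: "x \<in> V - U" "y \<in> V - U" "z \<in> V - U" "x \<noteq> y" "z \<noteq> x" "z \<noteq> y"
    and att: "\<exists>u\<in>U. adj u x" "\<exists>u\<in>U. adj u y" "\<exists>u\<in>U. adj u z"
  shows "\<exists>p Q q. Path_Connected.arc p \<and> pathstart p = pos x \<and> pathfinish p = pos y \<and> path_image p \<subseteq> drawn U {x, y}
    \<and> connected Q \<and> Q \<subseteq> drawn U {z} \<and> pos z \<in> Q \<and> q \<in> Q \<and> q \<in> path_image p - {pos x, pos y}"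
proof -
  obtain W where W: "path_connected W" "closed W" "pos ` U \<subseteq> W" "W \<subseteq> drawn U {}"
    using grown_path_connected[OF U(1)] by blast
  obtain u where u: "u \<in> U" "adj u x" using att by blast
  obtain v where v: "v \<in> U" "adj v y" using att by blast
  obtain w where w: "w \<in> U" "adj w z" using att by blast
  define e f g where "e = path_image (\<gamma> {u, x})" "f = path_image (\<gamma> {v, y})" "g = path_image (\<gamma> {w, z})"
  have inW: "pos u \<in> W" "pos v \<in> W" "pos w \<in> W" using W u v w by auto
  have ends_in: "pos u \<in> e" "pos x \<in> e" "pos v \<in> f" "pos y \<in> f" "pos w \<in> g" "pos z \<in> g"
    unfolding e_f_g_def using u v w pos_in_edge by blast+
  have pc: "path_connected e" "path_connected f" "path_connected g" "closed e" "closed f"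
    unfolding e_f_g_def using path_connected_edge u v w by auto
  have sub: "e \<subseteq> drawn U {x, y}" "f \<subseteq> drawn U {x, y}" "W \<subseteq> drawn U {x, y}" "W \<subseteq> drawn U {z}" "g \<subseteq> drawn U {z}"
    unfolding e_f_g_def
    using arc_in_drawn[OF u(2,1), of "{x, y}"] arc_in_drawn[OF v(2,1), of "{x, y}"] arc_in_drawn[OF w(2,1), of "{z}"]
      order_trans[OF W(4) drawn_mono] by simp_all
  have posneq: "pos x \<noteq> pos y" using inj xyz by (auto dest: inj_onD)
  have "path_connected ((e \<union> W) \<union> f)"
    using pc W(1) ends_in inW by (intro path_connected_Un) auto
  then obtain p where p: "Path_Connected.arc p" "path_image p \<subseteq> e \<union> W \<union> f" "pathstart p = pos x" "pathfinish p = pos y"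
    using ends_in posneq unfolding path_connected_arcwise by (metis UnCI)
  have xyW: "pos x \<notin> W" "pos y \<notin> W"
  proof -
    have "pos x \<notin> drawn U {}" "pos y \<notin> drawn U {}"
      using drawn_Int[of U "{}" "{}" "{x}"] drawn_Int[of U "{}" "{}" "{y}"] pos_in_drawn[of x "{}" "{x}"]
        pos_in_drawn[of y "{}" "{y}"] U xyz by auto
    then show "pos x \<notin> W" "pos y \<notin> W" using W by auto
  qed
  have "e \<inter> f \<subseteq> W"
  proof -
    have "{u, x} \<noteq> {v, y}" using u v xyz by (auto simp: doubleton_eq_iff)
    then have "e \<inter> f = pos ` ({u, x} \<inter> {v, y})"
      unfolding e_f_g_def using crossing u v by blast
    also have "\<dots> \<subseteq> W" using inW u v xyz by auto
    finally show ?thesis .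
  qed
  \<comment> \<open>The two edges meet only in \<open>W\<close>. Off \<open>W\<close> the connected
    arc would split into two disjoint nonempty closed parts, one on each edge.\<close>
  have "path_image p \<inter> W \<noteq> {}"
  proof
    assume none: "path_image p \<inter> W = {}"
    have "connected (path_image p)" using p(1) by (simp add: connected_arc_image)
    moreover have "path_image p \<subseteq> e \<union> f" using none p(2) by auto
    moreover have "e \<inter> f \<inter> path_image p = {}" using none \<open>e \<inter> f \<subseteq> W\<close> by auto
    moreover have "pos x \<in> path_image p" "pos y \<in> path_image p" using p by (metis pathstart_in_path_image pathfinish_in_path_image)+
    ultimately show False
      using pc(4,5) ends_in unfolding connected_closed by blast
  qed
  then obtain q where q: "q \<in> path_image p" "q \<in> W" by blast
  have "connected (W \<union> g)"
    using pc(3) W(1) inW ends_in by (intro connected_Un path_connected_imp_connected) auto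
  then show ?thesis
    using p q sub xyW ends_in by (intro exI[of _ p] exI[of _ "W \<union> g"] exI[of _ q]) blast
qed

text \<open>The three tripods provide the arcs between \<open>x\<close> and \<open>y\<close> and the
  links to \<open>z\<close> of the forbidden configuration. Different tripods share nothing beyond
  \<open>x\<close>, \<open>y\<close> and \<open>z\<close>.\<close>

lemma no_K33_minor:
  fixes U :: "nat \<Rightarrow> 'a set"
  assumes U: "\<And>i. i < 3 \<Longrightarrow> grown adj (U i) \<and> U i \<subseteq> V \<and> U i \<inter> H = {}"
    and disj: "\<And>i j. i < 3 \<Longrightarrow> j < 3 \<Longrightarrow> i \<noteq> j \<Longrightarrow> U i \<inter> U j = {}"
    and H: "H \<subseteq> V" "card H = 3" and att: "\<And>i h. i < 3 \<Longrightarrow> h \<in> H \<Longrightarrow> \<exists>u\<in>U i. adj u h"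
  shows False
proof -
  obtain x y z where xyz: "H = {x, y, z}" "x \<noteq> y" "z \<noteq> x" "z \<noteq> y"
    using H(2) by (auto simp: card_3_iff)
  have "\<forall>i. \<exists>p Q q. i < 3 \<longrightarrow> Path_Connected.arc p \<and> pathstart p = pos x \<and> pathfinish p = pos y \<and> path_image p \<subseteq> drawn (U i) {x, y}
    \<and> connected Q \<and> Q \<subseteq> drawn (U i) {z} \<and> pos z \<in> Q \<and> q \<in> Q \<and> q \<in> path_image p - {pos x, pos y}"
  proof (intro allI)
    fix i
    show "\<exists>p Q q. i < 3 \<longrightarrow> Path_Connected.arc p \<and> pathstart p = pos x \<and> pathfinish p = pos y \<and> path_image p \<subseteq> drawn (U i) {x, y}
      \<and> connected Q \<and> Q \<subseteq> drawn (U i) {z} \<and> pos z \<in> Q \<and> q \<in> Q \<and> q \<in> path_image p - {pos x, pos y}"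
    proof (cases "i < 3")
      case True
      have "x \<in> V - U i" "y \<in> V - U i" "z \<in> V - U i"
        using U[OF True] H(1) unfolding xyz(1) by auto
      then show ?thesis
        using grown_tripod[of "U i" x y z] U[OF True] att[OF True] xyz by (simp only: True simp_thms insert_iff)
    qed simp
  qed
  then obtain p Q q where pQq: "\<And>i. i < 3 \<Longrightarrow> Path_Connected.arc (p i) \<and> pathstart (p i) = pos x \<and> pathfinish (p i) = pos y
      \<and> path_image (p i) \<subseteq> drawn (U i) {x, y} \<and> connected (Q i) \<and> Q i \<subseteq> drawn (U i) {z} \<and> pos z \<in> Q i
      \<and> q i \<in> Q i \<and> q i \<in> path_image (p i) - {pos x, pos y}"
    by metis
  have int: "drawn (U i) A \<inter> drawn (U j) B \<subseteq> pos ` (A \<inter> B)"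
    if "i < 3" "j < 3" "i \<noteq> j" "A \<subseteq> H" "B \<subseteq> H" for i j A B
    using U[OF that(1)] U[OF that(2)] disj[OF that(1-3)] that(4,5) H(1) by (intro drawn_Int) blast+
  show False
  proof (rule theta_not_linked[of p "pos x" "pos y" Q "pos z" q])
    show "path_image (p i) \<inter> path_image (p j) \<subseteq> {pos x, pos y}" if "i < 3" "j < 3" "i \<noteq> j" for i j
      using int[OF that, of "{x, y}" "{x, y}"] pQq[OF that(1)] pQq[OF that(2)] xyz by auto
    show "Q i \<inter> path_image (p j) = {}" if "i < 3" "j < 3" "i \<noteq> j" for i j
      using int[OF that, of "{z}" "{x, y}"] pQq[OF that(1)] pQq[OF that(2)] xyz by auto
  qed (use pQq in auto)
qed

lemma small_degree:
  assumes "A \<subseteq> V" "finite A" "A \<noteq> {}"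
  shows "\<exists>v\<in>A. card {u\<in>A. {v, u} \<in> Es} \<le> 15"
proof (rule ccontr)
  assume "\<not> ?thesis"
  then have deg: "16 \<le> card {u\<in>A. adj v u}" if "v \<in> A" for v using that by force
  have irr: "\<not> adj v v" for v using edge[of "{v, v}"] by auto
  have sym: "adj u v" if "adj v u" for u v using that by (simp add: insert_commute)
  show False
  proof (rule min_degree_K33_minor[of adj A, OF sym irr assms(2,3) deg])
    fix U :: "nat \<Rightarrow> 'a set" and H
    assume *: "\<And>i. i < 3 \<Longrightarrow> grown adj (U i) \<and> U i \<subseteq> A \<and> U i \<inter> H = {}"
      "\<And>i j. i < 3 \<Longrightarrow> j < 3 \<Longrightarrow> i \<noteq> j \<Longrightarrow> U i \<inter> U j = {}"
      "H \<subseteq> A" "card H = 3" "\<And>i h. i < 3 \<Longrightarrow> h \<in> H \<Longrightarrow> \<exists>u\<in>U i. adj u h"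
    have UV: "grown adj (U i) \<and> U i \<subseteq> V \<and> U i \<inter> H = {}" if "i < 3" for i using *(1)[OF that] assms(1) by blast
    have HV: "H \<subseteq> V" using *(3) assms(1) by blast
    show False by (rule no_K33_minor[of U H, OF UV *(2) HV *(4,5)])
  qed
qed

end

lemma planar_small_degree:
  fixes G :: "'a cap_graph"
  assumes "cap_instance G" "planar G" "A \<subseteq> verts G" "A \<noteq> {}"
  shows "\<exists>v\<in>A. card {u\<in>A. {v, u} \<in> edges G} \<le> 15"
proof -
  have fin: "finite (verts G)" and e2: "\<And>e. e \<in> edges G \<Longrightarrow> e \<subseteq> verts G \<and> card e = 2"
    using assms(1) unfolding cap_instance_def by simp_all
  obtain pos :: "'a \<Rightarrow> complex" and \<gamma> where inj: "inj_on pos (verts G)"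
    and arcs: "\<forall>e\<in>edges G. arc (\<gamma> e) \<and> {pathstart (\<gamma> e), pathfinish (\<gamma> e)} = pos ` e
           \<and> path_image (\<gamma> e) \<inter> pos ` verts G = pos ` e"
    and cross: "\<forall>e\<in>edges G. \<forall>e'\<in>edges G. e \<noteq> e' \<longrightarrow>
           path_image (\<gamma> e) \<inter> path_image (\<gamma> e') = pos ` (e \<inter> e')"
    using assms(2) unfolding planar_def by (elim exE conjE) (rule that)
  interpret plane_drawing "verts G" "edges G" pos \<gamma>
    by unfold_locales (use inj e2 arcs cross in simp_all)
  show ?thesis
    using assms(3) finite_subset[OF assms(3) fin] assms(4) by (rule small_degree)
qed

subsection \<open>The primal-dual elimination\<close>

text \<open>\<open>W u\<close> is the opening cost and \<open>R v u\<close> the cost of serving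
  \<open>v\<close> entirely at \<open>u\<close>, scaled to natural numbers so that the machine
  computes with them exactly. They are left unspecified at capacity zero, where no positive demand
  can be served at finite cost.\<close>

locale scaled_instance =
  fixes G :: "nat cap_graph" and n :: nat and scale :: real
    and W :: "nat \<Rightarrow> nat" and R :: "nat \<Rightarrow> nat \<Rightarrow> nat" and D :: nat
  assumes inst: "cap_instance G" and vs: "verts G = {..<n}" and scale: "scale > 0"
    and W: "\<And>u. u < n \<Longrightarrow> capacity G u \<noteq> 0 \<Longrightarrow> real (W u) = scale * cost G u"
    and R: "\<And>u v. u < n \<Longrightarrow> v < n \<Longrightarrow> capacity G u \<noteq> 0 \<Longrightarrow>
      real (R v u) = scale * (demand G v * (cost G u / capacity G u))"
begin

abbreviation nb :: "nat \<Rightarrow> nat set" where "nb \<equiv> closed_nbhd G"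

text \<open>These are the clients that pay. A vertex with demand but no usable closed neighbour
  forces infinite cost on every feasible assignment, so it may as well be assigned to
  itself.\<close>

definition act :: "nat \<Rightarrow> bool" where
  "act v \<longleftrightarrow> demand G v \<noteq> 0 \<and> (\<exists>u\<in>nb v. capacity G u \<noteq> 0)"

lemma nb_lt: "v < n \<Longrightarrow> u \<in> nb v \<Longrightarrow> u < n"
  using vs by (auto simp: closed_nbhd_def)

lemma nb_self: "v \<in> nb v"
  by (simp add: closed_nbhd_def)

lemma nb_sym: "v < n \<Longrightarrow> u \<in> nb v \<Longrightarrow> v \<in> nb u"
  using vs by (auto simp: closed_nbhd_def insert_commute)

lemma finite_nb: "finite (nb v)"
  using vs by (simp add: closed_nbhd_def)

lemma nonneg: "v < n \<Longrightarrow> 0 \<le> cost G v" "v < n \<Longrightarrow> 0 \<le> capacity G v" "v < n \<Longrightarrow> 0 \<le> demand G v"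
  using inst vs by (auto simp: cap_instance_def)

text \<open>\<open>X\<close> is the set of eliminated vertices and \<open>out v\<close> consists of \<open>v\<close> and its
  neighbours remaining when \<open>v\<close> was eliminated.\<close>

definition pay :: "nat set \<Rightarrow> (nat \<Rightarrow> nat) \<Rightarrow> (nat \<Rightarrow> nat set) \<Rightarrow> nat \<Rightarrow> nat" where
  "pay X \<alpha> out u = (\<Sum>v\<in>X. if u \<in> out v then \<alpha> v - R v u else 0)"

text \<open>The second condition says that each edge with an eliminated end is accounted for at the
  end eliminated first. In the fourth, \<open>\<alpha> v\<close> stands beside \<open>pay\<close>:
  the server may be eliminated already, in which case \<open>v\<close> puts nothing towards it in
  \<open>pay\<close> although \<open>\<alpha> v\<close> covers what was missing. There is equality
  for such a server when it is chosen; afterwards \<open>pay\<close> can only grow. The third and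
  fifth condition feed the lower bound on the optimum.\<close>

definition invar :: "nat set \<Rightarrow> (nat \<Rightarrow> nat) \<Rightarrow> (nat \<Rightarrow> nat) \<Rightarrow> (nat \<Rightarrow> nat) \<Rightarrow> (nat \<Rightarrow> nat set) \<Rightarrow> bool" where
  "invar X rem \<sigma> \<alpha> out \<longleftrightarrow>
     (\<forall>v\<in>X. out v \<subseteq> nb v \<and> card (out v) \<le> D + 1) \<and>
     (\<forall>v\<in>X. \<forall>u\<in>nb v. u \<in> out v \<or> u \<in> X \<and> v \<in> out u) \<and>
     (\<forall>u<n. capacity G u \<noteq> 0 \<longrightarrow> rem u + pay X \<alpha> out u = W u) \<and>
     (\<forall>v\<in>X. act v \<longrightarrow> \<sigma> v \<in> nb v \<and> capacity G (\<sigma> v) \<noteq> 0 \<and> R v (\<sigma> v) \<le> \<alpha> v \<and>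
        W (\<sigma> v) + R v (\<sigma> v) \<le> \<alpha> v + pay X \<alpha> out (\<sigma> v)) \<and>
     (\<forall>v\<in>X. act v \<longrightarrow> (\<forall>u\<in>nb v. capacity G u \<noteq> 0 \<longrightarrow> \<alpha> v \<le> W u + R v u)) \<and>
     (\<forall>v\<in>X. \<not> act v \<longrightarrow> \<alpha> v = 0) \<and>
     (\<forall>v<n. v \<notin> X \<or> \<not> act v \<longrightarrow> \<sigma> v = v)"

text \<open>The payments and the sets \<open>out\<close> belong to the analysis; only
  \<open>rem\<close> and \<open>\<sigma>\<close> correspond to arrays of the machine.\<close>

definition reachable :: "nat set \<Rightarrow> (nat \<Rightarrow> nat) \<Rightarrow> (nat \<Rightarrow> nat) \<Rightarrow> bool" where
  "reachable X rem \<sigma> \<longleftrightarrow> X \<subseteq> {..<n} \<and> (\<exists>\<alpha> out. invar X rem \<sigma> \<alpha> out)"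

lemma reachable_start:
  assumes "\<And>u. u < n \<Longrightarrow> capacity G u \<noteq> 0 \<Longrightarrow> rem u = W u" "\<And>v. v < n \<Longrightarrow> \<sigma> v = v"
  shows "reachable {} rem \<sigma>"
  using assms unfolding reachable_def invar_def pay_def by simp

lemma pay_insert:
  assumes "finite X" "v \<notin> X"
  shows "pay (insert v X) (\<alpha>(v := a)) (out(v := S)) u = (if u \<in> S then a - R v u else 0) + pay X \<alpha> out u"
proof -
  have "(\<Sum>w\<in>X. if u \<in> (out(v := S)) w then (\<alpha>(v := a)) w - R w u else 0) = pay X \<alpha> out u"
    unfolding pay_def using assms(2) by (intro sum.cong) auto
  then show ?thesis using assms unfolding pay_def by (subst sum.insert) simp_all
qed

text \<open>The payment \<open>b\<close> is a minimum, so it never contributes more to a facility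
  than is still unpaid. For the minimizer \<open>us\<close>, the unpaid part and what was paid
  before add up to \<open>W us\<close>, which gives the condition on servers.\<close>

lemma reachable_step:
  assumes re: "reachable X rem \<sigma>" and v: "v < n" "v \<notin> X"
    and deg: "card {u. u < n \<and> {v, u} \<in> edges G \<and> u \<notin> X} \<le> D"
    and inactive: "\<not> act v \<Longrightarrow> \<sigma>' = \<sigma> \<and> (\<forall>u<n. capacity G u \<noteq> 0 \<longrightarrow> rem' u = rem u)"
    and active: "act v \<Longrightarrow> us \<in> nb v \<and> capacity G us \<noteq> 0 \<and> b = rem us + R v us \<and>
      (\<forall>u\<in>nb v. capacity G u \<noteq> 0 \<longrightarrow> b \<le> rem u + R v u) \<and> \<sigma>' = \<sigma>(v := us) \<and>
      (\<forall>u<n. capacity G u \<noteq> 0 \<longrightarrow> rem' u = (if u \<in> nb v \<and> u \<notin> X then rem u - (b - R v u) else rem u))"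
  shows "reachable (insert v X) rem' \<sigma>'"
proof -
  obtain \<alpha> out where X: "X \<subseteq> {..<n}" and inv: "invar X rem \<sigma> \<alpha> out"
    using re unfolding reachable_def by blast
  have finX: "finite X" using X finite_subset by blast
  note I = inv[unfolded invar_def]
  have I1: "\<And>w. w \<in> X \<Longrightarrow> out w \<subseteq> nb w \<and> card (out w) \<le> D + 1" using I by simp
  have I2: "\<And>w u. w \<in> X \<Longrightarrow> u \<in> nb w \<Longrightarrow> u \<in> out w \<or> u \<in> X \<and> w \<in> out u" using I by simp
  have I3: "\<And>u. u < n \<Longrightarrow> capacity G u \<noteq> 0 \<Longrightarrow> rem u + pay X \<alpha> out u = W u" using I by simp
  have I4: "\<And>w. w \<in> X \<Longrightarrow> act w \<Longrightarrow> \<sigma> w \<in> nb w \<and> capacity G (\<sigma> w) \<noteq> 0 \<and> R w (\<sigma> w) \<le> \<alpha> w \<and>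
        W (\<sigma> w) + R w (\<sigma> w) \<le> \<alpha> w + pay X \<alpha> out (\<sigma> w)" using I by simp
  have I5: "\<And>w u. w \<in> X \<Longrightarrow> act w \<Longrightarrow> u \<in> nb w \<Longrightarrow> capacity G u \<noteq> 0 \<Longrightarrow> \<alpha> w \<le> W u + R w u" using I by simp
  have I6: "\<And>w. w \<in> X \<Longrightarrow> \<not> act w \<Longrightarrow> \<alpha> w = 0" using I by simp
  have I7: "\<And>w. w < n \<Longrightarrow> w \<notin> X \<or> \<not> act w \<Longrightarrow> \<sigma> w = w" using I by simp
  define a where "a = (if act v then b else 0)"
  define S where "S = {u \<in> nb v. u \<notin> X}"
  define \<alpha>' out' where "\<alpha>' = \<alpha>(v := a)" and "out' = out(v := S)"
  have pay': "pay (insert v X) \<alpha>' out' u = (if u \<in> S then a - R v u else 0) + pay X \<alpha> out u" for u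
    unfolding \<alpha>'_def out'_def using pay_insert[OF finX v(2)] .
  have S: "S \<subseteq> nb v" "card S \<le> D + 1"
  proof -
    have "S \<subseteq> insert v {u. u < n \<and> {v, u} \<in> edges G \<and> u \<notin> X}"
      using vs unfolding S_def closed_nbhd_def by (auto simp: insert_commute)
    then have "card S \<le> card (insert v {u. u < n \<and> {v, u} \<in> edges G \<and> u \<notin> X})"
      by (intro card_mono) auto
    also have "\<dots> \<le> Suc (card {u. u < n \<and> {v, u} \<in> edges G \<and> u \<notin> X})" by (rule card_insert_le_m1) auto
    finally show "card S \<le> D + 1" using deg by simp
  qed (auto simp: S_def)
  have other: "\<alpha>' w = \<alpha> w" "out' w = out w" if "w \<in> X" for w
    using that v(2) unfolding \<alpha>'_def out'_def by auto
  have at_v: "\<alpha>' v = a" "out' v = S" unfolding \<alpha>'_def out'_def by auto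
  have \<sigma>'other: "\<sigma>' w = \<sigma> w" if "w \<noteq> v" for w using inactive active that by (cases "act v") auto
  have "invar (insert v X) rem' \<sigma>' \<alpha>' out'"
    unfolding invar_def
  proof (intro conjI ballI allI impI)
    fix w assume w: "w \<in> insert v X"
    have "out' w \<subseteq> nb w \<and> card (out' w) \<le> D + 1"
    proof (cases "w = v")
      case True
      then show ?thesis using S at_v by simp
    next
      case False
      then show ?thesis using I1[of w] other[of w] w by simp
    qed
    then show "out' w \<subseteq> nb w" "card (out' w) \<le> D + 1" by simp_all
  next
    fix w u assume w: "w \<in> insert v X" and u: "u \<in> nb w"
    show "u \<in> out' w \<or> u \<in> insert v X \<and> w \<in> out' u"
    proof (cases "w = v")
      case True
      show ?thesis
      proof (cases "u \<in> X")
        case True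
        \<comment> \<open>When \<open>u\<close> was eliminated, \<open>v\<close> was still
          remaining, so the edge was recorded in \<open>out u\<close>.\<close>
        then have "v \<in> out u"
          using I2[of u v] nb_sym[of v u] u v \<open>w = v\<close> by auto
        then show ?thesis using True other \<open>w = v\<close> by simp
      next
        case False
        then show ?thesis using u \<open>w = v\<close> at_v by (simp add: S_def)
      qed
    next
      case False
      then have "w \<in> X" using w by simp
      then show ?thesis using I2[OF _ u] other by auto
    qed
  next
    fix u assume u: "u < n" "capacity G u \<noteq> 0"
    show "rem' u + pay (insert v X) \<alpha>' out' u = W u"
    proof (cases "act v")
      case True
      \<comment> \<open>By this bound the subtraction from \<open>rem u\<close> does not truncate,
        so what leaves \<open>rem\<close> is exactly what enters \<open>pay\<close>.\<close>
      have "b - R v u \<le> rem u" if "u \<in> nb v" using active[OF True] that u by auto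
      then show ?thesis using active[OF True] u I3[OF u] True unfolding pay' a_def S_def by auto
    next
      case False
      then show ?thesis using inactive u I3[OF u] unfolding pay' a_def by simp
    qed
  next
    fix w assume w: "w \<in> insert v X" and aw: "act w"
    have *: "\<sigma>' w \<in> nb w \<and> capacity G (\<sigma>' w) \<noteq> 0 \<and> R w (\<sigma>' w) \<le> \<alpha>' w \<and>
        W (\<sigma>' w) + R w (\<sigma>' w) \<le> \<alpha>' w + pay (insert v X) \<alpha>' out' (\<sigma>' w)"
    proof (cases "w = v")
      case True
      then have av: "act v" using aw by simp
      have "us < n" using active[OF av] nb_lt[OF v(1)] by blast
      then have "W us = rem us + pay X \<alpha> out us" using active[OF av] I3[of us] by simp
      then show ?thesis using active[OF av] True av unfolding pay' at_v a_def by (simp add: at_v a_def)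
    next
      case False
      then have wX: "w \<in> X" using w by simp
      show ?thesis using I4[OF wX aw] \<sigma>'other[OF False] other[OF wX] unfolding pay' by auto
    qed
    show "\<sigma>' w \<in> nb w" "capacity G (\<sigma>' w) \<noteq> 0" "R w (\<sigma>' w) \<le> \<alpha>' w"
      "W (\<sigma>' w) + R w (\<sigma>' w) \<le> \<alpha>' w + pay (insert v X) \<alpha>' out' (\<sigma>' w)" using * by auto
  next
    fix w u assume w: "w \<in> insert v X" and aw: "act w" and u: "u \<in> nb w" "capacity G u \<noteq> 0"
    show "\<alpha>' w \<le> W u + R w u"
    proof (cases "w = v")
      case True
      then have "u < n" using nb_lt v u by blast
      then have "rem u \<le> W u" using I3[of u] u by simp
      moreover have "b \<le> rem u + R v u" using active aw u True by auto
      ultimately show ?thesis using True aw by (simp add: at_v a_def)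
    next
      case False
      then show ?thesis using I5[OF _ aw u] w other by auto
    qed
  next
    fix w assume "w \<in> insert v X" "\<not> act w"
    then show "\<alpha>' w = 0" using I6 other at_v by (cases "w = v") (auto simp: a_def)
  next
    fix w assume "w < n" "w \<notin> insert v X \<or> \<not> act w"
    then show "\<sigma>' w = w" using I7[of w] inactive v active by (cases "w = v"; cases "act v") auto
  qed
  then show ?thesis using X v unfolding reachable_def by blast
qed

text \<open>Each opened facility \<open>u\<close> chooses one of its clients, \<open>r u\<close>.
  The payment of \<open>r u\<close> covers its own service and the part of the opening cost missing
  from \<open>pay\<close>; the payments of all other clients cover their service. This uses every
  payment once, and the sum of \<open>pay\<close> counts it at most \<open>D + 1\<close> more times,
  once per element of \<open>out v\<close>.\<close>

lemma invar_total:
  assumes inv: "invar {..<n} rem \<sigma> \<alpha> out"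
  shows "(\<Sum>u\<in>\<sigma> ` {v\<in>{..<n}. act v}. W u) + (\<Sum>v\<in>{v\<in>{..<n}. act v}. R v (\<sigma> v)) \<le> (D + 2) * (\<Sum>v<n. \<alpha> v)"
proof -
  define A S r where "A = {v\<in>{..<n}. act v}" and "S = \<sigma> ` A" and "r = inv_into A \<sigma>"
  note I = inv[unfolded invar_def]
  have I1: "\<And>w. w < n \<Longrightarrow> out w \<subseteq> nb w \<and> card (out w) \<le> D + 1" using I by simp
  have I4: "\<And>w. w \<in> A \<Longrightarrow> \<sigma> w \<in> nb w \<and> R w (\<sigma> w) \<le> \<alpha> w \<and>
        W (\<sigma> w) + R w (\<sigma> w) \<le> \<alpha> w + pay {..<n} \<alpha> out (\<sigma> w)" using I unfolding A_def by simp
  have fin: "finite A" "finite S" unfolding A_def S_def by auto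
  have r: "r u \<in> A" "\<sigma> (r u) = u" if "u \<in> S" for u
    using that unfolding r_def S_def by (auto intro: inv_into_into f_inv_into_f)
  have inj: "inj_on r S" using r by (metis inj_onI)
  have rS: "r ` S \<subseteq> A" using r by auto
  have "(\<Sum>u\<in>S. W u) + (\<Sum>v\<in>A. R v (\<sigma> v))
      = (\<Sum>u\<in>S. W u) + (\<Sum>u\<in>S. R (r u) u) + (\<Sum>v\<in>A - r ` S. R v (\<sigma> v))"
    using sum.subset_diff[OF rS fin(1), of "\<lambda>v. R v (\<sigma> v)"] sum.reindex[OF inj, of "\<lambda>v. R v (\<sigma> v)"] r
    by (simp add: o_def)
  also have "\<dots> = (\<Sum>u\<in>S. W u + R (r u) u) + (\<Sum>v\<in>A - r ` S. R v (\<sigma> v))"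
    by (simp add: sum.distrib)
  also have "\<dots> \<le> (\<Sum>u\<in>S. \<alpha> (r u) + pay {..<n} \<alpha> out u) + (\<Sum>v\<in>A - r ` S. \<alpha> v)"
  proof (rule add_mono[OF sum_mono sum_mono])
    show "W u + R (r u) u \<le> \<alpha> (r u) + pay {..<n} \<alpha> out u" if "u \<in> S" for u
      using I4[OF r(1)[OF that]] unfolding r(2)[OF that] by simp
    show "R v (\<sigma> v) \<le> \<alpha> v" if "v \<in> A - r ` S" for v
      using I4[of v] that by simp
  qed
  also have "\<dots> = (\<Sum>v\<in>A. \<alpha> v) + (\<Sum>u\<in>S. pay {..<n} \<alpha> out u)"
    using sum.subset_diff[OF rS fin(1), of \<alpha>] sum.reindex[OF inj, of \<alpha>]
    by (simp add: o_def sum.distrib)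
  also have "(\<Sum>v\<in>A. \<alpha> v) \<le> (\<Sum>v<n. \<alpha> v)"
    unfolding A_def by (intro sum_mono2) auto
  also have "(\<Sum>u\<in>S. pay {..<n} \<alpha> out u) = (\<Sum>v<n. \<Sum>u\<in>S. if u \<in> out v then \<alpha> v - R v u else 0)"
    unfolding pay_def by (rule sum.swap)
  also have "\<dots> \<le> (\<Sum>v<n. (D + 1) * \<alpha> v)"
  proof (intro sum_mono)
    fix v assume v: "v \<in> {..<n}"
    have fo: "finite (out v)" using I1[of v] v finite_nb finite_subset by auto
    have "(\<Sum>u\<in>S. if u \<in> out v then \<alpha> v - R v u else 0) = (\<Sum>u\<in>S \<inter> out v. \<alpha> v - R v u)"
      using fin by (simp add: sum.inter_restrict)
    also have "\<dots> \<le> (\<Sum>u\<in>out v. \<alpha> v)"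
      using fo by (intro order_trans[OF sum_mono[of "S \<inter> out v" _ "\<lambda>_. \<alpha> v"] sum_mono2]) auto
    also have "\<dots> \<le> (D + 1) * \<alpha> v"
      unfolding sum_constant of_nat_id using I1[of v] v by (intro mult_le_mono1) simp
    finally show "(\<Sum>u\<in>S. if u \<in> out v then \<alpha> v - R v u else 0) \<le> (D + 1) * \<alpha> v" .
  qed
  also have "(\<Sum>v<n. (D + 1) * \<alpha> v) = (D + 1) * (\<Sum>v<n. \<alpha> v)" by (rule sum_distrib_left[symmetric])
  finally show ?thesis unfolding A_def[symmetric] S_def[symmetric] by (simp add: algebra_simps)
qed

section \<open>The resulting assignment compared with the optimum\<close>

definition assign :: "(nat \<Rightarrow> nat) \<Rightarrow> nat \<Rightarrow> nat \<Rightarrow> real" where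
  "assign \<sigma> v u = (if \<sigma> v = u then demand G v else 0)"

lemma assign_feasible:
  assumes inv: "invar {..<n} rem \<sigma> \<alpha> out"
  shows "feasible G (assign \<sigma>)"
  unfolding feasible_def demand_assignment_def
proof (intro conjI ballI)
  fix v assume "v \<in> verts G"
  then have v: "v < n" using vs by simp
  have "\<sigma> v \<in> nb v" using inv v nb_self[of v] unfolding invar_def by (cases "act v") auto
  then have "(\<Sum>u\<in>nb v. assign \<sigma> v u) = demand G v"
    using finite_nb unfolding assign_def by (simp add: sum.delta)
  then show "demand G v \<le> (\<Sum>u\<in>nb v. assign \<sigma> v u)" by simp
qed (use nonneg vs in \<open>auto simp: assign_def\<close>)

lemma assign_cost:
  assumes inv: "invar {..<n} rem \<sigma> \<alpha> out" and all: "\<And>v. v < n \<Longrightarrow> demand G v \<noteq> 0 \<Longrightarrow> act v"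
  shows "assignment_cost G (assign \<sigma>) \<le> ereal ((D + 2) * (\<Sum>v<n. real (\<alpha> v)) / scale)"
proof -
  define A where "A = {v\<in>{..<n}. act v}"
  define load where "load = assigned_load G (assign \<sigma>)"
  have \<sigma>: "\<sigma> v \<in> nb v" "act v \<Longrightarrow> capacity G (\<sigma> v) \<noteq> 0" if "v < n" for v
    using inv that nb_self[of v] unfolding invar_def by (cases "act v"; auto)+
  have load: "load u = (\<Sum>v\<in>{v\<in>A. \<sigma> v = u}. demand G v)" if u: "u < n" for u
  proof -
    have "load u = (\<Sum>v\<in>nb u. if \<sigma> v = u then demand G v else 0)"
      unfolding load_def assigned_load_def assign_def ..
    also have "\<dots> = (\<Sum>v\<in>{v\<in>A. \<sigma> v = u}. demand G v)"
    proof (intro sum.mono_neutral_cong_right finite_nb)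
      show "{v \<in> A. \<sigma> v = u} \<subseteq> nb u" using \<sigma>(1) nb_sym unfolding A_def by auto
      show "\<forall>v\<in>nb u - {v \<in> A. \<sigma> v = u}. (if \<sigma> v = u then demand G v else 0) = 0"
        using all nb_lt[OF u] unfolding A_def by auto
    qed auto
    finally show ?thesis .
  qed
  have idle: "load u = 0" if "u < n" "u \<notin> \<sigma> ` A" for u
    using that by (subst load) (auto intro!: sum.neutral)
  have cap: "capacity G u \<noteq> 0" if "u \<in> \<sigma> ` A" for u
    using that \<sigma>(2) unfolding A_def by auto
  have lt: "u < n" if "u \<in> \<sigma> ` A" for u
    using that \<sigma>(1) nb_lt unfolding A_def by auto
  have load0: "0 \<le> load u" if "u < n" for u
    using load[OF that] nonneg(3) unfolding A_def by (auto intro!: sum_nonneg)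
  have "\<not> (\<exists>v\<in>verts G. capacity G v = 0 \<and> 0 < load v)"
    using idle cap vs by force
  then have "assignment_cost G (assign \<sigma>) = ereal (\<Sum>u<n. cost G u * of_int (multiplicity_of G (assign \<sigma>) u))"
    unfolding assignment_cost_def load_def vs by simp
  moreover have "scale * (\<Sum>u<n. cost G u * of_int (multiplicity_of G (assign \<sigma>) u)) \<le> (D + 2) * (\<Sum>v<n. real (\<alpha> v))"
  proof -
    have "(\<Sum>u<n. cost G u * of_int (multiplicity_of G (assign \<sigma>) u)) =
        (\<Sum>u\<in>\<sigma> ` A. cost G u * of_int (multiplicity_of G (assign \<sigma>) u))"
      using lt idle unfolding multiplicity_of_def load_def by (intro sum.mono_neutral_right) auto
    also have "scale * \<dots> \<le> (\<Sum>u\<in>\<sigma> ` A. real (W u) + (\<Sum>v\<in>{v\<in>A. \<sigma> v = u}. real (R v (\<sigma> v))))"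
      unfolding sum_distrib_left
    proof (intro sum_mono)
      fix u assume u: "u \<in> \<sigma> ` A"
      \<comment> \<open>Rounding up adds at most one copy, whose price is the opening cost. Vertices
        without clients have load 0 and multiplicity 0, so they pay no such copy.\<close>
      have "of_int (multiplicity_of G (assign \<sigma>) u) \<le> load u / capacity G u + 1"
        unfolding multiplicity_of_def load_def by linarith
      then have "scale * (cost G u * of_int (multiplicity_of G (assign \<sigma>) u)) \<le>
          scale * (cost G u * (load u / capacity G u + 1))"
        using scale nonneg(1)[OF lt[OF u]] by (intro mult_left_mono) auto
      also have "\<dots> = real (W u) + scale * (load u * (cost G u / capacity G u))"
        using W[OF lt[OF u] cap[OF u]] by (simp add: algebra_simps)
      also have "scale * (load u * (cost G u / capacity G u)) = (\<Sum>v\<in>{v\<in>A. \<sigma> v = u}. real (R v (\<sigma> v)))"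
        using R[OF lt[OF u] _ cap[OF u]] unfolding load[OF lt[OF u]] sum_distrib_left sum_distrib_right
        by (intro sum.cong) (auto simp: A_def)
      finally show "scale * (cost G u * of_int (multiplicity_of G (assign \<sigma>) u)) \<le>
          real (W u) + (\<Sum>v\<in>{v\<in>A. \<sigma> v = u}. real (R v (\<sigma> v)))" .
    qed
    also have "\<dots> = real ((\<Sum>u\<in>\<sigma> ` A. W u) + (\<Sum>v\<in>A. R v (\<sigma> v)))"
      using sum.image_gen[of A "\<lambda>v. real (R v (\<sigma> v))" \<sigma>] by (simp add: sum.distrib A_def)
    also have "\<dots> \<le> real ((D + 2) * (\<Sum>v<n. \<alpha> v))"
      using invar_total[OF inv] unfolding A_def of_nat_le_iff .
    finally show ?thesis by (simp add: distrib_right)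
  qed
  ultimately show ?thesis using scale by (simp add: field_simps)
qed

text \<open>The payment of a client is split among facilities in proportion to the demand that
  \<open>f\<close> sends to them, and each portion is bounded by \<open>share\<close>. Summing the
  shares at one facility instead of at one client then bounds everything by its cost under
  \<open>f\<close>.\<close>

lemma opt_lower_bound:
  assumes inv: "invar {..<n} rem \<sigma> \<alpha> out" and f: "feasible G f"
    and cap: "\<And>u. u < n \<Longrightarrow> 0 < assigned_load G f u \<Longrightarrow> capacity G u \<noteq> 0"
  shows "(\<Sum>v<n. real (\<alpha> v)) \<le> (D + 3) * (scale * (\<Sum>u<n. cost G u * of_int (multiplicity_of G f u)))"
proof -
  note I = inv[unfolded invar_def]
  have I1: "\<And>w. w < n \<Longrightarrow> out w \<subseteq> nb w \<and> card (out w) \<le> D + 1" using I by simp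
  have I2: "\<And>w u. w < n \<Longrightarrow> u \<in> nb w \<Longrightarrow> u \<in> out w \<or> w \<in> out u"
    using I by (elim conjE) (metis lessThan_iff)
  have I3: "\<And>u. u < n \<Longrightarrow> capacity G u \<noteq> 0 \<Longrightarrow> pay {..<n} \<alpha> out u \<le> W u" using I by (metis le_add2)
  have I5: "\<And>w u. w < n \<Longrightarrow> act w \<Longrightarrow> u \<in> nb w \<Longrightarrow> capacity G u \<noteq> 0 \<Longrightarrow> \<alpha> w \<le> W u + R w u" using I by simp
  have I6: "\<And>w. w < n \<Longrightarrow> \<not> act w \<Longrightarrow> \<alpha> w = 0" using I by simp
  define load where "load = assigned_load G f"
  have f0: "0 \<le> f v u" if "v < n" "u < n" for v u
    using f that vs unfolding feasible_def demand_assignment_def by auto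
  have load_ge: "f v u \<le> load u" if "v < n" "u \<in> nb v" for v u
    unfolding load_def assigned_load_def
    using that nb_sym[OF that] nb_lt[OF that] nb_lt[of u] f0 finite_nb by (intro member_le_sum) auto
  have load0: "0 \<le> load u" if "u < n" for u
    unfolding load_def assigned_load_def using that nb_lt f0 by (intro sum_nonneg) auto
  define opened where "opened u = (if 0 < load u then 1 else 0 :: real)" for u
  \<comment> \<open>If \<open>u\<close> is in \<open>out v\<close>, the excess over service is part
    of \<open>pay\<close> and hence of the budget \<open>W u\<close>. Otherwise \<open>v\<close> is
    in \<open>out u\<close>, and the whole opening cost is charged, which happens for at most
    \<open>D + 1\<close> clients. The last term is the exact service cost.\<close>
  define share where "share v u = opened u * ((if u \<in> out v then real (\<alpha> v - R v u) else 0) +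
      (if v \<in> out u then real (W u) else 0)) + scale * (cost G u / capacity G u) * f v u" for v u
  have share0: "0 \<le> share v u" if "v < n" "u < n" for v u
    unfolding share_def opened_def using nonneg that scale f0[OF that] by auto
  have charge: "real (\<alpha> v) \<le> (\<Sum>u\<in>nb v. share v u)" if v: "v < n" for v
  proof (cases "act v")
    case False
    then show ?thesis using I6[OF v] share0[OF v] nb_lt[OF v] by (auto intro!: sum_nonneg)
  next
    case True
    \<comment> \<open>\<open>f\<close> may assign more than the demand. Dividing by the assigned
      amount makes the weights sum to 1, and \<open>demand G v / T\<close> at most 1 keeps the
      service term valid.\<close>
    define T where "T = (\<Sum>u\<in>nb v. f v u)"
    have T: "demand G v \<le> T" "0 < demand G v"
      using f v vs True nonneg(3)[OF v] unfolding feasible_def T_def act_def by auto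
    have "real (\<alpha> v) * (f v u / T) \<le> share v u" if u: "u \<in> nb v" for u
    proof (cases "f v u = 0")
      case True
      then show ?thesis using share0[OF v nb_lt[OF v u]] by simp
    next
      case False
      have un: "u < n" using nb_lt[OF v u] .
      have fpos: "0 < f v u" using False f0[OF v un] by simp
      have op: "opened u = 1" "0 < load u" using load_ge[OF v u] fpos unfolding opened_def by auto
      have cu: "capacity G u \<noteq> 0" using cap[OF un] op(2) unfolding load_def by blast
      define l where "l = f v u / T"
      have "f v u \<le> T" unfolding T_def
        using u finite_nb f0[OF v] nb_lt[OF v] by (intro member_le_sum) auto
      then have l: "0 \<le> l" "l \<le> 1" using T fpos unfolding l_def by auto
      have rho: "0 \<le> cost G u / capacity G u" using nonneg un by simp
      have "l * real (R v u) = scale * (cost G u / capacity G u) * (f v u * (demand G v / T))"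
        using R[OF un v cu] unfolding l_def by (simp add: field_simps)
      also have "\<dots> \<le> scale * (cost G u / capacity G u) * f v u"
      proof (rule mult_left_mono)
        show "f v u * (demand G v / T) \<le> f v u" using T fpos by (intro mult_left_le) auto
        show "0 \<le> scale * (cost G u / capacity G u)" using scale rho by (intro mult_nonneg_nonneg) auto
      qed
      finally have lR: "l * real (R v u) \<le> scale * (cost G u / capacity G u) * f v u" .
      define x where "x = (if u \<in> out v then real (\<alpha> v - R v u) else 0) + (if v \<in> out u then real (W u) else 0)"
      have "real (\<alpha> v) \<le> x + real (R v u)"
      proof (cases "u \<in> out v")
        case True
        then show ?thesis unfolding x_def by auto
      next
        case False
        then have "v \<in> out u" using I2[OF v u] by blast
        then show ?thesis using I5[OF v \<open>act v\<close> u cu] unfolding x_def by simp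
      qed
      then have "l * real (\<alpha> v) \<le> l * (x + real (R v u))" using l by (intro mult_left_mono)
      also have "\<dots> \<le> x + l * real (R v u)"
        using l mult_right_le_one_le[of x l] unfolding x_def by (simp add: algebra_simps)
      also have "\<dots> \<le> share v u" using lR unfolding share_def op(1) x_def by simp
      finally show ?thesis unfolding l_def by (simp add: mult.commute)
    qed
    then have "(\<Sum>u\<in>nb v. real (\<alpha> v) * (f v u / T)) \<le> (\<Sum>u\<in>nb v. share v u)" by (intro sum_mono)
    moreover have "(\<Sum>u\<in>nb v. real (\<alpha> v) * (f v u / T)) = real (\<alpha> v)"
      using T unfolding sum_distrib_left[symmetric] sum_divide_distrib[symmetric] T_def[symmetric] by simp
    ultimately show ?thesis by simp
  qed
  have "(\<Sum>v<n. real (\<alpha> v)) \<le> (\<Sum>v<n. \<Sum>u\<in>nb v. share v u)"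
    using charge by (intro sum_mono) auto
  also have "\<dots> = (\<Sum>u<n. \<Sum>v\<in>nb u. share v u)"
  proof -
    have "{u. u \<in> {..<n} \<and> u \<in> nb v} = nb v" if "v < n" for v using nb_lt[OF that] by auto
    moreover have "{v. v \<in> {..<n} \<and> u \<in> nb v} = nb u" if "u < n" for u
    proof -
      have "v \<in> {..<n} \<and> u \<in> nb v \<longleftrightarrow> v \<in> nb u" for v by (metis lessThan_iff nb_lt nb_sym that)
      then show ?thesis by simp
    qed
    ultimately show ?thesis
      using sum.swap_restrict[of "{..<n}" "{..<n}" share "\<lambda>v u. u \<in> nb v"] by simp
  qed
  also have "\<dots> \<le> (\<Sum>u<n. (D + 3) * (scale * (cost G u * of_int (multiplicity_of G f u))))"
  proof (intro sum_mono)
    fix u assume "u \<in> {..<n}"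
    then have u: "u < n" by simp
    define m where "m = real_of_int (multiplicity_of G f u)"
    have nbu: "nb u \<subseteq> {..<n}" using nb_lt[OF u] by auto
    show "(\<Sum>v\<in>nb u. share v u) \<le> (D + 3) * (scale * (cost G u * of_int (multiplicity_of G f u)))"
    proof (cases "0 < load u")
      case False
      then have "load u = 0" using load0[OF u] by simp
      then have "(\<Sum>v\<in>nb u. scale * (cost G u / capacity G u) * f v u) = 0"
        unfolding load_def assigned_load_def sum_distrib_left[symmetric] by simp
      moreover have "m = 0" unfolding m_def multiplicity_of_def using \<open>load u = 0\<close> unfolding load_def by simp
      ultimately show ?thesis using False unfolding share_def opened_def m_def by simp
    next
      case True
      then have op: "opened u = 1" unfolding opened_def by simp
      have cu: "capacity G u \<noteq> 0" using cap[OF u] True unfolding load_def by blast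
      then have c: "0 < capacity G u" using nonneg(2)[OF u] by simp
      have m: "load u / capacity G u \<le> m" "1 \<le> m"
        using True c unfolding m_def multiplicity_of_def load_def by (linarith, simp)
      have "(\<Sum>v\<in>nb u. if u \<in> out v then real (\<alpha> v - R v u) else 0) \<le> real (pay {..<n} \<alpha> out u)"
        unfolding pay_def of_nat_sum using nbu by (intro order_trans[OF _ sum_mono2[OF _ nbu]] sum_mono) auto
      also have "\<dots> \<le> real (W u)" using I3[OF u cu] by simp
      finally have 1: "(\<Sum>v\<in>nb u. if u \<in> out v then real (\<alpha> v - R v u) else 0) \<le> real (W u)" .
      have "(\<Sum>v\<in>nb u. if v \<in> out u then real (W u) else 0) = card (out u) * real (W u)"
        using finite_nb I1[OF u] by (simp add: sum.inter_restrict[symmetric] Int_absorb1)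
      also have "\<dots> \<le> (D + 1) * real (W u)" using I1[OF u] by (intro mult_right_mono) auto
      finally have 2: "(\<Sum>v\<in>nb u. if v \<in> out u then real (W u) else 0) \<le> (D + 1) * real (W u)" .
      have "(\<Sum>v\<in>nb u. share v u) = (\<Sum>v\<in>nb u. if u \<in> out v then real (\<alpha> v - R v u) else 0) +
          (\<Sum>v\<in>nb u. if v \<in> out u then real (W u) else 0) + scale * (cost G u / capacity G u) * load u"
        unfolding share_def op load_def assigned_load_def by (simp add: sum.distrib sum_distrib_left)
      also have "\<dots> \<le> (D + 2) * real (W u) + scale * (cost G u * (load u / capacity G u))"
        using 1 2 by (simp add: algebra_simps)
      \<comment> \<open>A positive load makes the multiplicity \<open>m\<close> at least 1, so
        \<open>m\<close> copies pay for one opening cost; \<open>m\<close> is also at least the load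
        over the capacity, so they pay for the service once.\<close>
      also have "\<dots> \<le> (D + 2) * (scale * (cost G u * m)) + scale * (cost G u * m)"
      proof (intro add_mono mult_left_mono)
        have "scale * (cost G u * 1) \<le> scale * (cost G u * m)"
          using m(2) scale nonneg(1)[OF u] by (intro mult_left_mono) auto
        then show "real (W u) \<le> scale * (cost G u * m)" using W[OF u cu] by simp
      qed (use m scale nonneg(1)[OF u] in auto)
      finally show ?thesis unfolding m_def by (simp add: algebra_simps)
    qed
  qed
  finally show ?thesis by (simp add: sum_distrib_left mult_ac)
qed

lemma reachable_feasible: "reachable {..<n} rem \<sigma> \<Longrightarrow> feasible G (assign \<sigma>)"
  unfolding reachable_def using assign_feasible by blast

lemma assign_approx:
  assumes re: "reachable {..<n} rem \<sigma>" and f: "feasible G f"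
  shows "assignment_cost G (assign \<sigma>) \<le> ereal ((D + 2) * (D + 3)) * assignment_cost G f"
proof -
  obtain \<alpha> out where inv: "invar {..<n} rem \<sigma> \<alpha> out" using re unfolding reachable_def by blast
  show "assignment_cost G (assign \<sigma>) \<le> ereal ((D + 2) * (D + 3)) * assignment_cost G f"
  proof (cases "\<exists>v\<in>verts G. capacity G v = 0 \<and> 0 < assigned_load G f v")
    case True
    define k where "k = real ((D + 2) * (D + 3))"
    have "0 < k" unfolding k_def of_nat_0_less_iff by simp
    moreover have "assignment_cost G f = \<infinity>" unfolding assignment_cost_def by (rule if_P[OF True])
    ultimately show ?thesis by (simp only: k_def[symmetric]) simp
  next
    case False
    define opt where "opt = (\<Sum>u<n. cost G u * of_int (multiplicity_of G f u))"
    have cap: "capacity G u \<noteq> 0" if "u < n" "0 < assigned_load G f u" for u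
      using False that vs by auto
    \<comment> \<open>At finite cost, a vertex with positive demand sends a positive amount to some
      closed neighbour, which therefore has nonzero capacity.\<close>
    have all: "act v" if v: "v < n" "demand G v \<noteq> 0" for v
    proof -
      have f0: "0 \<le> f w u" if "w < n" "u < n" for w u
        using f that vs unfolding feasible_def demand_assignment_def by auto
      have "0 < demand G v" using v nonneg(3)[of v] by simp
      also have "\<dots> \<le> (\<Sum>u\<in>nb v. f v u)" using f v vs unfolding feasible_def by auto
      finally obtain u where u: "u \<in> nb v" "0 < f v u" by (meson not_le sum_nonpos)
      note un = nb_lt[OF v(1) u(1)]
      have "f v u \<le> assigned_load G f u"
        unfolding assigned_load_def using nb_sym[OF v(1) u(1)] un nb_lt[OF un] f0 finite_nb
        by (intro member_le_sum) auto
      then have "capacity G u \<noteq> 0" using cap[OF un] u(2) by simp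
      then show ?thesis using u v unfolding act_def by blast
    qed
    have "(D + 2) * (\<Sum>v<n. real (\<alpha> v)) \<le> (D + 2) * ((D + 3) * (scale * opt))"
      unfolding opt_def by (intro mult_left_mono opt_lower_bound[OF inv f cap]) auto
    then have "(D + 2) * (\<Sum>v<n. real (\<alpha> v)) / scale \<le> (D + 2) * (D + 3) * opt"
      using scale by (simp add: field_simps)
    then have "assignment_cost G (assign \<sigma>) \<le> ereal ((D + 2) * (D + 3) * opt)"
      using assign_cost[OF inv all] by (meson ereal_less_eq(3) order_trans)
    moreover have "assignment_cost G f = ereal opt"
      using False unfolding assignment_cost_def opt_def vs by simp
    ultimately show ?thesis by simp
  qed
qed

end

subsection \<open>Structured programs on the random access machine\<close>

lemma bit_length_pos: "1 \<le> bit_length n"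
  by (subst bit_length.simps) simp

lemma less_two_power_bit_length: "n < 2 ^ bit_length n"
proof (induction n rule: bit_length.induct)
  case (1 n)
  show ?case
  proof (cases "n < 2")
    case True
    then show ?thesis by (simp add: bit_length.simps)
  next
    case False
    then have "n div 2 < 2 ^ bit_length (n div 2)" using 1 by simp
    then have "n < 2 ^ Suc (bit_length (n div 2))" by simp
    then show ?thesis using False by (subst bit_length.simps) simp
  qed
qed

lemma bit_length_le: "n < 2 ^ k \<Longrightarrow> 1 \<le> k \<Longrightarrow> bit_length n \<le> k"
proof (induction n arbitrary: k rule: bit_length.induct)
  case (1 n)
  show ?case
  proof (cases "n < 2")
    case True
    then show ?thesis using 1 by (simp add: bit_length.simps)
  next
    case False
    then obtain m where m: "k = Suc m" "1 \<le> m"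
      using 1(2,3) by (cases k; cases "k = 1") auto
    then have "n div 2 < 2 ^ m" using 1(2) by (simp add: less_mult_imp_div_less mult.commute)
    then have "bit_length (n div 2) \<le> m" using 1(1) False m by simp
    then show ?thesis using False m by (subst bit_length.simps) simp
  qed
qed

text \<open>The weight, multiplied by \<open>L\<close>, bounds both the length of the value and the
  evaluation time when cells are below \<open>2 ^ L\<close>. The factor 2 pays for the operands and
  once more for the result, which is at most as long as both operands together.\<close>

fun exp_weight :: "ram_exp \<Rightarrow> nat" where
  "exp_weight (Lit n) = bit_length n"
| "exp_weight (Deref a) = exp_weight a + 1"
| "exp_weight (Add a b) = 2 * (exp_weight a + exp_weight b)"
| "exp_weight (Sub a b) = 2 * (exp_weight a + exp_weight b)"
| "exp_weight (Mul a b) = 2 * (exp_weight a + exp_weight b)"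
| "exp_weight (Quot a b) = 2 * (exp_weight a + exp_weight b)"

lemma exp_weight_pos: "1 \<le> exp_weight e"
  by (induction e) (auto simp: bit_length_pos[unfolded One_nat_def])

lemma exp_weight_bounds:
  assumes s: "\<And>i. s i < 2 ^ L" and L: "1 \<le> L"
  shows "exp_val e s < 2 ^ (exp_weight e * L) \<and> exp_time e s \<le> exp_weight e * L"
proof -
  \<comment> \<open>All four operations are bounded by the sum or the product of their arguments. A
    sum is absorbed by the product of the bounds since both bounds are at least 2.\<close>
  have binop: "f x y < 2 ^ (2 * (p + q) * L) \<and> tx + ty + bit_length (f x y) \<le> 2 * (p + q) * L"
    if f: "f x y \<le> x + y \<or> f x y \<le> x * y" and x: "x < 2 ^ (p * L)" "tx \<le> p * L"
      and y: "y < 2 ^ (q * L)" "ty \<le> q * L" and pq: "1 \<le> p" "1 \<le> q"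
    for f :: "nat \<Rightarrow> nat \<Rightarrow> nat" and x y p q tx ty
  proof -
    have pL: "1 \<le> p * L" "1 \<le> q * L" using L pq by (simp_all add: Suc_le_eq)
    define X Y :: nat where "X = 2 ^ (p * L)" and "Y = 2 ^ (q * L)"
    have XY: "2 \<le> X" "2 \<le> Y" "x < X" "y < Y"
      unfolding X_def Y_def using x y pL power_increasing[of 1 "p * L" "2::nat"] power_increasing[of 1 "q * L" "2::nat"] by auto
    have "X + Y \<le> X * Y"
    proof -
      obtain X' Y' where "X = X' + 2" "Y = Y' + 2" using XY(1,2) by (metis add.commute le_Suc_ex)
      then show ?thesis by (simp add: algebra_simps)
    qed
    moreover have "x * y < X * Y" using XY by (intro mult_strict_mono) auto
    ultimately have "f x y < X * Y" using f XY by linarith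
    then have lt: "f x y < 2 ^ ((p + q) * L)" by (simp add: X_def Y_def power_add add_mult_distrib)
    moreover have "bit_length (f x y) \<le> (p + q) * L"
      using lt pL by (intro bit_length_le) (simp_all only: add_mult_distrib)
    moreover have "(2::nat) ^ ((p + q) * L) \<le> 2 ^ (2 * (p + q) * L)" by (intro power_increasing) auto
    ultimately have "f x y < 2 ^ (2 * (p + q) * L)" "bit_length (f x y) \<le> (p + q) * L" by linarith+
    then show ?thesis using x y by (simp add: algebra_simps)
  qed
  show ?thesis
  proof (induction e)
    case (Lit n)
    have "n < 2 ^ bit_length n" by (rule less_two_power_bit_length)
    also have "\<dots> \<le> 2 ^ (bit_length n * L)" using L by (intro power_increasing) auto
    finally show ?case using L by simp
  next
    case (Deref a)
    have "bit_length (s (exp_val a s)) \<le> L" using s L by (intro bit_length_le) auto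
    moreover have "s (exp_val a s) < 2 ^ (exp_weight a * L + L)"
      by (rule less_le_trans[OF s power_increasing]) auto
    ultimately show ?case using Deref by (simp add: add.commute)
  next
    case (Add a b)
    then show ?case using binop[where f = "(+)" and x = "exp_val a s" and y = "exp_val b s"
      and p = "exp_weight a" and q = "exp_weight b" and tx = "exp_time a s" and ty = "exp_time b s"] exp_weight_pos
      by simp
  next
    case (Sub a b)
    have "exp_val a s - exp_val b s \<le> exp_val a s + exp_val b s" by linarith
    then show ?case using Sub binop[where f = "(-)" and x = "exp_val a s" and y = "exp_val b s"
      and p = "exp_weight a" and q = "exp_weight b" and tx = "exp_time a s" and ty = "exp_time b s"] exp_weight_pos
      by simp
  next
    case (Mul a b)
    then show ?case using binop[where f = "(*)" and x = "exp_val a s" and y = "exp_val b s"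
      and p = "exp_weight a" and q = "exp_weight b" and tx = "exp_time a s" and ty = "exp_time b s"] exp_weight_pos
      by simp
  next
    case (Quot a b)
    have "exp_val a s div exp_val b s \<le> exp_val a s" by simp
    then have "exp_val a s div exp_val b s \<le> exp_val a s + exp_val b s" by linarith
    then show ?case using Quot binop[where f = "(div)" and x = "exp_val a s" and y = "exp_val b s"
      and p = "exp_weight a" and q = "exp_weight b" and tx = "exp_time a s" and ty = "exp_time b s"] exp_weight_pos
      by simp
  qed
qed

text \<open>An upper bound for the running time when cells stay below \<open>2 ^ L\<close> and
  every loop makes at most \<open>n\<close> iterations.\<close>

fun time_bound :: "nat \<Rightarrow> nat \<Rightarrow> ram_prog \<Rightarrow> nat" where
  "time_bound n L Skip = 1"
| "time_bound n L (Store a b) = 1 + exp_weight a * L + exp_weight b * L"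
| "time_bound n L (Seq P Q) = time_bound n L P + time_bound n L Q"
| "time_bound n L (Cond b P Q) = 1 + exp_weight b * L + time_bound n L P + time_bound n L Q"
| "time_bound n L (Loop b P) = (n + 1) * (1 + exp_weight b * L + time_bound n L P)"

text \<open>The nesting of loops is fixed by the program, so the bound stays polynomial even when
  the cell length \<open>L\<close> is itself a polynomial in the input size.\<close>

lemma time_bound_poly: "\<exists>p :: nat poly. \<forall>x. time_bound x (poly l x) P = poly p x"
proof (induction P)
  case Skip
  show ?case by (intro exI[of _ 1]) simp
next
  case (Store a b)
  show ?case
    by (intro exI[of _ "1 + [:exp_weight a:] * l + [:exp_weight b:] * l"]) (simp add: algebra_simps)
next
  case (Seq P Q)
  then obtain p q where "\<forall>x. time_bound x (poly l x) P = poly p x" "\<forall>x. time_bound x (poly l x) Q = poly q x" by blast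
  then show ?case by (intro exI[of _ "p + q"]) simp
next
  case (Cond b P Q)
  then obtain p q where "\<forall>x. time_bound x (poly l x) P = poly p x" "\<forall>x. time_bound x (poly l x) Q = poly q x" by blast
  then show ?case by (intro exI[of _ "1 + [:exp_weight b:] * l + p + q"]) (simp add: algebra_simps)
next
  case (Loop b P)
  then obtain p where "\<forall>x. time_bound x (poly l x) P = poly p x" by blast
  then show ?case by (intro exI[of _ "[:1, 1:] * (1 + [:exp_weight b:] * l + p)"]) (simp add: algebra_simps)
qed

lemma time_bound_mono: "n \<le> m \<Longrightarrow> time_bound n L P \<le> time_bound m L P"
proof (induction P)
  case (Loop b P)
  then show ?case unfolding time_bound.simps by (intro mult_le_mono) auto
qed auto

text \<open>Cell 0 holds a base address \<open>B\<close>; entry \<open>i\<close> of array \<open>j < 8\<close> is cell \<open>B + 8 * i + j\<close>, and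
  array 8 is the memory below \<open>B\<close>, which holds first the input and in the end the output.
  The entries of array 7 serve as variables.\<close>

type_synonym arrays = "nat \<Rightarrow> nat \<Rightarrow> nat"

definition layout :: "nat \<Rightarrow> arrays \<Rightarrow> memory" where
  "layout B a i = (if i = 0 then B else if i < B then a 8 i else a ((i - B) mod 8) ((i - B) div 8))"

definition set_arr :: "nat \<Rightarrow> nat \<Rightarrow> nat \<Rightarrow> arrays \<Rightarrow> arrays" where
  "set_arr j i x a = a(j := (a j)(i := x))"

lemma set_arr_apply [simp]: "set_arr j i x a k l = (if k = j \<and> l = i then x else a k l)"
  by (auto simp: set_arr_def)

lemma set_arr_other [simp]: "k \<noteq> j \<Longrightarrow> set_arr j i x a k = a k"
  by (auto simp: set_arr_def)

definition Cell :: "nat \<Rightarrow> ram_exp \<Rightarrow> ram_exp" where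
  "Cell j e = Add (Deref (Lit 0)) (Add (Mul (Lit 8) e) (Lit j))"

abbreviation Arr :: "nat \<Rightarrow> ram_exp \<Rightarrow> ram_exp" where "Arr j e \<equiv> Deref (Cell j e)"
abbreviation Var :: "nat \<Rightarrow> ram_exp" where "Var i \<equiv> Arr 7 (Lit i)"
abbreviation SetVar :: "nat \<Rightarrow> ram_exp \<Rightarrow> ram_prog" where "SetVar i \<equiv> Store (Cell 7 (Lit i))"

text \<open>The truncated difference is nonzero exactly while variable \<open>i\<close> is below
  variable 0. With the number of vertices in variable 0, every loop thus respects the iteration
  count charged by \<open>time_bound\<close>.\<close>

definition For :: "nat \<Rightarrow> ram_prog \<Rightarrow> ram_prog" where
  "For i P = Seq (SetVar i (Lit 0)) (Loop (Sub (Var 0) (Var i)) (Seq P (SetVar i (Add (Var i) (Lit 1)))))"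

section \<open>Hoare triples with built-in time and size bounds\<close>

locale ram_frame =
  fixes B L n :: nat
  assumes B: "0 < B" "B < 2 ^ L" and n: "n < 2 ^ L" and L: "1 \<le> L"
begin

lemma one_small: "Suc 0 < 2 ^ L"
  using L by (metis One_nat_def Suc_1 lessI one_less_power less_eq_Suc_le)

definition val :: "ram_exp \<Rightarrow> arrays \<Rightarrow> nat" where
  "val e a = exp_val e (layout B a)"

lemma val_simps [simp]:
  "val (Lit k) a = k"
  "val (Add e f) a = val e a + val f a"
  "val (Sub e f) a = val e a - val f a"
  "val (Mul e f) a = val e a * val f a"
  "val (Quot e f) a = val e a div val f a"
  by (simp_all add: val_def)

lemma val_Cell: "val (Cell j e) a = B + (8 * val e a + j)"
  by (simp add: val_def Cell_def layout_def)

lemma val_Arr [simp]: "j < 8 \<Longrightarrow> val (Arr j e) a = a j (val e a)"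
  using B(1) val_Cell[of j e a] by (simp add: val_def layout_def)

lemma val_low: "0 < val e a \<Longrightarrow> val e a < B \<Longrightarrow> val (Deref e) a = a 8 (val e a)"
  by (simp add: val_def layout_def)

lemma layout_set: "j < 8 \<Longrightarrow> (layout B a)(B + (8 * i + j) := x) = layout B (set_arr j i x a)"
proof (rule ext)
  fix k assume j: "j < 8"
  show "((layout B a)(B + (8 * i + j) := x)) k = layout B (set_arr j i x a) k"
  proof (cases "B \<le> k")
    case True
    then obtain d where d: "k = B + d" using le_Suc_ex by blast
    have "d = 8 * i + j \<longleftrightarrow> d mod 8 = j \<and> d div 8 = i"
      using j div_mult_mod_eq[of d 8] by auto
    then have "(k = B + (8 * i + j)) = ((k - B) mod 8 = j \<and> (k - B) div 8 = i)" using d by simp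
    then show ?thesis using True B(1) j by (cases "k = B + (8 * i + j)") (auto simp: layout_def)
  next
    case False
    then show ?thesis using j by (simp add: layout_def)
  qed
qed

lemma layout_set_low: "0 < i \<Longrightarrow> i < B \<Longrightarrow> (layout B a)(i := x) = layout B (set_arr 8 i x a)"
proof (rule ext)
  fix k assume i: "0 < i" "i < B"
  have "(k - B) mod 8 \<noteq> 8" by (metis mod_less_divisor nat_less_le zero_less_numeral)
  then show "((layout B a)(i := x)) k = layout B (set_arr 8 i x a) k"
    using i by (auto simp: layout_def)
qed

definition small :: "arrays \<Rightarrow> bool" where
  "small a \<longleftrightarrow> (\<forall>j i. a j i < 2 ^ L)"

lemma layout_small: "small a \<Longrightarrow> layout B a i < 2 ^ L"
  using B by (simp add: small_def layout_def)

lemma exp_time_le: "small a \<Longrightarrow> exp_time e (layout B a) \<le> exp_weight e * L"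
  using exp_weight_bounds[of "layout B a" L e] layout_small L by simp

text \<open>Total correctness, with the time bound and the preservation of \<open>small\<close>
  included: a functional correctness proof yields the running time as well.\<close>

definition triple :: "(arrays \<Rightarrow> bool) \<Rightarrow> ram_prog \<Rightarrow> (arrays \<Rightarrow> bool) \<Rightarrow> bool" where
  "triple Q P Q' \<longleftrightarrow> (\<forall>a. small a \<and> Q a \<longrightarrow>
     (\<exists>t a'. ram_run P (layout B a) t (layout B a') \<and> t \<le> time_bound n L P \<and> small a' \<and> Q' a'))"

lemma triple_Skip: "(\<And>a. Q a \<Longrightarrow> Q' a) \<Longrightarrow> triple Q Skip Q'"
  unfolding triple_def using ram_run.Skip by fastforce

lemma triple_conseq: "triple Q P Q' \<Longrightarrow> (\<And>a. R a \<Longrightarrow> Q a) \<Longrightarrow> (\<And>a. Q' a \<Longrightarrow> R' a) \<Longrightarrow> triple R P R'"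
  unfolding triple_def by meson

text \<open>Fixes the initial state, so that the postcondition can refer to it.\<close>

lemma triple_ghost: "(\<And>a\<^sub>0. Q a\<^sub>0 \<Longrightarrow> triple (\<lambda>a. a = a\<^sub>0) P Q') \<Longrightarrow> triple Q P Q'"
  unfolding triple_def by blast

lemma triple_Seq: "triple Q P Q' \<Longrightarrow> triple Q' P' Q'' \<Longrightarrow> triple Q (Seq P P') Q''"
  unfolding triple_def by (metis (no_types, lifting) ram_run.Seq add_mono time_bound.simps(3))

lemma triple_Cond:
  assumes "triple (\<lambda>a. Q a \<and> val b a \<noteq> 0) P Q'" "triple (\<lambda>a. Q a \<and> val b a = 0) P' Q'"
  shows "triple Q (Cond b P P') Q'"
  unfolding triple_def
proof (intro allI impI, elim conjE)
  fix a assume a: "small a" "Q a"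
  show "\<exists>t a'. ram_run (Cond b P P') (layout B a) t (layout B a') \<and> t \<le> time_bound n L (Cond b P P') \<and> small a' \<and> Q' a'"
  proof (cases "val b a = 0")
    case True
    then obtain t a' where "ram_run P' (layout B a) t (layout B a')" "t \<le> time_bound n L P'" "small a'" "Q' a'"
      using assms(2) a unfolding triple_def by meson
    then show ?thesis
      using ram_run.CondFalse[of b "layout B a" P' t "layout B a'" P] True exp_time_le[OF a(1), of b]
      unfolding val_def by (intro exI[of _ "1 + exp_time b (layout B a) + t"] exI[of _ a']) auto
  next
    case False
    then obtain t a' where "ram_run P (layout B a) t (layout B a')" "t \<le> time_bound n L P" "small a'" "Q' a'"
      using assms(1) a unfolding triple_def by meson
    then show ?thesis
      using ram_run.CondTrue[of b "layout B a" P t "layout B a'" P'] False exp_time_le[OF a(1), of b]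
      unfolding val_def by (intro exI[of _ "1 + exp_time b (layout B a) + t"] exI[of _ a']) auto
  qed
qed

lemma triple_Store:
  assumes "\<And>a. small a \<Longrightarrow> Q a \<Longrightarrow> \<exists>a'. (layout B a)(val e a := val x a) = layout B a' \<and> small a' \<and> Q' a'"
  shows "triple Q (Store e x) Q'"
  unfolding triple_def
proof (intro allI impI, elim conjE)
  fix a assume a: "small a" "Q a"
  then obtain a' where "(layout B a)(val e a := val x a) = layout B a'" "small a'" "Q' a'" using assms by blast
  then show "\<exists>t a'. ram_run (Store e x) (layout B a) t (layout B a') \<and> t \<le> time_bound n L (Store e x) \<and> small a' \<and> Q' a'"
    using ram_run.Store[of e x "layout B a"] exp_time_le[OF a(1), of e] exp_time_le[OF a(1), of x]
    unfolding val_def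
    by (intro exI[of _ "1 + exp_time e (layout B a) + exp_time x (layout B a)"] exI[of _ a']) auto
qed

lemma triple_set:
  assumes "j < 8" "\<And>a. small a \<Longrightarrow> Q a \<Longrightarrow> val x a < 2 ^ L \<and> Q' (set_arr j (val e a) (val x a) a)"
  shows "triple Q (Store (Cell j e) x) Q'"
proof (rule triple_Store)
  fix a assume a: "small a" "Q a"
  show "\<exists>a'. (layout B a)(val (Cell j e) a := val x a) = layout B a' \<and> small a' \<and> Q' a'"
    using layout_set[OF assms(1)] assms(2)[OF a] a(1) unfolding val_Cell
    by (intro exI[of _ "set_arr j (val e a) (val x a) a"]) (auto simp: small_def)
qed

lemma triple_set_low:
  assumes "\<And>a. small a \<Longrightarrow> Q a \<Longrightarrow> 0 < val e a \<and> val e a < B \<and> val x a < 2 ^ L \<and> Q' (set_arr 8 (val e a) (val x a) a)"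
  shows "triple Q (Store e x) Q'"
proof (rule triple_Store)
  fix a assume a: "small a" "Q a"
  show "\<exists>a'. (layout B a)(val e a := val x a) = layout B a' \<and> small a' \<and> Q' a'"
    using layout_set_low assms[OF a] a(1)
    by (intro exI[of _ "set_arr 8 (val e a) (val x a) a"]) (auto simp: small_def)
qed

text \<open>The body must establish the next invariant for the arrays with the counter already
  advanced, so the increment needs no separate reasoning in applications.\<close>

lemma triple_For:
  assumes "0 < i"
    and start: "\<And>a. Q a \<Longrightarrow> I 0 (set_arr 7 i 0 a)"
    and ctr: "\<And>k a. k \<le> n \<Longrightarrow> I k a \<Longrightarrow> a 7 0 = n \<and> a 7 i = k"
    and body: "\<And>k. k < n \<Longrightarrow> triple (I k) P (\<lambda>a. a 7 i = k \<and> I (Suc k) (set_arr 7 i (Suc k) a))"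
    and fin: "\<And>a. I n a \<Longrightarrow> Q' a"
  shows "triple Q (For i P) Q'"
proof -
  define b where "b = Sub (Var 0) (Var i)"
  define S where "S = Seq P (SetVar i (Add (Var i) (Lit 1)))"
  have S: "triple (I k) S (I (Suc k))" if k: "k < n" for k
    unfolding S_def by (rule triple_Seq[OF body[OF k] triple_set]) (use k n in auto)
  have loop: "\<exists>t a'. ram_run (Loop b S) (layout B a) t (layout B a') \<and>
      t \<le> (m + 1) * (1 + exp_weight b * L + time_bound n L S) \<and> small a' \<and> I n a'"
    if "small a" "I k a" "k \<le> n" "m = n - k" for m k a
    using that
  proof (induction m arbitrary: k a)
    case 0
    then have "val b a = 0" using ctr[of k a] unfolding b_def by simp
    then show ?case
      using 0 ram_run.LoopFalse[of b "layout B a" S] exp_time_le[OF 0(1), of b] unfolding val_def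
      by (intro exI[of _ "1 + exp_time b (layout B a)"] exI[of _ a]) auto
  next
    case (Suc m)
    then have k: "k < n" and "val b a \<noteq> 0" using ctr[of k a] unfolding b_def by auto
    obtain t a' where t: "ram_run S (layout B a) t (layout B a')" "t \<le> time_bound n L S" "small a'" "I (Suc k) a'"
      using S[OF k] Suc.prems unfolding triple_def by meson
    moreover have "Suc k \<le> n" "m = n - Suc k" using Suc.prems k by auto
    ultimately obtain t' a'' where t': "ram_run (Loop b S) (layout B a') t' (layout B a'')"
      "t' \<le> (m + 1) * (1 + exp_weight b * L + time_bound n L S)" "small a''" "I n a''"
      using Suc.IH by blast
    show ?case
      using ram_run.LoopTrue[OF _ t(1) t'(1)] \<open>val b a \<noteq> 0\<close> t t' exp_time_le[OF Suc.prems(1), of b]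
      unfolding val_def
      by (intro exI[of _ "1 + exp_time b (layout B a) + t + t'"] exI[of _ a'']) auto
  qed
  have "triple (I 0) (Loop b S) (I n)"
    unfolding triple_def
  proof (intro allI impI, elim conjE)
    fix a assume "small a" "I 0 a"
    then show "\<exists>t a'. ram_run (Loop b S) (layout B a) t (layout B a') \<and> t \<le> time_bound n L (Loop b S) \<and> small a' \<and> I n a'"
      using loop[of a 0 n] by simp
  qed
  moreover have "triple Q (SetVar i (Lit 0)) (I 0)"
    by (rule triple_set) (use start in auto)
  ultimately have "triple Q (For i P) (I n)"
    unfolding For_def b_def[symmetric] S_def[symmetric] by (blast intro: triple_Seq)
  then show ?thesis by (rule triple_conseq) (use fin in simp_all)
qed

end

subsection \<open>The program\<close>

text \<open>Array 0 holds the unpaid opening costs, array 1 marks the eliminated vertices, array 2 holds the chosen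
  server of each vertex, arrays 3 and 4 numerator and denominator of its demand. The variables are
  0: number of vertices, 1: common scale, 2: sweep, 3: vertex \<open>v\<close>, 4: vertex \<open>u\<close>, 5: degree,
  6: cheapest option, 7: whether there is an option, 8: the vertex offering it.
  The parameters \<open>Par v 0\<close>, \<dots>, \<open>Par v 5\<close> are the numerators and denominators of cost, capacity and
  demand of \<open>v\<close>, as in the encoding of instances.\<close>

definition Adj :: "ram_exp \<Rightarrow> ram_exp \<Rightarrow> ram_exp" where
  "Adj e f = Deref (Add (Lit 2) (Add (Mul e (Var 0)) f))"

text \<open>The offset 2, as in \<open>Adj\<close>: entry \<open>k\<close> of the input list is in
  cell \<open>k + 1\<close>, and the list begins with \<open>n\<close>.\<close>

definition Par :: "ram_exp \<Rightarrow> nat \<Rightarrow> ram_exp" where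
  "Par e j = Deref (Add (Lit (2 + j)) (Add (Mul (Var 0) (Var 0)) (Mul (Lit 6) e)))"

definition Differ :: "ram_exp \<Rightarrow> ram_exp \<Rightarrow> ram_exp" where
  "Differ e f = Add (Sub e f) (Sub f e)"

text \<open>Logic on natural numbers: a sum is a disjunction, a product a conjunction, and
  \<open>Sub (Lit 1)\<close> a negation. The last factor is the numerator of the capacity, so only
  usable vertices count.\<close>

definition Near :: "ram_exp \<Rightarrow> ram_exp \<Rightarrow> ram_exp" where
  "Near e f = Mul (Add (Adj e f) (Sub (Lit 1) (Differ e f))) (Par f 2)"

definition Serve :: "ram_exp \<Rightarrow> ram_exp \<Rightarrow> ram_exp" where
  "Serve e f = Quot (Mul (Mul (Mul (Var 1) (Par e 4)) (Par f 0)) (Par f 3)) (Mul (Mul (Par e 5) (Par f 1)) (Par f 2))"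

definition Scale_prog :: ram_prog where
  "Scale_prog = Seq (SetVar 1 (Lit 1))
     (For 3 (SetVar 1 (Mul (Mul (Mul (Var 1) (Par (Var 3) 1)) (Par (Var 3) 5))
        (Add (Par (Var 3) 2) (Sub (Lit 1) (Par (Var 3) 2))))))"

text \<open>The demands are copied because the output will overwrite the input.\<close>

definition Init_prog :: ram_prog where
  "Init_prog = For 3
     (Seq (Store (Cell 0 (Var 3)) (Quot (Mul (Var 1) (Par (Var 3) 0)) (Par (Var 3) 1)))
     (Seq (Store (Cell 2 (Var 3)) (Var 3))
     (Seq (Store (Cell 3 (Var 3)) (Par (Var 3) 4))
       (Store (Cell 4 (Var 3)) (Par (Var 3) 5)))))"

definition Count_prog :: ram_prog where
  "Count_prog = Seq (SetVar 5 (Lit 0))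
     (For 4 (Cond (Mul (Adj (Var 3) (Var 4)) (Sub (Lit 1) (Arr 1 (Var 4))))
        (SetVar 5 (Add (Var 5) (Lit 1))) Skip))"

definition Option_cost :: ram_exp where
  "Option_cost = Add (Arr 0 (Var 4)) (Serve (Var 3) (Var 4))"

definition Choose_prog :: ram_prog where
  "Choose_prog = Seq (SetVar 6 (Lit 0)) (Seq (SetVar 7 (Lit 0))
     (For 4 (Cond (Mul (Near (Var 3) (Var 4)) (Add (Sub (Lit 1) (Var 7)) (Sub (Var 6) Option_cost)))
        (Seq (SetVar 6 Option_cost) (Seq (SetVar 7 (Lit 1)) (SetVar 8 (Var 4)))) Skip)))"

definition Update_prog :: ram_prog where
  "Update_prog = Seq (Store (Cell 2 (Var 3)) (Var 8))
     (For 4 (Cond (Mul (Near (Var 3) (Var 4)) (Sub (Lit 1) (Arr 1 (Var 4))))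
        (Store (Cell 0 (Var 4)) (Sub (Arr 0 (Var 4)) (Sub (Var 6) (Serve (Var 3) (Var 4))))) Skip))"

text \<open>\<open>v\<close> is marked only at the end, so during the update it still counts as
  remaining and its payment is also put towards its own opening cost.\<close>

definition Visit_prog :: ram_prog where
  "Visit_prog = Seq Count_prog (Cond (Sub (Lit 16) (Var 5))
     (Seq Choose_prog
       (Seq (Cond (Mul (Var 7) (Arr 3 (Var 3))) Update_prog Skip)
         (Store (Cell 1 (Var 3)) (Lit 1)))) Skip)"

definition Sweep_prog :: ram_prog where
  "Sweep_prog = For 2 (For 3 (Cond (Arr 1 (Var 3)) Skip Visit_prog))"

definition Out_addr :: "nat \<Rightarrow> ram_exp" where
  "Out_addr c = Add (Lit c) (Mul (Lit 2) (Add (Mul (Var 3) (Var 0)) (Var 4)))"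

definition Output_prog :: ram_prog where
  "Output_prog = For 3 (For 4 (Cond (Differ (Arr 2 (Var 3)) (Var 4))
     (Seq (Store (Out_addr 1) (Lit 0)) (Store (Out_addr 2) (Lit 1)))
     (Seq (Store (Out_addr 1) (Arr 3 (Var 3))) (Store (Out_addr 2) (Arr 4 (Var 3))))))"

definition Main_prog :: ram_prog where
  "Main_prog = Seq (SetVar 0 (Deref (Lit 1)))
     (Seq Scale_prog (Seq Init_prog (Seq Sweep_prog Output_prog)))"

section \<open>Scaled costs and correctness of the program\<close>

lemma index_less: "x < n \<Longrightarrow> y < n \<Longrightarrow> x * n + y < n * (n::nat)"
proof -
  assume "x < n" "y < n"
  then have "x * n + y < Suc x * n" by simp
  also have "\<dots> \<le> n * n" using \<open>x < n\<close> by (intro mult_le_mono1) simp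
  finally show ?thesis .
qed

definition par_at :: "nat \<Rightarrow> (nat \<Rightarrow> nat) \<Rightarrow> nat \<Rightarrow> nat \<Rightarrow> nat" where
  "par_at n inp v j = inp (2 + j + (n * n + 6 * v))"

text \<open>Scaling by the product of all cost and demand denominators and all nonzero capacity numerators
  makes opening and service costs integral; \<open>x + (1 - x)\<close> is \<open>max x 1\<close> on natural numbers.\<close>

definition den_at :: "nat \<Rightarrow> (nat \<Rightarrow> nat) \<Rightarrow> nat \<Rightarrow> nat" where
  "den_at n inp v = par_at n inp v 1 * par_at n inp v 5 * (par_at n inp v 2 + (1 - par_at n inp v 2))"

definition scale_at :: "nat \<Rightarrow> (nat \<Rightarrow> nat) \<Rightarrow> nat" where
  "scale_at n inp = (\<Prod>v<n. den_at n inp v)"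

definition open_cost :: "nat \<Rightarrow> (nat \<Rightarrow> nat) \<Rightarrow> nat \<Rightarrow> nat" where
  "open_cost n inp u = scale_at n inp * par_at n inp u 0 div par_at n inp u 1"

definition serve_cost :: "nat \<Rightarrow> (nat \<Rightarrow> nat) \<Rightarrow> nat \<Rightarrow> nat \<Rightarrow> nat" where
  "serve_cost n inp v u = scale_at n inp * par_at n inp v 4 * par_at n inp u 0 * par_at n inp u 3 div
     (par_at n inp v 5 * par_at n inp u 1 * par_at n inp u 2)"

text \<open>\<open>room\<close> lets the cells below \<open>B\<close> hold the input, which ends at
  \<open>n * n + 6 * n + 1\<close>, and later the output, which ends at \<open>2 * (n * n)\<close>.
  The bounds by \<open>2 ^ L\<close> concern stored values, including the partial products of the
  scale; larger values inside an expression are covered by its weight. \<open>degenerate\<close>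
  carries all that is used of planarity.\<close>

locale machine = ram_frame B L n +
  scaled_instance G n scale "open_cost n inp" "serve_cost n inp" 15
  for B L n G scale inp +
  assumes room: "2 * (n * n) + 6 * n + 2 \<le> B"
    and inp_n: "inp 1 = n"
    and inp_adj: "\<And>u v. u < n \<Longrightarrow> v < n \<Longrightarrow> inp (2 + (v * n + u)) \<noteq> 0 \<longleftrightarrow> {v, u} \<in> edges G"
    and degenerate: "\<And>A. A \<subseteq> {..<n} \<Longrightarrow> A \<noteq> {} \<Longrightarrow> \<exists>v\<in>A. card {u\<in>A. {v, u} \<in> edges G} \<le> 15"
    and par_cap: "\<And>u. u < n \<Longrightarrow> par_at n inp u 2 \<noteq> 0 \<longleftrightarrow> capacity G u \<noteq> 0"
    and par_dem: "\<And>v. v < n \<Longrightarrow> par_at n inp v 4 \<noteq> 0 \<longleftrightarrow> demand G v \<noteq> 0"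
    and inp_small: "\<And>i. inp i < 2 ^ L"
    and den_small: "\<And>k. k \<le> n \<Longrightarrow> (\<Prod>v<k. den_at n inp v) < 2 ^ L"
    and WR_small: "\<And>u v. u < n \<Longrightarrow> v < n \<Longrightarrow> open_cost n inp u + serve_cost n inp v u < 2 ^ L"
begin

abbreviation par :: "nat \<Rightarrow> nat \<Rightarrow> nat" where "par \<equiv> par_at n inp"
abbreviation den :: "nat \<Rightarrow> nat" where "den \<equiv> den_at n inp"
abbreviation M :: nat where "M \<equiv> scale_at n inp"
abbreviation W :: "nat \<Rightarrow> nat" where "W \<equiv> open_cost n inp"
abbreviation R :: "nat \<Rightarrow> nat \<Rightarrow> nat" where "R \<equiv> serve_cost n inp"

lemma par_small: "par v j < 2 ^ L"
  unfolding par_at_def by (rule inp_small)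

definition env :: "arrays \<Rightarrow> bool" where
  "env a \<longleftrightarrow> a 8 = inp \<and> a 7 0 = n \<and> a 7 1 = M"

lemma val_Par: "a 8 = inp \<Longrightarrow> a 7 0 = n \<Longrightarrow> val e a < n \<Longrightarrow> j < 6 \<Longrightarrow> val (Par e j) a = par (val e a) j"
  unfolding Par_def par_at_def using room by (subst val_low) auto

lemma val_Adj: "a 8 = inp \<Longrightarrow> a 7 0 = n \<Longrightarrow> val e a < n \<Longrightarrow> val f a < n \<Longrightarrow>
    val (Adj e f) a \<noteq> 0 \<longleftrightarrow> {val e a, val f a} \<in> edges G"
  unfolding Adj_def using room index_less[of "val e a" n "val f a"] inp_adj[of "val f a" "val e a"]
  by (subst val_low) auto

lemma val_Differ: "val (Differ e f) a = 0 \<longleftrightarrow> val e a = val f a"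
  unfolding Differ_def by auto

lemma val_Near:
  assumes "a 8 = inp" "a 7 0 = n" "val e a < n" "val f a < n"
  shows "val (Near e f) a \<noteq> 0 \<longleftrightarrow> val f a \<in> nb (val e a) \<and> capacity G (val f a) \<noteq> 0"
proof -
  have "1 - val (Differ e f) a \<noteq> 0 \<longleftrightarrow> val e a = val f a"
    using val_Differ[of e f a] by (cases "val (Differ e f) a") auto
  then have "val (Add (Adj e f) (Sub (Lit 1) (Differ e f))) a \<noteq> 0 \<longleftrightarrow> val f a \<in> nb (val e a)"
    using val_Adj[OF assms] assms(4) vs
    by (simp add: closed_nbhd_def insert_commute[of "val f a"] eq_commute[of "val f a"] disj_commute)
  then show ?thesis
    unfolding Near_def using val_Par[OF assms(1,2,4), of 2] par_cap[OF assms(4)] by simp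
qed

lemma val_Serve:
  "env a \<Longrightarrow> val e a < n \<Longrightarrow> val f a < n \<Longrightarrow> val (Serve e f) a = R (val e a) (val f a)"
  unfolding Serve_def env_def by (simp add: val_Par serve_cost_def)

lemma Scale_prog: "triple (\<lambda>a. a 8 = inp \<and> a 7 0 = n \<and> (\<forall>v. a 1 v = 0)) Scale_prog (\<lambda>a. env a \<and> (\<forall>v. a 1 v = 0))"
  unfolding Scale_prog_def
proof (rule triple_Seq)
  show "triple (\<lambda>a. a 8 = inp \<and> a 7 0 = n \<and> (\<forall>v. a 1 v = 0)) (SetVar 1 (Lit 1))
     (\<lambda>a. a 8 = inp \<and> a 7 0 = n \<and> a 7 1 = 1 \<and> (\<forall>v. a 1 v = 0))"
    by (rule triple_set) (use one_small in auto)
  show "triple (\<lambda>a. a 8 = inp \<and> a 7 0 = n \<and> a 7 1 = 1 \<and> (\<forall>v. a 1 v = 0)) (For 3 (SetVar 1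
     (Mul (Mul (Mul (Var 1) (Par (Var 3) 1)) (Par (Var 3) 5)) (Add (Par (Var 3) 2) (Sub (Lit 1) (Par (Var 3) 2))))))
     (\<lambda>a. env a \<and> (\<forall>v. a 1 v = 0))"
  proof (rule triple_For[where I = "\<lambda>k a. a 8 = inp \<and> a 7 0 = n \<and> a 7 1 = (\<Prod>v<k. den v) \<and> a 7 3 = k \<and> (\<forall>v. a 1 v = 0)"])
    fix k assume k: "k < n"
    show "triple (\<lambda>a. a 8 = inp \<and> a 7 0 = n \<and> a 7 1 = (\<Prod>v<k. den v) \<and> a 7 3 = k \<and> (\<forall>v. a 1 v = 0))
       (SetVar 1 (Mul (Mul (Mul (Var 1) (Par (Var 3) 1)) (Par (Var 3) 5)) (Add (Par (Var 3) 2) (Sub (Lit 1) (Par (Var 3) 2)))))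
       (\<lambda>a. a 7 3 = k \<and> set_arr 7 3 (Suc k) a 8 = inp \<and> set_arr 7 3 (Suc k) a 7 0 = n \<and>
         set_arr 7 3 (Suc k) a 7 1 = (\<Prod>v<Suc k. den v) \<and> set_arr 7 3 (Suc k) a 7 3 = Suc k \<and> (\<forall>v. set_arr 7 3 (Suc k) a 1 v = 0))"
      by (rule triple_set) (use k den_small[of "Suc k"] in \<open>auto simp: val_Par den_at_def mult.assoc\<close>)
  qed (auto simp: env_def scale_at_def)
qed

definition copied :: "nat \<Rightarrow> arrays \<Rightarrow> bool" where
  "copied k a \<longleftrightarrow> (\<forall>v<k. a 3 v = par v 4 \<and> a 4 v = par v 5)"

lemma Init_prog: "triple (\<lambda>a. env a \<and> (\<forall>v. a 1 v = 0)) Init_prog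
    (\<lambda>a. env a \<and> (\<forall>v. a 1 v = 0) \<and> copied n a \<and> (\<forall>v<n. a 0 v = W v \<and> a 2 v = v))"
  unfolding Init_prog_def
proof (rule triple_For[where I = "\<lambda>k a. env a \<and> a 7 3 = k \<and> (\<forall>v. a 1 v = 0) \<and> copied k a \<and> (\<forall>v<k. a 0 v = W v \<and> a 2 v = v)"])
  fix k assume k: "k < n"
  define I where "I a \<longleftrightarrow> env a \<and> a 7 3 = k \<and> (\<forall>v. a 1 v = 0) \<and> copied k a \<and> (\<forall>v<k. a 0 v = W v \<and> a 2 v = v)" for a
  show "triple (\<lambda>a. env a \<and> a 7 3 = k \<and> (\<forall>v. a 1 v = 0) \<and> copied k a \<and> (\<forall>v<k. a 0 v = W v \<and> a 2 v = v))
     (Seq (Store (Cell 0 (Var 3)) (Quot (Mul (Var 1) (Par (Var 3) 0)) (Par (Var 3) 1)))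
     (Seq (Store (Cell 2 (Var 3)) (Var 3))
     (Seq (Store (Cell 3 (Var 3)) (Par (Var 3) 4))
       (Store (Cell 4 (Var 3)) (Par (Var 3) 5)))))
     (\<lambda>a. a 7 3 = k \<and> env (set_arr 7 3 (Suc k) a) \<and> set_arr 7 3 (Suc k) a 7 3 = Suc k \<and>
       (\<forall>v. set_arr 7 3 (Suc k) a 1 v = 0) \<and> copied (Suc k) (set_arr 7 3 (Suc k) a) \<and>
       (\<forall>v<Suc k. set_arr 7 3 (Suc k) a 0 v = W v \<and> set_arr 7 3 (Suc k) a 2 v = v))"
    unfolding I_def[symmetric]
  proof (intro triple_Seq)
    show "triple I (Store (Cell 0 (Var 3)) (Quot (Mul (Var 1) (Par (Var 3) 0)) (Par (Var 3) 1))) (\<lambda>a. I a \<and> a 0 k = W k)"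
      by (rule triple_set) (use k WR_small[of k k] in \<open>auto simp: I_def env_def copied_def val_Par open_cost_def\<close>)
    show "triple (\<lambda>a. I a \<and> a 0 k = W k) (Store (Cell 2 (Var 3)) (Var 3)) (\<lambda>a. I a \<and> a 0 k = W k \<and> a 2 k = k)"
      by (rule triple_set) (use k n in \<open>auto simp: I_def env_def copied_def\<close>)
    show "triple (\<lambda>a. I a \<and> a 0 k = W k \<and> a 2 k = k) (Store (Cell 3 (Var 3)) (Par (Var 3) 4))
        (\<lambda>a. I a \<and> a 0 k = W k \<and> a 2 k = k \<and> a 3 k = par k 4)"
      by (rule triple_set) (use k par_small[of k 4] in \<open>auto simp: I_def env_def copied_def val_Par\<close>)
    show "triple (\<lambda>a. I a \<and> a 0 k = W k \<and> a 2 k = k \<and> a 3 k = par k 4) (Store (Cell 4 (Var 3)) (Par (Var 3) 5))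
     (\<lambda>a. a 7 3 = k \<and> env (set_arr 7 3 (Suc k) a) \<and> set_arr 7 3 (Suc k) a 7 3 = Suc k \<and>
       (\<forall>v. set_arr 7 3 (Suc k) a 1 v = 0) \<and> copied (Suc k) (set_arr 7 3 (Suc k) a) \<and>
       (\<forall>v<Suc k. set_arr 7 3 (Suc k) a 0 v = W v \<and> set_arr 7 3 (Suc k) a 2 v = v))"
      by (rule triple_set) (use k par_small[of k 5] in \<open>auto simp: I_def env_def copied_def val_Par less_Suc_eq\<close>)
  qed
qed (auto simp: env_def copied_def)

section \<open>Elimination of one vertex\<close>

definition removed :: "arrays \<Rightarrow> nat set" where
  "removed a = {v. v < n \<and> a 1 v \<noteq> 0}"

definition left_degree :: "nat set \<Rightarrow> nat \<Rightarrow> nat" where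
  "left_degree X v = card {u. u < n \<and> {v, u} \<in> edges G \<and> u \<notin> X}"

text \<open>A frame condition: only the variables in \<open>S\<close> may have changed.\<close>

definition agree :: "nat set \<Rightarrow> arrays \<Rightarrow> arrays \<Rightarrow> bool" where
  "agree S a b \<longleftrightarrow> (\<forall>j. j \<noteq> 7 \<longrightarrow> b j = a j) \<and> (\<forall>i. i \<notin> S \<longrightarrow> b 7 i = a 7 i)"

lemma agree_set: "agree S a b \<Longrightarrow> i \<in> S \<Longrightarrow> agree S a (set_arr 7 i x b)"
  unfolding agree_def by simp

lemma agree_env: "agree S a b \<Longrightarrow> env a \<Longrightarrow> 0 \<notin> S \<Longrightarrow> 1 \<notin> S \<Longrightarrow> env b"
  unfolding agree_def env_def by simp

lemma Count_prog:
  assumes a: "env a\<^sub>0" "a\<^sub>0 7 3 = v" "v < n"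
  shows "triple (\<lambda>a. a = a\<^sub>0) Count_prog (\<lambda>a. agree {4,5} a\<^sub>0 a \<and> a 7 5 = left_degree (removed a\<^sub>0) v)"
  unfolding Count_prog_def
proof (rule triple_Seq)
  define C where "C k = card {u. u < k \<and> {v, u} \<in> edges G \<and> u \<notin> removed a\<^sub>0}" for k
  have Cle: "C k \<le> k" for k
    using card_mono[of "{..<k}" "{u. u < k \<and> {v, u} \<in> edges G \<and> u \<notin> removed a\<^sub>0}"] unfolding C_def by auto
  have CSuc: "C (Suc k) = C k + (if {v, k} \<in> edges G \<and> k \<notin> removed a\<^sub>0 then 1 else 0)" for k
  proof -
    have "{u. u < Suc k \<and> {v, u} \<in> edges G \<and> u \<notin> removed a\<^sub>0} =
      (if {v, k} \<in> edges G \<and> k \<notin> removed a\<^sub>0 then insert k {u. u < k \<and> {v, u} \<in> edges G \<and> u \<notin> removed a\<^sub>0}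
       else {u. u < k \<and> {v, u} \<in> edges G \<and> u \<notin> removed a\<^sub>0})"
      by (auto simp: less_Suc_eq)
    then show ?thesis unfolding C_def by simp
  qed
  show "triple (\<lambda>a. a = a\<^sub>0) (SetVar 5 (Lit 0)) (\<lambda>a. agree {4,5} a\<^sub>0 a \<and> a 7 5 = 0)"
    by (rule triple_set) (auto simp: agree_def)
  define I where "I k b \<longleftrightarrow> agree {4,5} a\<^sub>0 b \<and> b 7 4 = k \<and> b 7 5 = C k" for k b
  have I: "b 8 = inp \<and> b 7 0 = n \<and> b 7 3 = v" if "I k b" for k b
    using that a unfolding I_def agree_def env_def by simp
  show "triple (\<lambda>a. agree {4,5} a\<^sub>0 a \<and> a 7 5 = 0)
     (For 4 (Cond (Mul (Adj (Var 3) (Var 4)) (Sub (Lit 1) (Arr 1 (Var 4)))) (SetVar 5 (Add (Var 5) (Lit 1))) Skip))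
     (\<lambda>a. agree {4,5} a\<^sub>0 a \<and> a 7 5 = left_degree (removed a\<^sub>0) v)"
  proof (rule triple_For[where I = I])
    fix k assume k: "k < n"
    have cond: "val (Mul (Adj (Var 3) (Var 4)) (Sub (Lit 1) (Arr 1 (Var 4)))) b \<noteq> 0 \<longleftrightarrow>
        {v, k} \<in> edges G \<and> k \<notin> removed a\<^sub>0" if b: "I k b" for b
    proof -
      have "b 1 = a\<^sub>0 1" "b 7 4 = k" using b unfolding I_def agree_def by auto
      then show ?thesis using val_Adj[of b "Var 3" "Var 4"] I[OF b] k a(3) by (auto simp: removed_def)
    qed
    show "triple (I k) (Cond (Mul (Adj (Var 3) (Var 4)) (Sub (Lit 1) (Arr 1 (Var 4)))) (SetVar 5 (Add (Var 5) (Lit 1))) Skip)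
        (\<lambda>b. b 7 4 = k \<and> I (Suc k) (set_arr 7 4 (Suc k) b))"
    proof (rule triple_Cond[OF triple_set triple_Skip])
      fix b assume b: "I k b \<and> val (Mul (Adj (Var 3) (Var 4)) (Sub (Lit 1) (Arr 1 (Var 4)))) b \<noteq> 0"
      then have "C (Suc k) = C k + 1" using cond[of b] unfolding CSuc by simp
      moreover have "C k + 1 < 2 ^ L" using Cle[of k] k n by linarith
      ultimately show "val (Add (Var 5) (Lit 1)) b < 2 ^ L \<and>
        set_arr 7 (val (Lit 5) b) (val (Add (Var 5) (Lit 1)) b) b 7 4 = k \<and>
        I (Suc k) (set_arr 7 4 (Suc k) (set_arr 7 (val (Lit 5) b) (val (Add (Var 5) (Lit 1)) b) b))"
        using b unfolding I_def by (auto intro!: agree_set)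
    next
      fix b assume b: "I k b \<and> val (Mul (Adj (Var 3) (Var 4)) (Sub (Lit 1) (Arr 1 (Var 4)))) b = 0"
      then have "C (Suc k) = C k" using cond[of b] unfolding CSuc by simp
      then show "b 7 4 = k \<and> I (Suc k) (set_arr 7 4 (Suc k) b)"
        using b unfolding I_def by (auto intro!: agree_set)
    qed simp
  next
    fix b assume "agree {4,5} a\<^sub>0 b \<and> b 7 5 = 0"
    then show "I 0 (set_arr 7 4 0 b)" unfolding I_def C_def by (auto intro!: agree_set)
  next
    fix k b assume "I k b"
    then show "b 7 0 = n \<and> b 7 4 = k" using I by (auto simp: I_def)
  next
    fix b assume "I n b"
    then show "agree {4,5} a\<^sub>0 b \<and> b 7 5 = left_degree (removed a\<^sub>0) v" unfolding I_def C_def left_degree_def by simp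
  qed simp
qed

text \<open>Variable 7 distinguishes the absence of a usable neighbour from an option of cost
  zero.\<close>

definition chosen :: "arrays \<Rightarrow> nat \<Rightarrow> nat \<Rightarrow> arrays \<Rightarrow> bool" where
  "chosen a\<^sub>0 v k a \<longleftrightarrow>
     a 7 7 = 0 \<and> a 7 6 = 0 \<and> (\<forall>u<k. \<not> (u \<in> nb v \<and> capacity G u \<noteq> 0)) \<or>
     a 7 7 = 1 \<and> a 7 8 < k \<and> a 7 8 \<in> nb v \<and> capacity G (a 7 8) \<noteq> 0 \<and> a 7 6 = a\<^sub>0 0 (a 7 8) + R v (a 7 8) \<and>
       (\<forall>u<k. u \<in> nb v \<and> capacity G u \<noteq> 0 \<longrightarrow> a 7 6 \<le> a\<^sub>0 0 u + R v u)"

lemma Choose_prog: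
  assumes a: "env a\<^sub>0" "a\<^sub>0 7 3 = v" "v < n" "\<And>u. u < n \<Longrightarrow> a\<^sub>0 0 u \<le> W u"
  shows "triple (agree {4..8} a\<^sub>0) Choose_prog (\<lambda>a. agree {4..8} a\<^sub>0 a \<and> chosen a\<^sub>0 v n a)"
  unfolding Choose_prog_def
proof (intro triple_Seq)
  show "triple (agree {4..8} a\<^sub>0) (SetVar 6 (Lit 0)) (\<lambda>a. agree {4..8} a\<^sub>0 a \<and> a 7 6 = 0)"
    by (rule triple_set) (auto intro!: agree_set)
  show "triple (\<lambda>a. agree {4..8} a\<^sub>0 a \<and> a 7 6 = 0) (SetVar 7 (Lit 0)) (\<lambda>a. agree {4..8} a\<^sub>0 a \<and> a 7 6 = 0 \<and> a 7 7 = 0)"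
    by (rule triple_set) (auto intro!: agree_set)
  define I where "I k b \<longleftrightarrow> agree {4..8} a\<^sub>0 b \<and> b 7 4 = k \<and> chosen a\<^sub>0 v k b" for k b
  have I: "env b \<and> b 8 = inp \<and> b 7 0 = n \<and> b 7 3 = v \<and> b 7 4 = k \<and> b 0 = a\<^sub>0 0" if "I k b" for k b
    using that a agree_env[of "{4..8}" a\<^sub>0 b] unfolding I_def agree_def env_def by simp
  define c where "c = Mul (Near (Var 3) (Var 4)) (Add (Sub (Lit 1) (Var 7)) (Sub (Var 6) Option_cost))"
  show "triple (\<lambda>a. agree {4..8} a\<^sub>0 a \<and> a 7 6 = 0 \<and> a 7 7 = 0)
     (For 4 (Cond (Mul (Near (Var 3) (Var 4)) (Add (Sub (Lit 1) (Var 7)) (Sub (Var 6) Option_cost)))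
        (Seq (SetVar 6 Option_cost) (Seq (SetVar 7 (Lit 1)) (SetVar 8 (Var 4)))) Skip))
     (\<lambda>a. agree {4..8} a\<^sub>0 a \<and> chosen a\<^sub>0 v n a)"
    unfolding c_def[symmetric]
  proof (rule triple_For[where I = I])
    fix k assume k: "k < n"
    have opt: "val Option_cost b = a\<^sub>0 0 k + R v k" if b: "I k b" for b
      unfolding Option_cost_def using I[OF b] a(3) k val_Serve[of b "Var 3" "Var 4"] by simp
    have cond: "val c b \<noteq> 0 \<longleftrightarrow> k \<in> nb v \<and> capacity G k \<noteq> 0 \<and> (b 7 7 = 0 \<or> a\<^sub>0 0 k + R v k < b 7 6)" if b: "I k b" for b
    proof -
      have "val (Near (Var 3) (Var 4)) b \<noteq> 0 \<longleftrightarrow> k \<in> nb v \<and> capacity G k \<noteq> 0"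
        using val_Near[of b "Var 3" "Var 4"] I[OF b] a(3) k by simp
      moreover have "val (Add (Sub (Lit 1) (Var 7)) (Sub (Var 6) Option_cost)) b \<noteq> 0 \<longleftrightarrow> b 7 7 = 0 \<or> a\<^sub>0 0 k + R v k < b 7 6"
        using opt[OF b] by auto
      moreover have "val c b = val (Near (Var 3) (Var 4)) b * val (Add (Sub (Lit 1) (Var 7)) (Sub (Var 6) Option_cost)) b"
        unfolding c_def by simp
      ultimately show ?thesis by simp
    qed
    show "triple (I k) (Cond c (Seq (SetVar 6 Option_cost) (Seq (SetVar 7 (Lit 1)) (SetVar 8 (Var 4)))) Skip)
        (\<lambda>b. b 7 4 = k \<and> I (Suc k) (set_arr 7 4 (Suc k) b))"
    proof (rule triple_Cond)
      define J where "J b \<longleftrightarrow> agree {4..8} a\<^sub>0 b \<and> b 7 4 = k \<and> k \<in> nb v \<and> capacity G k \<noteq> 0 \<and> b 7 6 = a\<^sub>0 0 k + R v k \<and>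
          (\<forall>u<k. u \<in> nb v \<and> capacity G u \<noteq> 0 \<longrightarrow> b 7 6 \<le> a\<^sub>0 0 u + R v u)" for b
      show "triple (\<lambda>b. I k b \<and> val c b \<noteq> 0) (Seq (SetVar 6 Option_cost) (Seq (SetVar 7 (Lit 1)) (SetVar 8 (Var 4))))
          (\<lambda>b. b 7 4 = k \<and> I (Suc k) (set_arr 7 4 (Suc k) b))"
      proof (intro triple_Seq)
        show "triple (\<lambda>b. I k b \<and> val c b \<noteq> 0) (SetVar 6 Option_cost) J"
        proof (rule triple_set)
          fix b assume b: "I k b \<and> val c b \<noteq> 0"
          have "a\<^sub>0 0 k + R v k < 2 ^ L" using WR_small[OF k a(3)] a(4)[OF k] by linarith
          moreover have "\<forall>u<k. u \<in> nb v \<and> capacity G u \<noteq> 0 \<longrightarrow> a\<^sub>0 0 k + R v k \<le> a\<^sub>0 0 u + R v u"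
            using b cond[of b] unfolding I_def chosen_def by auto
          ultimately show "val Option_cost b < 2 ^ L \<and> J (set_arr 7 (val (Lit 6) b) (val Option_cost b) b)"
            using b opt[of b] cond[of b] unfolding J_def I_def by (auto intro!: agree_set)
        qed simp
        show "triple J (SetVar 7 (Lit 1)) (\<lambda>b. J b \<and> b 7 7 = 1)"
          by (rule triple_set) (use one_small in \<open>auto simp: J_def intro!: agree_set\<close>)
        show "triple (\<lambda>b. J b \<and> b 7 7 = 1) (SetVar 8 (Var 4)) (\<lambda>b. b 7 4 = k \<and> I (Suc k) (set_arr 7 4 (Suc k) b))"
        proof (rule triple_set)
          fix b assume b: "J b \<and> b 7 7 = 1"
          have "chosen a\<^sub>0 v (Suc k) (set_arr 7 4 (Suc k) (set_arr 7 8 k b))"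
            using b unfolding chosen_def J_def by (auto simp: less_Suc_eq)
          then show "val (Var 4) b < 2 ^ L \<and> set_arr 7 (val (Lit 8) b) (val (Var 4) b) b 7 4 = k \<and>
              I (Suc k) (set_arr 7 4 (Suc k) (set_arr 7 (val (Lit 8) b) (val (Var 4) b) b))"
            using b k n unfolding I_def J_def by (auto intro!: agree_set)
        qed simp
      qed
      show "triple (\<lambda>b. I k b \<and> val c b = 0) Skip (\<lambda>b. b 7 4 = k \<and> I (Suc k) (set_arr 7 4 (Suc k) b))"
      proof (rule triple_Skip)
        fix b assume b: "I k b \<and> val c b = 0"
        have "chosen a\<^sub>0 v (Suc k) (set_arr 7 4 (Suc k) b)"
          using b cond[of b] unfolding chosen_def I_def by (auto simp: less_Suc_eq)
        then show "b 7 4 = k \<and> I (Suc k) (set_arr 7 4 (Suc k) b)"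
          using b unfolding I_def by (auto intro!: agree_set)
      qed
    qed
  next
    fix b assume "agree {4..8} a\<^sub>0 b \<and> b 7 6 = 0 \<and> b 7 7 = 0"
    then show "I 0 (set_arr 7 4 0 b)" unfolding I_def chosen_def by (auto intro!: agree_set)
  next
    fix k b assume "I k b"
    then show "b 7 0 = n \<and> b 7 4 = k" using I by auto
  next
    fix b assume "I n b"
    then show "agree {4..8} a\<^sub>0 b \<and> chosen a\<^sub>0 v n b" unfolding I_def by simp
  qed simp
qed


lemma Update_prog:
  assumes b: "env b\<^sub>0" "b\<^sub>0 7 3 = v" "v < n"
  shows "triple (\<lambda>a. a = b\<^sub>0) Update_prog (\<lambda>a. a 1 = b\<^sub>0 1 \<and> a 2 = (b\<^sub>0 2)(v := b\<^sub>0 7 8) \<and> a 3 = b\<^sub>0 3 \<and> a 4 = b\<^sub>0 4 \<and>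
     a 8 = b\<^sub>0 8 \<and> (\<forall>i. i \<noteq> 4 \<longrightarrow> a 7 i = b\<^sub>0 7 i) \<and>
     (\<forall>u<n. a 0 u = (if u \<in> nb v \<and> capacity G u \<noteq> 0 \<and> u \<notin> removed b\<^sub>0 then b\<^sub>0 0 u - (b\<^sub>0 7 6 - R v u) else b\<^sub>0 0 u)))"
  unfolding Update_prog_def
proof (rule triple_Seq)
  define new where "new u = (if u \<in> nb v \<and> capacity G u \<noteq> 0 \<and> u \<notin> removed b\<^sub>0 then b\<^sub>0 0 u - (b\<^sub>0 7 6 - R v u) else b\<^sub>0 0 u)" for u
  define keep where "keep a \<longleftrightarrow> a 1 = b\<^sub>0 1 \<and> a 2 = (b\<^sub>0 2)(v := b\<^sub>0 7 8) \<and> a 3 = b\<^sub>0 3 \<and> a 4 = b\<^sub>0 4 \<and>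
     a 8 = b\<^sub>0 8 \<and> (\<forall>i. i \<noteq> 4 \<longrightarrow> a 7 i = b\<^sub>0 7 i)" for a :: arrays
  have keep_env: "env a" "a 8 = inp" "a 7 0 = n" "a 7 3 = v" "a 7 6 = b\<^sub>0 7 6" if "keep a" for a
    using that b unfolding keep_def env_def by auto
  show "triple (\<lambda>a. a = b\<^sub>0) (Store (Cell 2 (Var 3)) (Var 8)) (\<lambda>a. keep a \<and> a 0 = b\<^sub>0 0)"
    by (rule triple_set) (use b in \<open>auto simp: keep_def small_def set_arr_def\<close>)
  define c where "c = Mul (Near (Var 3) (Var 4)) (Sub (Lit 1) (Arr 1 (Var 4)))"
  define I where "I k a \<longleftrightarrow> keep a \<and> a 7 4 = k \<and> (\<forall>u. a 0 u = (if u < k then new u else b\<^sub>0 0 u))" for k a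
  show "triple (\<lambda>a. keep a \<and> a 0 = b\<^sub>0 0)
     (For 4 (Cond (Mul (Near (Var 3) (Var 4)) (Sub (Lit 1) (Arr 1 (Var 4))))
        (Store (Cell 0 (Var 4)) (Sub (Arr 0 (Var 4)) (Sub (Var 6) (Serve (Var 3) (Var 4))))) Skip))
     (\<lambda>a. a 1 = b\<^sub>0 1 \<and> a 2 = (b\<^sub>0 2)(v := b\<^sub>0 7 8) \<and> a 3 = b\<^sub>0 3 \<and> a 4 = b\<^sub>0 4 \<and>
     a 8 = b\<^sub>0 8 \<and> (\<forall>i. i \<noteq> 4 \<longrightarrow> a 7 i = b\<^sub>0 7 i) \<and>
     (\<forall>u<n. a 0 u = (if u \<in> nb v \<and> capacity G u \<noteq> 0 \<and> u \<notin> removed b\<^sub>0 then b\<^sub>0 0 u - (b\<^sub>0 7 6 - R v u) else b\<^sub>0 0 u)))"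
    unfolding c_def[symmetric]
  proof (rule triple_For[where I = I])
    fix k assume k: "k < n"
    have cond: "val c a \<noteq> 0 \<longleftrightarrow> k \<in> nb v \<and> capacity G k \<noteq> 0 \<and> k \<notin> removed b\<^sub>0" if a: "I k a" for a
    proof -
      have ka: "keep a" "a 7 4 = k" "a 1 = b\<^sub>0 1" using a unfolding I_def keep_def by auto
      have "val (Near (Var 3) (Var 4)) a \<noteq> 0 \<longleftrightarrow> k \<in> nb v \<and> capacity G k \<noteq> 0"
        using val_Near[of a "Var 3" "Var 4"] keep_env[OF ka(1)] ka(2) b(3) k by simp
      then show ?thesis unfolding c_def using ka k by (auto simp: removed_def)
    qed
    show "triple (I k) (Cond c (Store (Cell 0 (Var 4)) (Sub (Arr 0 (Var 4)) (Sub (Var 6) (Serve (Var 3) (Var 4))))) Skip)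
       (\<lambda>a. a 7 4 = k \<and> I (Suc k) (set_arr 7 4 (Suc k) a))"
    proof (rule triple_Cond[OF triple_set triple_Skip])
      fix a assume sm: "small a" and a: "I k a \<and> val c a \<noteq> 0"
      have ka: "keep a" "a 7 4 = k" "a 0 k = b\<^sub>0 0 k" using a unfolding I_def by auto
      have "val (Sub (Arr 0 (Var 4)) (Sub (Var 6) (Serve (Var 3) (Var 4)))) a = new k"
        using cond[of a] a ka keep_env[OF ka(1)] val_Serve[of a "Var 3" "Var 4"] b(3) k unfolding new_def by simp
      moreover have "new k < 2 ^ L"
      proof (rule le_less_trans)
        show "new k \<le> a 0 k" unfolding new_def ka(3) by simp
        show "a 0 k < 2 ^ L" using sm unfolding small_def by simp
      qed
      ultimately show "val (Sub (Arr 0 (Var 4)) (Sub (Var 6) (Serve (Var 3) (Var 4)))) a < 2 ^ L \<and>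
          set_arr 0 (val (Var 4) a) (val (Sub (Arr 0 (Var 4)) (Sub (Var 6) (Serve (Var 3) (Var 4)))) a) a 7 4 = k \<and>
          I (Suc k) (set_arr 7 4 (Suc k) (set_arr 0 (val (Var 4) a) (val (Sub (Arr 0 (Var 4)) (Sub (Var 6) (Serve (Var 3) (Var 4)))) a) a))"
        using a ka unfolding I_def keep_def by (auto simp: less_Suc_eq)
    next
      fix a assume a: "I k a \<and> val c a = 0"
      then have "new k = b\<^sub>0 0 k" using cond[of a] unfolding new_def by auto
      then show "a 7 4 = k \<and> I (Suc k) (set_arr 7 4 (Suc k) a)"
        using a unfolding I_def keep_def by (auto simp: less_Suc_eq)
    qed simp
  next
    fix a assume "keep a \<and> a 0 = b\<^sub>0 0"
    then show "I 0 (set_arr 7 4 0 a)" unfolding I_def keep_def by auto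
  next
    fix k a assume "I k a"
    then show "a 7 0 = n \<and> a 7 4 = k" using keep_env unfolding I_def by auto
  next
    fix a assume "I n a"
    then show "a 1 = b\<^sub>0 1 \<and> a 2 = (b\<^sub>0 2)(v := b\<^sub>0 7 8) \<and> a 3 = b\<^sub>0 3 \<and> a 4 = b\<^sub>0 4 \<and>
     a 8 = b\<^sub>0 8 \<and> (\<forall>i. i \<noteq> 4 \<longrightarrow> a 7 i = b\<^sub>0 7 i) \<and>
     (\<forall>u<n. a 0 u = (if u \<in> nb v \<and> capacity G u \<noteq> 0 \<and> u \<notin> removed b\<^sub>0 then b\<^sub>0 0 u - (b\<^sub>0 7 6 - R v u) else b\<^sub>0 0 u))"
      unfolding I_def keep_def new_def by auto
  qed simp
qed

section \<open>The sweeps\<close>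

definition sweep_inv :: "arrays \<Rightarrow> bool" where
  "sweep_inv a \<longleftrightarrow> env a \<and> copied n a \<and> (\<forall>u<n. a 0 u \<le> W u) \<and> reachable (removed a) (a 0) (a 2)"

lemma sweep_inv_set [simp]: "1 < i \<Longrightarrow> sweep_inv (set_arr 7 i x a) = sweep_inv a"
  by (simp add: sweep_inv_def env_def copied_def removed_def)

lemma removed_set [simp]: "removed (set_arr 7 i x a) = removed a"
  by (simp add: removed_def)

lemma Visit_prog:
  assumes a: "sweep_inv a\<^sub>0" "a\<^sub>0 7 3 = v" "v < n" "v \<notin> removed a\<^sub>0"
  shows "triple (\<lambda>a. a = a\<^sub>0) Visit_prog (\<lambda>a. sweep_inv a \<and> a 7 2 = a\<^sub>0 7 2 \<and> a 7 3 = v \<and>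
     removed a = (if left_degree (removed a\<^sub>0) v \<le> 15 then insert v (removed a\<^sub>0) else removed a\<^sub>0))"
  unfolding Visit_prog_def
proof (rule triple_Seq)
  define X where "X = removed a\<^sub>0"
  have a0: "env a\<^sub>0" "copied n a\<^sub>0" "\<And>u. u < n \<Longrightarrow> a\<^sub>0 0 u \<le> W u" "reachable X (a\<^sub>0 0) (a\<^sub>0 2)"
    using a(1) unfolding sweep_inv_def X_def by auto
  define Post where "Post a \<longleftrightarrow> sweep_inv a \<and> a 7 2 = a\<^sub>0 7 2 \<and> a 7 3 = v \<and>
     removed a = (if left_degree X v \<le> 15 then insert v X else X)" for a
  define Mid where "Mid a \<longleftrightarrow> agree {4..8} a\<^sub>0 a \<and> chosen a\<^sub>0 v n a" for a
  \<comment> \<open>Between the update and the marking, the costs and servers already belong to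
    \<open>insert v X\<close> while array 1 still describes \<open>X\<close>.\<close>
  define Late where "Late a \<longleftrightarrow> env a \<and> copied n a \<and> a 7 2 = a\<^sub>0 7 2 \<and> a 7 3 = v \<and> a 1 = a\<^sub>0 1 \<and>
     (\<forall>u<n. a 0 u \<le> W u) \<and> reachable (insert v X) (a 0) (a 2)" for a
  show "triple (\<lambda>a. a = a\<^sub>0) Count_prog (\<lambda>a. agree {4,5} a\<^sub>0 a \<and> a 7 5 = left_degree X v)"
    using Count_prog[OF a0(1) a(2,3)] unfolding X_def .
  show "triple (\<lambda>a. agree {4,5} a\<^sub>0 a \<and> a 7 5 = left_degree X v)
     (Cond (Sub (Lit 16) (Var 5))
       (Seq Choose_prog (Seq (Cond (Mul (Var 7) (Arr 3 (Var 3))) Update_prog Skip) (Store (Cell 1 (Var 3)) (Lit 1)))) Skip)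
     (\<lambda>a. sweep_inv a \<and> a 7 2 = a\<^sub>0 7 2 \<and> a 7 3 = v \<and>
       removed a = (if left_degree (removed a\<^sub>0) v \<le> 15 then insert v (removed a\<^sub>0) else removed a\<^sub>0))"
    unfolding X_def[symmetric] Post_def[symmetric]
  proof (rule triple_Cond)
    show "triple (\<lambda>a. (agree {4,5} a\<^sub>0 a \<and> a 7 5 = left_degree X v) \<and> val (Sub (Lit 16) (Var 5)) a = 0) Skip Post"
    proof (rule triple_Skip)
      fix b assume b: "(agree {4,5} a\<^sub>0 b \<and> b 7 5 = left_degree X v) \<and> val (Sub (Lit 16) (Var 5)) b = 0"
      then have "env b" using agree_env[of "{4,5}" a\<^sub>0 b] a0(1) by simp
      then show "Post b" using b a a0 unfolding Post_def X_def sweep_inv_def agree_def copied_def removed_def by auto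
    qed
  next
    show "triple (\<lambda>a. (agree {4,5} a\<^sub>0 a \<and> a 7 5 = left_degree X v) \<and> val (Sub (Lit 16) (Var 5)) a \<noteq> 0)
       (Seq Choose_prog (Seq (Cond (Mul (Var 7) (Arr 3 (Var 3))) Update_prog Skip) (Store (Cell 1 (Var 3)) (Lit 1)))) Post"
    proof (cases "left_degree X v \<le> 15")
      case False
      then show ?thesis unfolding triple_def by auto
    next
      case True
      then have deg: "card {u. u < n \<and> {v, u} \<in> edges G \<and> u \<notin> X} \<le> 15" unfolding left_degree_def .
      note step = reachable_step[OF a0(4) a(3) a(4)[folded X_def] deg]
      show ?thesis
      proof (intro triple_Seq)
        show "triple (\<lambda>a. (agree {4,5} a\<^sub>0 a \<and> a 7 5 = left_degree X v) \<and> val (Sub (Lit 16) (Var 5)) a \<noteq> 0) Choose_prog Mid"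
          unfolding Mid_def
          by (rule triple_conseq[OF Choose_prog[OF a0(1) a(2,3) a0(3)]]) (auto simp: agree_def)
        have mid: "env b" "b 7 3 = v" "b 0 = a\<^sub>0 0" "b 1 = a\<^sub>0 1" "b 2 = a\<^sub>0 2" "b 3 = a\<^sub>0 3" "b 4 = a\<^sub>0 4" "b 7 2 = a\<^sub>0 7 2"
          "removed b = X" "chosen a\<^sub>0 v n b" if "Mid b" for b
          using that a(2) a0(1) agree_env[of "{4..8}" a\<^sub>0 b] unfolding Mid_def agree_def X_def removed_def by auto
        have a3: "a\<^sub>0 3 v \<noteq> 0 \<longleftrightarrow> demand G v \<noteq> 0"
          using a0(2) a(3) par_dem[OF a(3)] unfolding copied_def by simp
        show "triple Mid (Cond (Mul (Var 7) (Arr 3 (Var 3))) Update_prog Skip) Late"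
        proof (rule triple_Cond[OF triple_ghost triple_Skip])
          fix b assume b: "Mid b \<and> val (Mul (Var 7) (Arr 3 (Var 3))) b = 0"
          note m = mid[of b]
          have "b 7 7 = 0 \<or> demand G v = 0" using b m a3 by auto
          then have "\<not> act v"
            using m(10) b nb_lt[OF a(3)] unfolding act_def chosen_def by auto
          then have "reachable (insert v X) (b 0) (b 2)"
            \<comment> \<open>An inactive vertex chooses nothing, so any values serve for
              \<open>us\<close> and \<open>b\<close>.\<close>
            by (intro step[where us = 0 and b = 0]) (use b m in auto)
          then show "Late b" using b m a0 unfolding Late_def copied_def by auto
        next
          fix b assume b: "Mid b \<and> val (Mul (Var 7) (Arr 3 (Var 3))) b \<noteq> 0"
          note m = mid[of b]
          have ch: "b 7 7 \<noteq> 0" "demand G v \<noteq> 0" using b m a3 by auto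
          then have us: "b 7 8 < n" "b 7 8 \<in> nb v" "capacity G (b 7 8) \<noteq> 0" "b 7 6 = a\<^sub>0 0 (b 7 8) + R v (b 7 8)"
            "\<forall>u\<in>nb v. capacity G u \<noteq> 0 \<longrightarrow> b 7 6 \<le> a\<^sub>0 0 u + R v u"
            using m(10) b nb_lt[OF a(3)] unfolding chosen_def by auto
          then have act: "act v" using ch unfolding act_def by auto
          show "triple (\<lambda>a. a = b) Update_prog Late"
          proof (rule triple_conseq[OF Update_prog[of b v]])
            fix c :: arrays assume c: "c 1 = b 1 \<and> c 2 = (b 2)(v := b 7 8) \<and> c 3 = b 3 \<and> c 4 = b 4 \<and> c 8 = b 8 \<and>
              (\<forall>i. i \<noteq> 4 \<longrightarrow> c 7 i = b 7 i) \<and>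
              (\<forall>u<n. c 0 u = (if u \<in> nb v \<and> capacity G u \<noteq> 0 \<and> u \<notin> removed b then b 0 u - (b 7 6 - R v u) else b 0 u))"
            have "reachable (insert v X) (c 0) (c 2)"
              by (rule step[where us = "b 7 8" and b = "b 7 6"]) (use c us act m b in auto)
            moreover have "c 0 u \<le> W u" if "u < n" for u
              using c that a0(3)[OF that] m b by auto
            ultimately show "Late c"
              using c m b a0(2) unfolding Late_def env_def copied_def by auto
          qed (use b m a(3) in auto)
        qed
        show "triple Late (Store (Cell 1 (Var 3)) (Lit 1)) Post"
        proof (rule triple_set)
          fix b assume b: "Late b"
          have "removed (set_arr 1 v 1 b) = insert v X"
            using b a(3) unfolding Late_def X_def removed_def by auto
          then show "val (Lit 1) b < 2 ^ L \<and> Post (set_arr 1 (val (Var 3) b) (val (Lit 1) b) b)"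
            using b True one_small unfolding Late_def Post_def sweep_inv_def env_def copied_def by auto
        qed simp
      qed
    qed
  qed
qed

text \<open>Each sweep eliminates a vertex: one that has at most 15 remaining neighbours when the sweep starts
  still has when the sweep reaches it.\<close>

definition progress :: "nat \<Rightarrow> nat \<Rightarrow> nat set \<Rightarrow> bool" where
  "progress r k X \<longleftrightarrow> Suc r \<le> card X \<or> X = {..<n} \<or>
     r \<le> card X \<and> (\<exists>v\<ge>k. v < n \<and> v \<notin> X \<and> left_degree X v \<le> 15)"

lemma progress_start:
  assumes "X \<subseteq> {..<n}" "r \<le> card X \<or> X = {..<n}"
  shows "progress r 0 X"
proof (cases "X = {..<n}")
  case False
  then obtain v where v: "v \<in> {..<n} - X" "card {u\<in>{..<n} - X. {v, u} \<in> edges G} \<le> 15"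
    using degenerate[of "{..<n} - X"] assms(1) by blast
  moreover have "{u\<in>{..<n} - X. {v, u} \<in> edges G} = {u. u < n \<and> {v, u} \<in> edges G \<and> u \<notin> X}" by auto
  ultimately show ?thesis using assms(2) False unfolding progress_def left_degree_def by auto
qed (simp add: progress_def)

text \<open>A promised vertex of small degree cannot be \<open>k\<close> itself, so it lies beyond
  \<open>k\<close>.\<close>

lemma progress_skip:
  assumes "progress r k X" "k \<in> X \<or> \<not> left_degree X k \<le> 15"
  shows "progress r (Suc k) X"
  using assms unfolding progress_def by (metis le_antisym not_less_eq_eq)

text \<open>A single elimination already achieves the aim of sweep \<open>r\<close>, more than
  \<open>r\<close> eliminated vertices.\<close>

lemma progress_remove:
  assumes "progress r k X" "X \<subseteq> {..<n}" "k < n" "k \<notin> X"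
  shows "progress r (Suc k) (insert k X)"
proof -
  have "finite X" using assms(2) finite_subset by blast
  then have "card (insert k X) = Suc (card X)" using assms(4) by simp
  then show ?thesis using assms unfolding progress_def by auto
qed

lemma removed_subset: "removed a \<subseteq> {..<n}"
  unfolding removed_def by auto

lemma Sweep_prog: "triple (\<lambda>a. sweep_inv a) Sweep_prog (\<lambda>a. sweep_inv a \<and> removed a = {..<n})"
  unfolding Sweep_prog_def
proof (rule triple_For[where I = "\<lambda>r a. sweep_inv a \<and> a 7 2 = r \<and> (r \<le> card (removed a) \<or> removed a = {..<n})"])
  fix r assume r: "r < n"
  show "triple (\<lambda>a. sweep_inv a \<and> a 7 2 = r \<and> (r \<le> card (removed a) \<or> removed a = {..<n}))
     (For 3 (Cond (Arr 1 (Var 3)) Skip Visit_prog))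
     (\<lambda>a. a 7 2 = r \<and> sweep_inv (set_arr 7 2 (Suc r) a) \<and> set_arr 7 2 (Suc r) a 7 2 = Suc r \<and>
       (Suc r \<le> card (removed (set_arr 7 2 (Suc r) a)) \<or> removed (set_arr 7 2 (Suc r) a) = {..<n}))"
  proof (rule triple_For[where I = "\<lambda>k a. sweep_inv a \<and> a 7 2 = r \<and> a 7 3 = k \<and> progress r k (removed a)"])
    fix k assume k: "k < n"
    show "triple (\<lambda>a. sweep_inv a \<and> a 7 2 = r \<and> a 7 3 = k \<and> progress r k (removed a)) (Cond (Arr 1 (Var 3)) Skip Visit_prog)
      (\<lambda>a. a 7 3 = k \<and> sweep_inv (set_arr 7 3 (Suc k) a) \<and> set_arr 7 3 (Suc k) a 7 2 = r \<and>
        set_arr 7 3 (Suc k) a 7 3 = Suc k \<and> progress r (Suc k) (removed (set_arr 7 3 (Suc k) a)))"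
    proof (rule triple_Cond[OF triple_Skip triple_ghost])
      fix b assume b: "(sweep_inv b \<and> b 7 2 = r \<and> b 7 3 = k \<and> progress r k (removed b)) \<and> val (Arr 1 (Var 3)) b \<noteq> 0"
      then have "k \<in> removed b" using k by (auto simp: removed_def)
      then show "b 7 3 = k \<and> sweep_inv (set_arr 7 3 (Suc k) b) \<and> set_arr 7 3 (Suc k) b 7 2 = r \<and>
        set_arr 7 3 (Suc k) b 7 3 = Suc k \<and> progress r (Suc k) (removed (set_arr 7 3 (Suc k) b))"
        using b progress_skip by simp
    next
      fix b assume b: "(sweep_inv b \<and> b 7 2 = r \<and> b 7 3 = k \<and> progress r k (removed b)) \<and> val (Arr 1 (Var 3)) b = 0"
      then have kr: "k \<notin> removed b" by (auto simp: removed_def)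
      show "triple (\<lambda>a. a = b) Visit_prog (\<lambda>a. a 7 3 = k \<and> sweep_inv (set_arr 7 3 (Suc k) a) \<and> set_arr 7 3 (Suc k) a 7 2 = r \<and>
        set_arr 7 3 (Suc k) a 7 3 = Suc k \<and> progress r (Suc k) (removed (set_arr 7 3 (Suc k) a)))"
      proof (rule triple_conseq[OF Visit_prog[OF _ _ k kr]])
        fix c assume "sweep_inv c \<and> c 7 2 = b 7 2 \<and> c 7 3 = k \<and>
          removed c = (if left_degree (removed b) k \<le> 15 then insert k (removed b) else removed b)"
        then show "c 7 3 = k \<and> sweep_inv (set_arr 7 3 (Suc k) c) \<and> set_arr 7 3 (Suc k) c 7 2 = r \<and>
          set_arr 7 3 (Suc k) c 7 3 = Suc k \<and> progress r (Suc k) (removed (set_arr 7 3 (Suc k) c))"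
          using b progress_skip[of r k "removed b"] progress_remove[OF _ removed_subset k kr] by simp
      qed (use b in auto)
    qed
  next
    fix a assume "sweep_inv a \<and> a 7 2 = r \<and> (r \<le> card (removed a) \<or> removed a = {..<n})"
    then show "sweep_inv (set_arr 7 3 0 a) \<and> set_arr 7 3 0 a 7 2 = r \<and> set_arr 7 3 0 a 7 3 = 0 \<and> progress r 0 (removed (set_arr 7 3 0 a))"
      using progress_start[OF removed_subset] by simp
  next
    fix a assume "sweep_inv a \<and> a 7 2 = r \<and> a 7 3 = n \<and> progress r n (removed a)"
    then show "a 7 2 = r \<and> sweep_inv (set_arr 7 2 (Suc r) a) \<and> set_arr 7 2 (Suc r) a 7 2 = Suc r \<and>
       (Suc r \<le> card (removed (set_arr 7 2 (Suc r) a)) \<or> removed (set_arr 7 2 (Suc r) a) = {..<n})"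
      unfolding progress_def by auto
  qed (auto simp: sweep_inv_def env_def)
next
  fix a assume a: "sweep_inv a \<and> a 7 2 = n \<and> (n \<le> card (removed a) \<or> removed a = {..<n})"
  then have "removed a = {..<n}"
    using card_seteq[OF _ removed_subset, of a] by auto
  then show "sweep_inv a \<and> removed a = {..<n}" using a by simp
qed (auto simp: sweep_inv_def env_def copied_def)

text \<open>Pairs are numbered row by row, \<open>p = v * n + u\<close>, so that both nested output
  loops extend one initial segment.\<close>

definition written :: "arrays \<Rightarrow> nat \<Rightarrow> arrays \<Rightarrow> bool" where
  "written a\<^sub>0 m a \<longleftrightarrow> (\<forall>p<m.
     a 8 (1 + 2 * p) = (if a\<^sub>0 2 (p div n) = p mod n then a\<^sub>0 3 (p div n) else 0) \<and>
     a 8 (2 + 2 * p) = (if a\<^sub>0 2 (p div n) = p mod n then a\<^sub>0 4 (p div n) else 1))"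

lemma written_set: "written a\<^sub>0 m (set_arr 7 i x a) = written a\<^sub>0 m a"
  unfolding written_def by simp

lemma written_Suc:
  assumes "written a\<^sub>0 m a"
    and "a' 8 = (a 8)(1 + 2 * m := if a\<^sub>0 2 (m div n) = m mod n then a\<^sub>0 3 (m div n) else 0,
      2 + 2 * m := if a\<^sub>0 2 (m div n) = m mod n then a\<^sub>0 4 (m div n) else 1)"
  shows "written a\<^sub>0 (Suc m) a'"
  unfolding written_def
proof (intro allI impI)
  fix p assume p: "p < Suc m"
  have "1 + 2 * p \<noteq> 2 + 2 * m" "2 + 2 * p \<noteq> 1 + 2 * m" by presburger+
  then show "a' 8 (1 + 2 * p) = (if a\<^sub>0 2 (p div n) = p mod n then a\<^sub>0 3 (p div n) else 0) \<and>
     a' 8 (2 + 2 * p) = (if a\<^sub>0 2 (p div n) = p mod n then a\<^sub>0 4 (p div n) else 1)"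
    using assms p unfolding written_def by (cases "p = m") auto
qed

lemma Output_prog:
  assumes "a\<^sub>0 7 0 = n"
  shows "triple (\<lambda>a. a = a\<^sub>0) Output_prog (\<lambda>a. a 7 0 = n \<and> written a\<^sub>0 (n * n) a)"
  unfolding Output_prog_def
proof -
  define keep where "keep a \<longleftrightarrow> a 2 = a\<^sub>0 2 \<and> a 3 = a\<^sub>0 3 \<and> a 4 = a\<^sub>0 4 \<and> a 7 0 = n" for a :: arrays
  have keep_set: "keep (set_arr 7 i x a) = keep a" if "0 < i" for i x a using that unfolding keep_def by simp
  show "triple (\<lambda>a. a = a\<^sub>0) (For 3 (For 4 (Cond (Differ (Arr 2 (Var 3)) (Var 4))
     (Seq (Store (Out_addr 1) (Lit 0)) (Store (Out_addr 2) (Lit 1)))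
     (Seq (Store (Out_addr 1) (Arr 3 (Var 3))) (Store (Out_addr 2) (Arr 4 (Var 3)))))))
     (\<lambda>a. a 7 0 = n \<and> written a\<^sub>0 (n * n) a)"
  proof (rule triple_For[where I = "\<lambda>v a. keep a \<and> a 7 3 = v \<and> written a\<^sub>0 (v * n) a"])
    fix v assume v: "v < n"
    show "triple (\<lambda>a. keep a \<and> a 7 3 = v \<and> written a\<^sub>0 (v * n) a)
      (For 4 (Cond (Differ (Arr 2 (Var 3)) (Var 4))
       (Seq (Store (Out_addr 1) (Lit 0)) (Store (Out_addr 2) (Lit 1)))
       (Seq (Store (Out_addr 1) (Arr 3 (Var 3))) (Store (Out_addr 2) (Arr 4 (Var 3))))))
      (\<lambda>a. a 7 3 = v \<and> keep (set_arr 7 3 (Suc v) a) \<and> set_arr 7 3 (Suc v) a 7 3 = Suc v \<and>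
        written a\<^sub>0 (Suc v * n) (set_arr 7 3 (Suc v) a))"
    proof (rule triple_For[where I = "\<lambda>u a. keep a \<and> a 7 3 = v \<and> a 7 4 = u \<and> written a\<^sub>0 (v * n + u) a"])
      fix u assume u: "u < n"
      define m where "m = v * n + u"
      have m: "m div n = v" "m mod n = u" "m < n * n"
        unfolding m_def using u index_less[OF v u] by simp_all
      define I where "I a \<longleftrightarrow> keep a \<and> a 7 3 = v \<and> a 7 4 = u \<and> written a\<^sub>0 m a" for a
      define Q where "Q a \<longleftrightarrow> a 7 4 = u \<and> keep (set_arr 7 4 (Suc u) a) \<and> set_arr 7 4 (Suc u) a 7 3 = v \<and>
          set_arr 7 4 (Suc u) a 7 4 = Suc u \<and> written a\<^sub>0 (v * n + Suc u) (set_arr 7 4 (Suc u) a)" for a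
      have addr: "val (Out_addr 1) a = 1 + 2 * m" "val (Out_addr 2) a = 2 + 2 * m" if "keep a" "a 7 3 = v" "a 7 4 = u" for a
        using that unfolding Out_addr_def m_def keep_def by simp_all
      have low: "1 + 2 * m < B" "2 + 2 * m < B" using m(3) room by linarith+
      \<comment> \<open>Both branches write a fraction in two stores. The guard \<open>C\<close> is
        known only before the first store, so the state \<open>b\<close> in which it held is
        remembered across it.\<close>
      have store2: "triple (\<lambda>a. I a \<and> C a) (Seq (Store (Out_addr 1) x) (Store (Out_addr 2) y)) Q"
        if x: "\<And>a. small a \<Longrightarrow> I a \<Longrightarrow> C a \<Longrightarrow> val x a < 2 ^ L \<and> val x a = (if a\<^sub>0 2 v = u then a\<^sub>0 3 v else 0)"
          and y: "\<And>a b. small a \<Longrightarrow> keep a \<Longrightarrow> a 7 3 = v \<Longrightarrow> a 7 4 = u \<Longrightarrow> I b \<Longrightarrow> C b \<Longrightarrow>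
             val y a < 2 ^ L \<and> val y a = (if a\<^sub>0 2 v = u then a\<^sub>0 4 v else 1)"
        for x y C
      proof (rule triple_Seq)
        show "triple (\<lambda>a. I a \<and> C a) (Store (Out_addr 1) x)
          (\<lambda>a. keep a \<and> a 7 3 = v \<and> a 7 4 = u \<and> (\<exists>b. I b \<and> C b \<and> a 8 = (b 8)(1 + 2 * m := if a\<^sub>0 2 v = u then a\<^sub>0 3 v else 0)))"
        proof (rule triple_set_low)
          fix a assume a: "small a" "I a \<and> C a"
          have "set_arr 8 (1 + 2 * m) z a 8 = (a 8)(1 + 2 * m := z)" for z by (simp add: set_arr_def)
          then show "0 < val (Out_addr 1) a \<and> val (Out_addr 1) a < B \<and> val x a < 2 ^ L \<and>
            keep (set_arr 8 (val (Out_addr 1) a) (val x a) a) \<and> set_arr 8 (val (Out_addr 1) a) (val x a) a 7 3 = v \<and>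
            set_arr 8 (val (Out_addr 1) a) (val x a) a 7 4 = u \<and>
            (\<exists>b. I b \<and> C b \<and> set_arr 8 (val (Out_addr 1) a) (val x a) a 8 = (b 8)(1 + 2 * m := if a\<^sub>0 2 v = u then a\<^sub>0 3 v else 0))"
            using a addr(1)[of a] low x[of a] unfolding I_def keep_def by auto
        qed
        show "triple (\<lambda>a. keep a \<and> a 7 3 = v \<and> a 7 4 = u \<and> (\<exists>b. I b \<and> C b \<and> a 8 = (b 8)(1 + 2 * m := if a\<^sub>0 2 v = u then a\<^sub>0 3 v else 0)))
          (Store (Out_addr 2) y) Q"
        proof (rule triple_set_low)
          fix a assume sm: "small a" and a: "keep a \<and> a 7 3 = v \<and> a 7 4 = u \<and> (\<exists>b. I b \<and> C b \<and> a 8 = (b 8)(1 + 2 * m := if a\<^sub>0 2 v = u then a\<^sub>0 3 v else 0))"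
          then obtain b where b: "I b" "C b" "a 8 = (b 8)(1 + 2 * m := if a\<^sub>0 2 v = u then a\<^sub>0 3 v else 0)" by blast
          have vy: "val y a < 2 ^ L" "val y a = (if a\<^sub>0 2 v = u then a\<^sub>0 4 v else 1)" using y[OF sm _ _ _ b(1,2)] a by simp_all
          have "written a\<^sub>0 (Suc m) (set_arr 8 (2 + 2 * m) (val y a) a)"
            by (rule written_Suc[of _ _ b]) (use b vy m in \<open>simp_all add: I_def set_arr_def\<close>)
          then show "0 < val (Out_addr 2) a \<and> val (Out_addr 2) a < B \<and> val y a < 2 ^ L \<and> Q (set_arr 8 (val (Out_addr 2) a) (val y a) a)"
            using a addr(2)[of a] low vy(1) unfolding Q_def keep_def by (simp add: written_set m_def)
        qed
      qed
      show "triple (\<lambda>a. keep a \<and> a 7 3 = v \<and> a 7 4 = u \<and> written a\<^sub>0 (v * n + u) a)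
        (Cond (Differ (Arr 2 (Var 3)) (Var 4))
         (Seq (Store (Out_addr 1) (Lit 0)) (Store (Out_addr 2) (Lit 1)))
         (Seq (Store (Out_addr 1) (Arr 3 (Var 3))) (Store (Out_addr 2) (Arr 4 (Var 3)))))
        (\<lambda>a. a 7 4 = u \<and> keep (set_arr 7 4 (Suc u) a) \<and> set_arr 7 4 (Suc u) a 7 3 = v \<and>
          set_arr 7 4 (Suc u) a 7 4 = Suc u \<and> written a\<^sub>0 (v * n + Suc u) (set_arr 7 4 (Suc u) a))"
        unfolding m_def[symmetric] I_def[symmetric] unfolding m_def Q_def[symmetric]
      proof (rule triple_Cond)
        show "triple (\<lambda>a. I a \<and> val (Differ (Arr 2 (Var 3)) (Var 4)) a \<noteq> 0) (Seq (Store (Out_addr 1) (Lit 0)) (Store (Out_addr 2) (Lit 1))) Q"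
          by (rule store2) (use one_small in \<open>auto simp: I_def keep_def val_Differ\<close>)
        show "triple (\<lambda>a. I a \<and> val (Differ (Arr 2 (Var 3)) (Var 4)) a = 0) (Seq (Store (Out_addr 1) (Arr 3 (Var 3))) (Store (Out_addr 2) (Arr 4 (Var 3)))) Q"
          by (rule store2) (auto simp: I_def keep_def val_Differ small_def; metis)+
      qed
    next
      fix a assume "keep a \<and> a 7 3 = v \<and> a 7 4 = n \<and> written a\<^sub>0 (v * n + n) a"
      then show "a 7 3 = v \<and> keep (set_arr 7 3 (Suc v) a) \<and> set_arr 7 3 (Suc v) a 7 3 = Suc v \<and>
        written a\<^sub>0 (Suc v * n) (set_arr 7 3 (Suc v) a)"
        by (simp add: keep_set written_set add.commute)
    qed (auto simp: keep_set written_set keep_def)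
  qed (auto simp: keep_set written_set keep_def assms written_def)
qed

lemma Main_prog:
  "triple (\<lambda>a. a 8 = inp \<and> (\<forall>v. a 1 v = 0)) Main_prog
     (\<lambda>a. a 7 0 = n \<and> (\<exists>rem \<sigma>. reachable {..<n} rem \<sigma> \<and> (\<forall>v<n. \<forall>u<n.
        a 8 (1 + 2 * (v * n + u)) = (if \<sigma> v = u then par v 4 else 0) \<and>
        a 8 (2 + 2 * (v * n + u)) = (if \<sigma> v = u then par v 5 else 1))))"
  unfolding Main_prog_def
proof (intro triple_Seq)
  show "triple (\<lambda>a. a 8 = inp \<and> (\<forall>v. a 1 v = 0)) (SetVar 0 (Deref (Lit 1))) (\<lambda>a. a 8 = inp \<and> a 7 0 = n \<and> (\<forall>v. a 1 v = 0))"
  proof (rule triple_set)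
    fix a :: arrays assume "a 8 = inp \<and> (\<forall>v. a 1 v = 0)"
    moreover have "val (Deref (Lit 1)) a = a 8 1" using val_low[of "Lit 1" a] room by simp
    ultimately show "val (Deref (Lit 1)) a < 2 ^ L \<and> set_arr 7 (val (Lit 0) a) (val (Deref (Lit 1)) a) a 8 = inp \<and>
        set_arr 7 (val (Lit 0) a) (val (Deref (Lit 1)) a) a 7 0 = n \<and> (\<forall>v. set_arr 7 (val (Lit 0) a) (val (Deref (Lit 1)) a) a 1 v = 0)"
      using inp_n n by simp
  qed simp
  show "triple (\<lambda>a. a 8 = inp \<and> a 7 0 = n \<and> (\<forall>v. a 1 v = 0)) Scale_prog (\<lambda>a. env a \<and> (\<forall>v. a 1 v = 0))"
    by (rule Scale_prog)
  show "triple (\<lambda>a. env a \<and> (\<forall>v. a 1 v = 0)) Init_prog sweep_inv"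
  proof (rule triple_conseq[OF Init_prog])
    fix a assume a: "env a \<and> (\<forall>v. a 1 v = 0) \<and> copied n a \<and> (\<forall>v<n. a 0 v = W v \<and> a 2 v = v)"
    then have "removed a = {}" unfolding removed_def by simp
    moreover have "reachable {} (a 0) (a 2)" using a by (intro reachable_start) auto
    ultimately show "sweep_inv a" using a unfolding sweep_inv_def by auto
  qed
  show "triple sweep_inv Sweep_prog (\<lambda>a. sweep_inv a \<and> removed a = {..<n})" by (rule Sweep_prog)
  show "triple (\<lambda>a. sweep_inv a \<and> removed a = {..<n}) Output_prog (\<lambda>a. a 7 0 = n \<and> (\<exists>rem \<sigma>. reachable {..<n} rem \<sigma> \<and> (\<forall>v<n. \<forall>u<n.
        a 8 (1 + 2 * (v * n + u)) = (if \<sigma> v = u then par v 4 else 0) \<and>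
        a 8 (2 + 2 * (v * n + u)) = (if \<sigma> v = u then par v 5 else 1))))"
  proof (rule triple_ghost)
    fix a\<^sub>0 assume a0: "sweep_inv a\<^sub>0 \<and> removed a\<^sub>0 = {..<n}"
    show "triple (\<lambda>a. a = a\<^sub>0) Output_prog (\<lambda>a. a 7 0 = n \<and> (\<exists>rem \<sigma>. reachable {..<n} rem \<sigma> \<and> (\<forall>v<n. \<forall>u<n.
        a 8 (1 + 2 * (v * n + u)) = (if \<sigma> v = u then par v 4 else 0) \<and>
        a 8 (2 + 2 * (v * n + u)) = (if \<sigma> v = u then par v 5 else 1))))"
    proof (rule triple_conseq[OF Output_prog])
      show "a\<^sub>0 7 0 = n" using a0 unfolding sweep_inv_def env_def by simp
      fix a assume a: "a 7 0 = n \<and> written a\<^sub>0 (n * n) a"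
      have "a 8 (1 + 2 * (v * n + u)) = (if a\<^sub>0 2 v = u then par v 4 else 0) \<and>
        a 8 (2 + 2 * (v * n + u)) = (if a\<^sub>0 2 v = u then par v 5 else 1)" if "v < n" "u < n" for v u
      proof -
        have "written a\<^sub>0 (n * n) a" using a by simp
        note this[unfolded written_def, rule_format, OF index_less[OF that]]
        moreover have "(v * n + u) div n = v" "(v * n + u) mod n = u" using that by simp_all
        moreover have "a\<^sub>0 3 v = par v 4" "a\<^sub>0 4 v = par v 5"
          using a0 that unfolding sweep_inv_def copied_def by simp_all
        ultimately show ?thesis by simp
      qed
      then show "a 7 0 = n \<and> (\<exists>rem \<sigma>. reachable {..<n} rem \<sigma> \<and> (\<forall>v<n. \<forall>u<n.
        a 8 (1 + 2 * (v * n + u)) = (if \<sigma> v = u then par v 4 else 0) \<and>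
        a 8 (2 + 2 * (v * n + u)) = (if \<sigma> v = u then par v 5 else 1)))"
        using a a0 unfolding sweep_inv_def by (intro conjI exI[of _ "a\<^sub>0 0"] exI[of _ "a\<^sub>0 2"]) auto
    qed simp
  qed
qed

end

subsection \<open>Encoded instances\<close>

definition Base :: ram_exp where
  "Base = Add (Add (Mul (Lit 2) (Mul (Deref (Lit 1)) (Deref (Lit 1)))) (Mul (Lit 6) (Deref (Lit 1)))) (Lit 2)"

text \<open>Cell 0 changes its role twice: the length of the input is replaced by the base address,
  computed while the memory is still the raw input, and at the end by the length of the
  output.\<close>

definition Solver :: ram_prog where
  "Solver = Seq (Store (Lit 0) Base)
     (Seq Main_prog (Store (Lit 0) (Mul (Lit 2) (Mul (Var 0) (Var 0)))))"

lemma bit_length_le_bit_size: "i < length xs \<Longrightarrow> bit_length (xs ! i) \<le> bit_size xs"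
  unfolding bit_size_def by (rule member_le_sum_list) simp_all

lemma nth_less_bit_size: "i < length xs \<Longrightarrow> xs ! i < 2 ^ bit_size xs"
  by (rule less_le_trans[OF less_two_power_bit_length power_increasing]) (simp_all add: bit_length_le_bit_size)

lemma length_le_bit_size: "length xs \<le> bit_size xs"
  unfolding bit_size_def using bit_length_pos sum_list_mono[of xs "\<lambda>_. 1" bit_length]
  by (simp add: sum_list_triv)

lemma bit_size_le: "(\<And>x. x \<in> set xs \<Longrightarrow> x < 2 ^ L) \<Longrightarrow> 1 \<le> L \<Longrightarrow> bit_size xs \<le> length xs * L"
  unfolding bit_size_def using sum_list_mono[of xs bit_length "\<lambda>_. L"] bit_length_le
  by (simp add: sum_list_triv)

locale encoded_instance =
  fixes G :: "nat cap_graph" and xs :: "nat list" and n :: nat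
  assumes inst: "cap_instance G" and planar: "planar G" and vs: "verts G = {..<n}"
    and len: "length xs = 1 + n * n + 6 * n" and xs0: "xs ! 0 = n"
    and adjacency: "\<And>u v. u < n \<Longrightarrow> v < n \<Longrightarrow> xs ! (1 + u * n + v) = (if {u, v} \<in> edges G then 1 else 0)"
    and fractions: "\<And>v. v < n \<Longrightarrow> let k = 1 + n * n + 6 * v in
           is_fraction (cost G v) (xs ! k) (xs ! (k + 1)) \<and>
           is_fraction (capacity G v) (xs ! (k + 2)) (xs ! (k + 3)) \<and>
           is_fraction (demand G v) (xs ! (k + 4)) (xs ! (k + 5))"
begin

definition b :: nat where "b = bit_size xs"
text \<open>The scale is a product of at most \<open>b\<close> factors, each made of three numbers
  of \<open>b\<close> bits, hence \<open>3 * b * b\<close>. A service cost multiplies it by three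
  more such numbers, hence \<open>3 * b\<close>. The constant leaves room for adding an opening cost
  and for the base address.\<close>

definition L :: nat where "L = poly [:4, 3, 3:] b"
definition B :: nat where "B = 2 * (n * n) + 6 * n + 2"

abbreviation inp :: memory where "inp \<equiv> input_memory xs"
abbreviation par :: "nat \<Rightarrow> nat \<Rightarrow> nat" where "par \<equiv> par_at n inp"
abbreviation den :: "nat \<Rightarrow> nat" where "den \<equiv> den_at n inp"
abbreviation M :: nat where "M \<equiv> scale_at n inp"
abbreviation W :: "nat \<Rightarrow> nat" where "W \<equiv> open_cost n inp"
abbreviation R :: "nat \<Rightarrow> nat \<Rightarrow> nat" where "R \<equiv> serve_cost n inp"

lemma L_eq: "L = 4 + 3 * b + 3 * (b * b)"
  unfolding L_def by (simp add: algebra_simps)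

lemma n_le_b: "n \<le> b" "1 \<le> b"
  using length_le_bit_size[of xs] unfolding len b_def by linarith+

lemma input_small: "input_memory xs i < 2 ^ b"
proof -
  have "length xs < 2 ^ b" using length_le_bit_size[of xs] less_exp[of b] unfolding b_def by linarith
  then show ?thesis using nth_less_bit_size[of "i - 1" xs] unfolding input_memory_def b_def[symmetric] by auto
qed

lemma par_eq: "v < n \<Longrightarrow> j < 6 \<Longrightarrow> par v j = xs ! (1 + n * n + 6 * v + j)"
  unfolding par_at_def input_memory_def len by (auto simp: algebra_simps)

lemma par_small: "par v j < 2 ^ b"
  unfolding par_at_def by (rule input_small)

lemma par_fraction:
  assumes "v < n"
  shows "par v 1 \<noteq> 0" "par v 3 \<noteq> 0" "par v 5 \<noteq> 0" "cost G v = par v 0 / par v 1"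
    "capacity G v = par v 2 / par v 3" "demand G v = par v 4 / par v 5"
  using fractions[OF assms] par_eq[OF assms, of 0] par_eq[OF assms, of 1] par_eq[OF assms, of 2]
    par_eq[OF assms, of 3] par_eq[OF assms, of 4] par_eq[OF assms, of 5]
  by (simp_all add: Let_def is_fraction_def)

lemma den_pos: "v < n \<Longrightarrow> 0 < den v"
  unfolding den_at_def using par_fraction[of v] by (cases "par v 2") auto

lemma M_pos: "0 < M"
  unfolding scale_at_def using den_pos by (intro prod_pos) auto

lemma two_power_b: "2 \<le> (2::nat) ^ b"
  using power_increasing[of 1 b "2::nat"] n_le_b(2) by simp

lemma den_prod_le: "k \<le> n \<Longrightarrow> (\<Prod>v<k. den v) \<le> 2 ^ (3 * (b * b))"
proof -
  assume k: "k \<le> n"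
  have "den v \<le> 2 ^ (3 * b)" for v
  proof -
    have "par v 2 + (1 - par v 2) \<le> 2 ^ b" using par_small[of v 2] two_power_b by (cases "par v 2") auto
    then have "den v \<le> 2 ^ b * 2 ^ b * 2 ^ b"
      unfolding den_at_def using par_small[of v 1] par_small[of v 5] by (intro mult_le_mono) auto
    also have "\<dots> = 2 ^ (3 * b)" by (simp flip: power_add)
    finally show ?thesis .
  qed
  then have "(\<Prod>v<k. den v) \<le> (\<Prod>v<k. 2 ^ (3 * b))" by (intro prod_mono) auto
  also have "\<dots> = 2 ^ (3 * b * k)" by (simp flip: power_mult)
  also have "\<dots> \<le> 2 ^ (3 * (b * b))" using k n_le_b(1) by (intro power_increasing) (auto simp: mult.assoc)
  finally show ?thesis .
qed

lemma M_le: "M \<le> 2 ^ (3 * (b * b))"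
  unfolding scale_at_def using den_prod_le[of n] by simp

lemma small_powers: "k \<le> 3 * b + 3 + 3 * (b * b) \<Longrightarrow> (2::nat) ^ k < 2 ^ L"
  unfolding L_eq by (intro power_strict_increasing) auto

lemma WR_small: "W u + R v u < 2 ^ L"
proof -
  have p: "par v j \<le> 2 ^ b" for v j using par_small[of v j] by simp
  have "W u \<le> M * par u 0" unfolding open_cost_def by (rule div_le_dividend)
  also have "\<dots> \<le> 2 ^ (3 * (b * b)) * 2 ^ b" by (intro mult_le_mono M_le p)
  also have "\<dots> \<le> 2 ^ (3 * b + 3 * (b * b))" unfolding power_add[symmetric] by (intro power_increasing) auto
  finally have 1: "W u \<le> 2 ^ (3 * b + 3 * (b * b))" .
  have "R v u \<le> M * par v 4 * par u 0 * par u 3" unfolding serve_cost_def by (rule div_le_dividend)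
  also have "\<dots> \<le> 2 ^ (3 * (b * b)) * 2 ^ b * 2 ^ b * 2 ^ b" by (intro mult_le_mono M_le p)
  also have "\<dots> = 2 ^ (3 * b + 3 * (b * b))" unfolding power_add[symmetric] by (rule arg_cong[of _ _ "power 2"]) simp
  finally have "W u + R v u \<le> 2 ^ Suc (3 * b + 3 * (b * b))" using 1 by simp
  also have "\<dots> < 2 ^ L" by (rule small_powers) simp
  finally show ?thesis .
qed

lemma B_small: "B < 2 ^ L"
proof -
  define x :: nat where "x = 2 ^ b"
  have nx: "n \<le> x" using n_le_b(1) less_exp[of b] unfolding x_def by linarith
  have x2: "2 \<le> x" using two_power_b unfolding x_def .
  have "n * n \<le> x * x" using nx by (intro mult_le_mono)
  moreover have "n * 2 \<le> x * x" using nx x2 by (intro mult_le_mono)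
  moreover have "2 * 2 \<le> x * x" using x2 by (intro mult_le_mono)
  ultimately have "B \<le> 6 * (x * x)" unfolding B_def by linarith
  also have "\<dots> < 2 ^ 3 * (x * x)" using x2 by simp
  also have "\<dots> = 2 ^ (3 + b + b)" unfolding x_def power_add by simp
  also have "\<dots> < 2 ^ L" by (rule small_powers) simp
  finally show ?thesis .
qed

lemma den_dvd_M: "u < n \<Longrightarrow> den u dvd M"
  unfolding scale_at_def by (intro dvd_prodI) auto

lemma W_scaled:
  assumes "u < n"
  shows "real (W u) = real M * cost G u"
proof -
  have "par u 1 dvd M" using den_dvd_M[OF assms] unfolding den_at_def by (metis dvd_mult_left)
  then show ?thesis
    unfolding open_cost_def par_fraction(4)[OF assms] by (simp add: real_of_nat_div)
qed

lemma R_scaled: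
  assumes "u < n" "v < n" "capacity G u \<noteq> 0"
  shows "real (R v u) = real M * (demand G v * (cost G u / capacity G u))"
proof -
  have c: "par u 2 \<noteq> 0" using assms(3) par_fraction(5)[OF assms(1)] by auto
  then have du: "den u = par u 1 * par u 2 * par u 5" unfolding den_at_def by simp
  \<comment> \<open>For distinct \<open>u\<close> and \<open>v\<close> the divisor is spread over
    the two factors \<open>den v\<close> and \<open>den u\<close> of the scale; for equal ones it
    already divides \<open>den u\<close>. This makes the quotient exact.\<close>
  have "par v 5 * par u 1 * par u 2 dvd M"
  proof (cases "u = v")
    case True
    then show ?thesis using den_dvd_M[OF assms(1)] unfolding du by (simp add: mult_ac)
  next
    case False
    have "M = den u * (den v * (\<Prod>w\<in>{..<n} - {u} - {v}. den w))"
      unfolding scale_at_def using assms False by (simp add: prod.remove[of "{..<n}" u] prod.remove[of "{..<n} - {u}" v])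
    then have "den v * den u dvd M" by (simp add: mult_ac)
    moreover have "par v 5 dvd den v" unfolding den_at_def by simp
    moreover have "par u 1 * par u 2 dvd den u" unfolding du by simp
    ultimately show ?thesis unfolding mult.assoc by (meson mult_dvd_mono dvd_trans)
  qed
  then have "par v 5 * par u 1 * par u 2 dvd M * par v 4 * par u 0 * par u 3" by (simp add: mult.assoc)
  then have "real (R v u) = real (M * par v 4 * par u 0 * par u 3) / real (par v 5 * par u 1 * par u 2)"
    unfolding serve_cost_def by (rule real_of_nat_div)
  then show ?thesis
    unfolding par_fraction(4,5)[OF assms(1)] par_fraction(6)[OF assms(2)]
    using c par_fraction(1-3)[OF assms(1)] par_fraction(1-3)[OF assms(2)] by (simp add: field_simps)
qed

lemma machine: "machine B L n G (real M) inp"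
proof unfold_locales
  show "0 < B" unfolding B_def by simp
  show "B < 2 ^ L" by (rule B_small)
  have "n \<le> B" unfolding B_def by simp
  then show "n < 2 ^ L" using B_small by simp
  show "1 \<le> L" unfolding L_eq by simp
  show "inp 1 = n" using xs0 len by (simp add: input_memory_def)
  show "2 * (n * n) + 6 * n + 2 \<le> B" unfolding B_def by simp
  show "(inp (2 + (v * n + u)) \<noteq> 0) = ({v, u} \<in> edges G)" if "u < n" "v < n" for u v
    using adjacency[OF that(2,1)] index_less[OF that(2,1)] len by (simp add: input_memory_def)
  show "\<exists>v\<in>A. card {u \<in> A. {v, u} \<in> edges G} \<le> 15" if "A \<subseteq> {..<n}" "A \<noteq> {}" for A
    using planar_small_degree[OF inst planar] that vs by simp
  show "(par u 2 \<noteq> 0) = (capacity G u \<noteq> 0)" if "u < n" for u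
    using par_fraction[OF that] by simp
  show "(par v 4 \<noteq> 0) = (demand G v \<noteq> 0)" if "v < n" for v
    using par_fraction[OF that] by simp
  show "inp i < 2 ^ L" for i
    by (rule less_trans[OF input_small small_powers]) simp
  show "(\<Prod>v<k. den v) < 2 ^ L" if "k \<le> n" for k
    by (rule le_less_trans[OF den_prod_le[OF that] small_powers]) simp
  show "W u + R v u < 2 ^ L" for u v by (rule WR_small)
  show "real (W u) = real M * cost G u" if "u < n" for u by (rule W_scaled[OF that])
  show "real (R v u) = real M * (demand G v * (cost G u / capacity G u))" if "u < n" "v < n" "capacity G u \<noteq> 0" for u v
    by (rule R_scaled[OF that])
qed (use inst vs M_pos in auto)

definition start :: arrays where
  "start j = (if j = 8 then inp else (\<lambda>_. 0))"

text \<open>The input ends before \<open>B\<close>, so all cells from there on are zero; in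
  particular no vertex is marked as eliminated.\<close>

lemma layout_start: "inp(0 := B) = layout B start"
proof
  fix i
  show "(inp(0 := B)) i = layout B start i"
  proof (cases "i < B")
    case False
    have "(i - B) mod 8 \<noteq> 8" by (metis mod_less_divisor nat_less_le zero_less_numeral)
    moreover have "inp i = 0" using False unfolding input_memory_def len B_def by auto
    ultimately show ?thesis using False unfolding layout_def start_def by auto
  qed (simp add: layout_def start_def)
qed

lemma Solver_correct:
  "\<exists>t ys f. ram_computes Solver xs t ys \<and> t \<le> time_bound b L Solver + 2 * (b * b) * L \<and>
     encodes_assignment ys G f \<and> feasible G f \<and>
     (\<forall>f'. feasible G f' \<longrightarrow> assignment_cost G f \<le> ereal 306 * assignment_cost G f')"
proof -
  interpret m: machine B L n G "real M" inp by (rule machine)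
  have val_Base: "exp_val Base inp = B"
    using xs0 len unfolding Base_def B_def by (simp add: input_memory_def)
  have time_Base: "exp_time Base inp \<le> exp_weight Base * L" "exp_time (Lit 0) inp \<le> exp_weight (Lit 0) * L"
    using exp_weight_bounds[of inp L Base] exp_weight_bounds[of inp L "Lit 0"] m.inp_small m.L by simp_all
  have run0: "ram_run (Store (Lit 0) Base) inp (1 + exp_time (Lit 0) inp + exp_time Base inp) (layout B start)"
    using ram_run.Store[of "Lit 0" Base inp] val_Base layout_start by simp
  have "m.small start" using m.inp_small unfolding m.small_def start_def by simp
  then obtain t a rem \<sigma> where run1: "ram_run Main_prog (layout B start) t (layout B a)" "t \<le> time_bound n L Main_prog"
    and a: "m.small a" "a 7 0 = n" and re: "m.reachable {..<n} rem \<sigma>"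
    and out: "\<forall>v<n. \<forall>u<n.
        a 8 (1 + 2 * (v * n + u)) = (if \<sigma> v = u then par v 4 else 0) \<and>
        a 8 (2 + 2 * (v * n + u)) = (if \<sigma> v = u then par v 5 else 1)"
    using m.Main_prog[unfolded m.triple_def, rule_format, of start] by (auto simp: start_def)
  define e where "e = Mul (Lit 2) (Mul (Var 0) (Var 0))"
  have val_e: "exp_val e (layout B a) = 2 * (n * n)"
    using a(2) unfolding e_def m.val_def[symmetric] by simp
  define s where "s = (layout B a)(0 := 2 * (n * n))"
  have run2: "ram_run (Store (Lit 0) e) (layout B a) (1 + exp_time (Lit 0) (layout B a) + exp_time e (layout B a)) s"
    using ram_run.Store[of "Lit 0" e "layout B a"] val_e unfolding s_def by simp
  define T where "T = (1 + exp_time (Lit 0) inp + exp_time Base inp) + (t + (1 + exp_time (Lit 0) (layout B a) + exp_time e (layout B a)))"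
  have run: "ram_run Solver inp T s"
    using ram_run.Seq[OF run0 ram_run.Seq[OF run1(1) run2]] unfolding Solver_def T_def e_def .
  have T: "T \<le> time_bound n L Solver"
    using time_Base run1(2) m.exp_time_le[OF a(1), of e] m.exp_time_le[OF a(1), of "Lit 0"]
    unfolding T_def Solver_def e_def[symmetric] time_bound.simps by linarith
  define ys where "ys = output_list s"
  have len_ys: "length ys = 2 * (n * n)" unfolding ys_def output_list_def s_def by simp
  have nth_ys: "ys ! k = a 8 (k + 1)" if "k < 2 * (n * n)" for k
  proof -
    have "ys ! k = s (k + 1)"
      using that len_ys unfolding ys_def output_list_def by (simp del: upt_Suc)
    then show ?thesis using that unfolding s_def B_def layout_def by simp
  qed
  have "x < 2 ^ L" if "x \<in> set ys" for x
    using that nth_ys len_ys a(1) unfolding in_set_conv_nth m.small_def by auto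
  then have "bit_size ys \<le> 2 * (n * n) * L"
    using bit_size_le[of ys L] len_ys m.L by simp
  also have "\<dots> \<le> 2 * (b * b) * L" using n_le_b(1) by (intro mult_le_mono) auto
  finally have size: "bit_size ys \<le> 2 * (b * b) * L" .
  have "ram_computes Solver xs (T + bit_size ys) ys"
    unfolding ram_computes_def using run ys_def by blast
  moreover have "T + bit_size ys \<le> time_bound b L Solver + 2 * (b * b) * L"
    using T size time_bound_mono[OF n_le_b(1), of L Solver] by linarith
  moreover have "encodes_assignment ys G (m.assign \<sigma>)"
    unfolding encodes_assignment_def
  proof (intro exI[of _ n] conjI allI impI)
    fix v u assume v: "v < n" and u: "u < n"
    have i: "v * n + u < n * n" by (rule index_less[OF v u])
    have "ys ! (2 * (v * n + u)) = (if \<sigma> v = u then par v 4 else 0)"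
      "ys ! (2 * (v * n + u) + 1) = (if \<sigma> v = u then par v 5 else 1)"
      using nth_ys[of "2 * (v * n + u)"] nth_ys[of "2 * (v * n + u) + 1"] i out[rule_format, OF v u] by simp_all
    then show "let k = 2 * (v * n + u) in is_fraction (m.assign \<sigma> v u) (ys ! k) (ys ! (k + 1))"
      using par_fraction[OF v] unfolding Let_def is_fraction_def m.assign_def by simp
  qed (use vs len_ys in auto)
  \<comment> \<open>The constant is (15 + 2) * (15 + 3).\<close>
  moreover have "assignment_cost G (m.assign \<sigma>) \<le> ereal 306 * assignment_cost G f'" if "feasible G f'" for f'
    using m.assign_approx[OF re that] by simp
  moreover have "feasible G (m.assign \<sigma>)"
    by (rule m.reachable_feasible[OF re])
  ultimately show ?thesis by blast
qed

end

theorem theorem13: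
  "\<exists>\<alpha>::real. \<alpha> \<ge> 1 \<and>
     (\<exists>(P :: ram_prog) (p :: nat poly).
        \<forall>(G :: nat cap_graph) xs.
          cap_instance G \<and> planar G \<and> encodes_instance xs G \<longrightarrow>
            (\<exists>t ys f.
               ram_computes P xs t ys \<and> t \<le> poly p (bit_size xs) \<and>
               encodes_assignment ys G f \<and> feasible G f \<and>
               (\<forall>f'. feasible G f' \<longrightarrow> assignment_cost G f \<le> ereal \<alpha> * assignment_cost G f')))"
proof -
  obtain q where q: "\<And>x. time_bound x (poly [:4, 3, 3:] x) Solver = poly q x"
    using time_bound_poly by blast
  \<comment> \<open>The second summand pays for the size of the output: at most
    \<open>2 * (x * x)\<close> numbers of \<open>L\<close> bits.\<close>
  define p where "p = q + 2 * ([:0, 1:] * [:0, 1:]) * [:4, 3, 3:]"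
  have p: "poly p x = time_bound x (poly [:4, 3, 3:] x) Solver + 2 * (x * x) * poly [:4, 3, 3:] x" for x
    unfolding p_def q poly_add poly_mult by simp
  show ?thesis
  proof (intro exI[of _ "306 :: real"] exI[of _ Solver] exI[of _ p] conjI allI impI)
    fix G :: "nat cap_graph" and xs
    assume asm: "cap_instance G \<and> planar G \<and> encodes_instance xs G"
    then obtain n where "encoded_instance G xs n"
      unfolding encodes_instance_def encoded_instance_def by blast
    then interpret encoded_instance G xs n .
    show "\<exists>t ys f. ram_computes Solver xs t ys \<and> t \<le> poly p (bit_size xs) \<and>
               encodes_assignment ys G f \<and> feasible G f \<and>
               (\<forall>f'. feasible G f' \<longrightarrow> assignment_cost G f \<le> ereal 306 * assignment_cost G f')"
      using Solver_correct unfolding p b_def L_def .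
  qed simp
qed

end
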